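(* Let $n\ge1$, let $k_1,\dots,k_n\ge0$ be integers, and let $T^n,T^{k_1(1)},\dots,T^{k_n(n)}$ be $n$-, $k_1$-, $\dots$, $k_n$-punctured ball tangle diagrams, respectively. For each $j\in\{1,\dots,n\}$ write $$F^{k_j}(T^{k_j(j)})=\left[\begin{matrix} b^j_{11}&\cdots&b^j_{12^{k_j}}\\ b^j_{21}&\cdots&b^j_{22^{k_j}}\end{matrix}\right].$$ Then $$F^{k_1+\cdots+k_n}\bigl(T^n(T^{k_1(1)},\dots,T^{k_n(n)})\bigr)=F^n(T^n)\,[\eta^n]\bigl(F^{k_1}(T^{k_1(1)}),\dots,F^{k_n}(T^{k_n(n)})\bigr),$$ where $[\eta^n]\bigl(F^{k_1}(T^{k_1(1)}),\dots,F^{k_n}(T^{k_n(n)})\bigr)$ is the class modulo $\pm1$ of the $2^n\times2^{k_1+\cdots+k_n}$ matrix whose $(r,s)$ entry is $\prod_{j=1}^n b^j_{\alpha^n_{rj}\,\gamma_{sj}}$. Here $\alpha^n_r=(\alpha^n_{r1},\dots,\alpha^n_{rn})$ is the $r$-th element of $\{1,2\}^n$ in lexicographic order and $\gamma_s=(\gamma_{s1},\dots,\gamma_{sn})$ is the $s$-th element of $\prod_{j=1}^n\{1,\dots,2^{k_j}\}$ in lexicographic order.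
   Context: Tangles: let $H_0$ be a closed 3-ball and $H_1,\dots,H_n$ pairwise disjoint closed 3-balls in the interior of $H_0$, all centered in the $xy$-plane; on each $\partial H_k$ ($0\le k\le n$) fix four points NW, NE, SW, SE in the $xy$-plane. An $n$-punctured ball tangle is a properly embedded compact 1-submanifold $T$ of $X=H_0-\bigcup_{i=1}^n\mathrm{Int}(H_i)$ whose boundary is exactly the set of these $4(n+1)$ points, considered up to homeomorphism of $X$ fixing $\partial X$ pointwise and isotopic to the identity rel $\partial X$, and represented by diagrams in the $xy$-plane. For $n=0$ these are ball tangles. $T^n(T^{k_1(1)},\dots,T^{k_n(n)})$ is the $(k_1+\cdots+k_n)$-punctured ball tangle obtained by filling the $i$-th hole of $T^n$ with $T^{k_i(i)}$ for each $i$; its holes are ordered with those of $T^{k_1(1)}$ first (in their order), then those of $T^{k_2(2)}$, and so on. Kauffman bracket: let $A=e^{i\pi/4}$ and $\Phi=\{z\in\mathbb C:z^8=1\}$. At a crossing of a link diagram the two regions swept by rotating the over-strand counterclockwise are the $A$-regions, the other two the $B$-regions; $A$-type (resp. $B$-type) splitting opens a channel joining the two $A$-regions (resp. $B$-regions). A state $\sigma$ chooses a splitting at each crossing; $\alpha(\sigma),\beta(\sigma)$ are the numbers of $A$-type and $B$-type splittings and $d(\sigma)$ the number of resulting circles. $\langle L\rangle=\sum_{\sigma:\,d(\sigma)=1}A^{\alpha(\sigma)-\beta(\sigma)}$. Invariant: the fundamental tangle $1$ consists of two vertical arcs (NW to SW, NE to SE), the fundamental tangle $2$ of two horizontal arcs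 (NW to NE, SW to SE). The numerator closure (index $1$) joins NW to NE and SW to SE outside the ball without crossings; the denominator closure (index $2$) joins NW to SW and NE to SE. For $m\ge0$, an $m$-punctured ball tangle diagram $T$, $j\in\{1,2\}$ and $\alpha\in\{1,2\}^m$, $T_{j\alpha}$ is the link diagram obtained by filling the $i$-th hole of $T$ with the fundamental tangle $\alpha_i$ for each $i$ and taking the closure of index $j$. Let $\alpha^m_1<\cdots<\alpha^m_{2^m}$ be the elements of $\{1,2\}^m$ in lexicographic order, and let $t_k$ be the number of entries of $\alpha^m_k$ equal to $2$. $F^m(T)$ is the set of integer matrices among $zX(T)$, $z\in\Phi$, where $X(T)$ is the $2\times2^m$ matrix with $(1,k)$ entry $(-i)^{t_k}\langle T_{1\alpha^m_k}\rangle$ and $(2,k)$ entry $(-i)^{t_k}i\langle T_{2\alpha^m_k}\rangle$; this set has the form $\{M,-M\}$, i.e. is an element $[M]$ of $PM_{2\times2^m}(\mathbb Z)=M_{2\times2^m}(\mathbb Z)/\pm1$. Square brackets denote classes of matrices modulo $\pm1$, and products of classes are defined by $[M][N]=[MN]$. *)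

theory Defs
  imports
    Complex_Main
    "HOL-Library.List_Lexorder"
    "Jordan_Normal_Form.Matrix"
begin

section \<open>Planar diagrams\<close>

text \<open>
  A diagram in the punctured disc is recorded by its underlying plane graph.  The vertices are the
  crossings, the boundary circle of each hole, the boundary circle of the big disc, and finitely
  many regular points of the strands, called joints.  Cutting the diagram at the vertices leaves
  arcs, and an arc is the set of its two ends.  Joints are bivalent; they allow closed strands
  without crossings to be represented, and they are the places where diagrams are glued.
  Only the cyclic order of the ends around each vertex is kept, so the relative position of
  different connected components of the diagram is forgotten.
\<close>

datatype corner = NW | NE | SW | SE

text \<open>The four ends at a crossing in counterclockwise order; \<open>O1\<close>, \<open>O2\<close> are on the over-strand.\<close>

datatype leg = O1 | U1 | O2 | U2

datatype 'v end_point =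
    Out corner
  | Hole nat corner
  | Cr 'v leg
  | Jt 'v bool

record 'v diagram =
  crossings :: "'v set"
  joints :: "'v set"
  arcs :: "'v end_point set set"

text \<open>
  The number of classes into which \<open>E\<close> falls when all elements of each member of \<open>P\<close> are identified.
\<close>

definition num_classes :: "'a set \<Rightarrow> 'a set set \<Rightarrow> nat" where
  "num_classes E P = card (E // {(x, y). \<exists>p\<in>P. x \<in> p \<and> y \<in> p}\<^sup>*)"

text \<open>
  The successor of an end in the counterclockwise order around its vertex, on the sphere obtained
  by collapsing each hole and the exterior of the big disc to a point.  Seen from the exterior the
  sense of rotation is reversed, hence the difference between \<open>Out\<close> and \<open>Hole\<close>.
\<close>

fun rot :: "'v end_point \<Rightarrow> 'v end_point" where
  "rot (Out p) = Out (case p of NW \<Rightarrow> NE | NE \<Rightarrow> SE | SE \<Rightarrow> SW | SW \<Rightarrow> NW)"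
| "rot (Hole h p) = Hole h (case p of NW \<Rightarrow> SW | SW \<Rightarrow> SE | SE \<Rightarrow> NE | NE \<Rightarrow> NW)"
| "rot (Cr c l) = Cr c (case l of O1 \<Rightarrow> U1 | U1 \<Rightarrow> O2 | O2 \<Rightarrow> U2 | U2 \<Rightarrow> O1)"
| "rot (Jt v s) = Jt v (\<not> s)"

definition vertices :: "nat \<Rightarrow> 'v diagram \<Rightarrow> 'v end_point set set" where
  "vertices n T = {range Out} \<union> (\<lambda>h. range (Hole h)) ` {..<n}
     \<union> (\<lambda>c. range (Cr c)) ` crossings T \<union> (\<lambda>v. range (Jt v)) ` joints T"

text \<open>The pairs of ends that are consecutive on the boundary of a face.\<close>

definition face_steps :: "'v diagram \<Rightarrow> 'v end_point set set" where
  "face_steps T = {{x, rot y} | x y. x \<noteq> y \<and> {x, y} \<in> arcs T}"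

text \<open>
  Planarity is Euler's formula \<open>V - E + F = 2 C\<close>.  Each of the \<open>C\<close> connected components
  contributes at most 2 to the left-hand side, so equality says that every component has genus 0.
\<close>

definition tangle_diagram :: "nat \<Rightarrow> 'v diagram \<Rightarrow> bool" where
  "tangle_diagram n T \<longleftrightarrow>
     finite (crossings T) \<and> finite (joints T) \<and>
     partition_on (\<Union> (vertices n T)) (arcs T) \<and> (\<forall>a\<in>arcs T. card a = 2) \<and>
     int (card (vertices n T)) - int (card (arcs T))
       + int (num_classes (\<Union> (vertices n T)) (face_steps T))
     = 2 * int (num_classes (\<Union> (vertices n T)) (vertices n T \<union> arcs T))"


section \<open>Filling holes and closing up\<close>

datatype ('v, 'w) glued = Base 'v | Filling nat 'w | Seam nat corner

fun embed_base :: "'v end_point \<Rightarrow> ('v, 'w) glued end_point" where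
  "embed_base (Out p) = Out p"
| "embed_base (Hole j p) = Jt (Seam j p) True"
| "embed_base (Cr c l) = Cr (Base c) l"
| "embed_base (Jt v s) = Jt (Base v) s"

fun embed_filling :: "nat \<Rightarrow> nat \<Rightarrow> 'w end_point \<Rightarrow> ('v, 'w) glued end_point" where
  "embed_filling d j (Out p) = Jt (Seam j p) False"
| "embed_filling d j (Hole h p) = Hole (d + h) p"
| "embed_filling d j (Cr c l) = Cr (Filling j c) l"
| "embed_filling d j (Jt v s) = Jt (Filling j v) s"

text \<open>
  Holes are numbered from 0: hole \<open>j < n\<close> of \<open>T\<close> is filled with the \<open>k j\<close>-punctured diagram \<open>S j\<close>.
\<close>

definition fill :: "nat \<Rightarrow> (nat \<Rightarrow> nat) \<Rightarrow> 'v diagram \<Rightarrow> (nat \<Rightarrow> 'w diagram) \<Rightarrow> ('v, 'w) glued diagram"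
  where
  "fill n k T S =
    \<lparr> crossings = Base ` crossings T \<union> (\<Union>j<n. Filling j ` crossings (S j)),
      joints = Base ` joints T \<union> (\<Union>j<n. Filling j ` joints (S j)) \<union> {Seam j p | j p. j < n},
      arcs = (\<lambda>a. embed_base ` a) ` arcs T
        \<union> (\<Union>j<n. (\<lambda>a. embed_filling (\<Sum>i<j. k i) j ` a) ` arcs (S j)) \<rparr>"

definition fundamental :: "nat \<Rightarrow> unit diagram" where
  "fundamental i =
    \<lparr> crossings = {}, joints = {},
      arcs = (if i = 1 then {{Out NW, Out SW}, {Out NE, Out SE}}
              else {{Out NW, Out NE}, {Out SW, Out SE}}) \<rparr>"

fun embed_closed :: "'v end_point \<Rightarrow> ('v + corner) end_point" where
  "embed_closed (Out p) = Jt (Inr p) True"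
| "embed_closed (Hole j p) = Hole j p"
| "embed_closed (Cr c l) = Cr (Inl c) l"
| "embed_closed (Jt v s) = Jt (Inl v) s"

definition outer_arc :: "corner \<Rightarrow> corner \<Rightarrow> ('v + corner) end_point set" where
  "outer_arc p q = {Jt (Inr p) False, Jt (Inr q) False}"

text \<open>Index 1 is the numerator closure, index 2 the denominator closure.\<close>

definition close_up :: "nat \<Rightarrow> 'v diagram \<Rightarrow> ('v + corner) diagram" where
  "close_up i T =
    \<lparr> crossings = Inl ` crossings T,
      joints = Inl ` joints T \<union> range Inr,
      arcs = (\<lambda>a. embed_closed ` a) ` arcs T
        \<union> (if i = 1 then {outer_arc NW NE, outer_arc SW SE}
           else {outer_arc NW SW, outer_arc NE SE}) \<rparr>"

definition closed_filling ::
    "nat \<Rightarrow> 'v diagram \<Rightarrow> nat \<Rightarrow> nat list \<Rightarrow> (('v, unit) glued + corner) diagram" where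
  "closed_filling m T i \<alpha> = close_up i (fill m (\<lambda>_. 0) T (\<lambda>h. fundamental (\<alpha> ! h)))"


section \<open>The Kauffman bracket\<close>

text \<open>
  The A-regions are the sectors from \<open>O1\<close> to \<open>U1\<close> and from \<open>O2\<close> to \<open>U2\<close>, so after the
  channel between them is opened \<open>U1\<close> is connected to \<open>O2\<close> and \<open>U2\<close> to \<open>O1\<close>.
\<close>

definition A_splitting :: "'v \<Rightarrow> 'v end_point set set" where
  "A_splitting c = {{Cr c U1, Cr c O2}, {Cr c U2, Cr c O1}}"

definition B_splitting :: "'v \<Rightarrow> 'v end_point set set" where
  "B_splitting c = {{Cr c O1, Cr c U1}, {Cr c O2, Cr c U2}}"

text \<open>
  A state of a link diagram (a diagram without \<open>Out\<close> and \<open>Hole\<close> ends) is given by the set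
  \<open>\<sigma>\<close> of crossings at which the A-type splitting is chosen.
\<close>

definition num_circles :: "'v diagram \<Rightarrow> 'v set \<Rightarrow> nat" where
  "num_circles L \<sigma> =
     num_classes ((\<Union>c\<in>crossings L. range (Cr c)) \<union> (\<Union>v\<in>joints L. range (Jt v)))
       (arcs L \<union> (\<lambda>v. range (Jt v)) ` joints L
        \<union> (\<Union>c\<in>\<sigma>. A_splitting c) \<union> (\<Union>c\<in>crossings L - \<sigma>. B_splitting c))"

definition bracket :: "'v diagram \<Rightarrow> complex" where
  "bracket L = (\<Sum>\<sigma> | \<sigma> \<subseteq> crossings L \<and> num_circles L \<sigma> = 1.
     cis (pi / 4) powi (int (card \<sigma>) - int (card (crossings L - \<sigma>))))"


section \<open>The invariant\<close>

text \<open>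
  \<open>lex_nth B r\<close> is the element of \<open>B\<close> with 0-based position \<open>r\<close> in the lexicographic order.
\<close>

definition lex_nth :: "nat list set \<Rightarrow> nat \<Rightarrow> nat list" where
  "lex_nth B r = sorted_list_of_set B ! r"

definition alpha :: "nat \<Rightarrow> nat \<Rightarrow> nat list" where
  "alpha m = lex_nth (listset (replicate m {1, 2}))"

definition gamma :: "nat \<Rightarrow> (nat \<Rightarrow> nat) \<Rightarrow> nat \<Rightarrow> nat list" where
  "gamma n k = lex_nth (listset (map (\<lambda>j. {1..2 ^ k j}) [0..<n]))"

text \<open>Rows and columns of matrices are numbered from 0.\<close>

definition X :: "nat \<Rightarrow> 'v diagram \<Rightarrow> complex mat" where
  "X m T = mat 2 (2 ^ m) (\<lambda>(r, s).
     (- \<i>) ^ count_list (alpha m s) 2 * (if r = 0 then 1 else \<i>)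
       * bracket (closed_filling m T (r + 1) (alpha m s)))"

definition F :: "nat \<Rightarrow> 'v diagram \<Rightarrow> int mat set" where
  "F m T = {M. \<exists>z::complex. z ^ 8 = 1 \<and> map_mat of_int M = z \<cdot>\<^sub>m X m T}"

text \<open>Elements of \<open>M(\<int>)/\<plusminus>1\<close> are the sets \<open>pm_class M\<close>.\<close>

definition pm_class :: "int mat \<Rightarrow> int mat set" where
  "pm_class M = {M, - M}"

definition pm_times :: "int mat set \<Rightarrow> int mat set \<Rightarrow> int mat set" where
  "pm_times P Q = (\<Union>M\<in>P. \<Union>N\<in>Q. pm_class (M * N))"

definition eta :: "nat \<Rightarrow> (nat \<Rightarrow> nat) \<Rightarrow> (nat \<Rightarrow> int mat) \<Rightarrow> int mat" where
  "eta n k b = mat (2 ^ n) (2 ^ (\<Sum>j<n. k j)) (\<lambda>(r, s).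
     \<Prod>j<n. b j $$ (alpha n r ! j - 1, gamma n k s ! j - 1))"

text \<open>
  The operation induced on classes; independence of the representatives is
  \<open>pm_eta_pm_class\<close> below.
\<close>

definition pm_eta :: "nat \<Rightarrow> (nat \<Rightarrow> nat) \<Rightarrow> (nat \<Rightarrow> int mat set) \<Rightarrow> int mat set" where
  "pm_eta n k C = (\<Union>b\<in>{b. \<forall>j<n. b j \<in> C j}. pm_class (eta n k b))"


lemma pm_times_pm_class:
  assumes "M \<in> carrier_mat a b" and "N \<in> carrier_mat b c"
  shows "pm_times (pm_class M) (pm_class N) = pm_class (M * N)"
  using assms by (auto simp: pm_times_def pm_class_def)

lemma listset_conv: "xs \<in> listset As \<longleftrightarrow> length xs = length As \<and> (\<forall>i<length As. xs ! i \<in> As ! i)"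
proof (induction As arbitrary: xs)
  case Nil
  then show ?case by simp
next
  case (Cons A As)
  show ?case
  proof (cases xs)
    case Nil
    then show ?thesis by (simp add: set_Cons_def)
  next
    case (Cons y ys)
    then show ?thesis using Cons.IH[of ys] by (auto simp: set_Cons_def nth_Cons split: nat.splits)
  qed
qed

lemma finite_card_listset:
  assumes "\<forall>A\<in>set As. finite A"
  shows "finite (listset As) \<and> card (listset As) = (\<Prod>A\<leftarrow>As. card A)"
  using assms
proof (induction As)
  case Nil
  then show ?case by simp
next
  case (Cons A As)
  have eq: "listset (A # As) = (\<lambda>(x, xs). x # xs) ` (A \<times> listset As)"
    by (auto simp: set_Cons_def)
  have "inj_on (\<lambda>(x, xs). x # xs) (A \<times> listset As)"
    by (auto simp: inj_on_def)
  then have "card (listset (A # As)) = card (A \<times> listset As)"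
    unfolding eq by (rule card_image)
  moreover have "finite (listset (A # As))"
    unfolding eq using Cons by auto
  ultimately show ?case using Cons by (simp add: card_cartesian_product)
qed

lemma lex_nth_in: "finite B \<Longrightarrow> r < card B \<Longrightarrow> lex_nth B r \<in> B"
  unfolding lex_nth_def
  by (metis nth_mem set_sorted_list_of_set length_sorted_list_of_set)

lemma alpha_nth:
  assumes "r < 2 ^ n" "j < n"
  shows "alpha n r ! j \<in> {1, 2}"
proof -
  have "finite (listset (replicate n {1, 2::nat})) \<and> card (listset (replicate n {1, 2::nat})) = 2 ^ n"
    using finite_card_listset[of "replicate n {1, 2::nat}"]
    by (auto simp: prod_list_replicate numeral_2_eq_2[symmetric])
  then have "alpha n r \<in> listset (replicate n {1, 2})"
    unfolding alpha_def using assms(1) by (intro lex_nth_in) auto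
  then show ?thesis using assms(2) by (auto simp: listset_conv)
qed

lemma gamma_nth:
  assumes "s < 2 ^ (\<Sum>j<n. k j)" "j < n"
  shows "gamma n k s ! j \<in> {1..2 ^ k j}"
proof -
  let ?B = "listset (map (\<lambda>j. {1..2 ^ k j}) [0..<n]) :: nat list set"
  have "(\<Prod>j\<leftarrow>[0..<n]. 2 ^ k j) = (2::nat) ^ (\<Sum>j<n. k j)"
    by (induction n) (simp_all add: power_add mult.commute)
  then have "finite ?B \<and> card ?B = 2 ^ (\<Sum>j<n. k j)"
    using finite_card_listset[of "map (\<lambda>j. {1..2 ^ k j}) [0..<n] :: nat set list"]
    by (simp add: o_def)
  then have "gamma n k s \<in> ?B"
    unfolding gamma_def using assms(1) by (intro lex_nth_in) auto
  then show ?thesis using assms(2) by (auto simp: listset_conv)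
qed

lemma pm_eta_pm_class:
  assumes dim: "\<And>j. j < n \<Longrightarrow> b j \<in> carrier_mat 2 (2 ^ k j)"
    and C: "\<And>j. j < n \<Longrightarrow> C j = pm_class (b j)"
  shows "pm_eta n k C = pm_class (eta n k b)"
proof -
  have "pm_class (eta n k b') = pm_class (eta n k b)" if b': "\<forall>j<n. b' j \<in> C j" for b'
  proof -
    define \<epsilon> :: "nat \<Rightarrow> int" where "\<epsilon> j = (if b' j = b j then 1 else - 1)" for j
    have entry: "b' j $$ (p, q) = \<epsilon> j * b j $$ (p, q)" if "j < n" "p < 2" "q < 2 ^ k j" for j p q
      using b' C[OF that(1)] dim[OF that(1)] that by (auto simp: pm_class_def \<epsilon>_def)
    have "eta n k b' $$ (r, s) = (\<Prod>j<n. \<epsilon> j) * eta n k b $$ (r, s)"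
      if rs: "r < 2 ^ n" "s < 2 ^ (\<Sum>j<n. k j)" for r s
    proof -
      have "b' j $$ (alpha n r ! j - 1, gamma n k s ! j - 1)
          = \<epsilon> j * b j $$ (alpha n r ! j - 1, gamma n k s ! j - 1)" if "j < n" for j
        using alpha_nth[OF rs(1) that] gamma_nth[OF rs(2) that] by (intro entry[OF that]) auto
      then show ?thesis using rs by (simp add: eta_def prod.distrib[symmetric])
    qed
    moreover have "(\<Prod>j<n. \<epsilon> j) \<in> {1, - 1}"
      by (induction n) (auto simp: \<epsilon>_def)
    ultimately have "eta n k b' = eta n k b \<or> eta n k b' = - eta n k b"
      by (elim insertE emptyE) (simp_all add: mat_eq_iff eta_def)
    then show ?thesis by (auto simp: pm_class_def)
  qed
  moreover have "\<forall>j<n. b j \<in> C j" using C by (simp add: pm_class_def)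
  ultimately show ?thesis unfolding pm_eta_def by blast
qed

end

(*
  Splitting a crossing, filling a hole with a fundamental tangle and closing up are all of the same
  kind: at each vertex the four ends are joined in pairs of cyclic neighbours.  Planarity enters
  through a checkerboard colouring of the faces, i.e. a 2-colouring of the ends for which both arcs
  and such pairings join opposite colours; by Euler's formula it exists, as a cohomology computation
  over the field with two elements shows.

  With the colouring, the circles of a state are the cycles of a permutation of the ends of one
  colour, and changing one pairing composes it with a transposition.  So all states with one circle
  have the same parity, which makes X(T) integral up to one common 8th root of unity.  The colouring
  also forbids a state of a filling to join opposite corners.  Hence each state of a filling either
  has a closed component, and then does not contribute, or behaves like exactly one fundamental
  tangle, namely the one whose index is that of the closure of the state with one circle.  Summing
  over the types of all fillings gives the formula for brackets.  The phases match because the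
  factor (-i)^t for the types of the holes of T cancels the factors i in the second rows of the
  matrices of the fillings.
*)

theory Submission
  imports Defs "HOL-Combinatorics.Permutations"
begin

section \<open>Two-valued functions and connectedness\<close>

text \<open>The value A = e^(i pi/4) makes the usual weight - A^2 - A^(-2) of an extra circle
  vanish; so only states with one circle count, and switching a splitting from B to A multiplies the
  weight by A^2 = i. Circles are therefore never counted. A single circle means that every
  two-valued function respecting arcs and pairings is constant. Such functions restrict to the
  pieces of a filled diagram and glue along its seams, whereas classes of ends of different types
  would have to be compared directly. For the colouring, the obstacle is that planarity is given
  only as a numerical equation. It is used through cardinalities: sets of ends form a vector space
  over the field with two elements, one inclusion of subspaces says that a boundary has no boundary,
  and Euler's formula forces the sizes to agree.\<close>

definition const_on :: "('a \<Rightarrow> bool) \<Rightarrow> 'a set \<Rightarrow> bool" where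
  "const_on f A \<longleftrightarrow> (\<forall>x\<in>A. \<forall>y\<in>A. f x = f y)"

definition compat :: "('a \<Rightarrow> bool) \<Rightarrow> 'a set set \<Rightarrow> bool" where
  "compat f P \<longleftrightarrow> (\<forall>p\<in>P. const_on f p)"

lemma const_onD: "const_on f A \<Longrightarrow> x \<in> A \<Longrightarrow> y \<in> A \<Longrightarrow> f x = f y"
  unfolding const_on_def by blast

lemma const_on_pair [simp]: "const_on f {x, y} \<longleftrightarrow> f x = f y"
  by (auto simp: const_on_def)

lemma const_on_image: "const_on f (g ` A) \<longleftrightarrow> const_on (\<lambda>x. f (g x)) A"
  by (auto simp: const_on_def)

lemma compat_Un [simp]: "compat f (P \<union> Q) \<longleftrightarrow> compat f P \<and> compat f Q"
  by (auto simp: compat_def)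

lemma compat_UN [simp]: "compat f (\<Union>i\<in>I. P i) \<longleftrightarrow> (\<forall>i\<in>I. compat f (P i))"
  by (auto simp: compat_def)

lemma compat_insert [simp]: "compat f (insert p P) \<longleftrightarrow> const_on f p \<and> compat f P"
  by (auto simp: compat_def)

lemma compat_empty [simp]: "compat f {}"
  by (auto simp: compat_def)

lemma compat_image: "compat f (g ` I) \<longleftrightarrow> (\<forall>i\<in>I. const_on f (g i))"
  by (auto simp: compat_def)

definition linked :: "'a set set \<Rightarrow> ('a \<times> 'a) set" where
  "linked P = {(x, y). \<exists>p\<in>P. x \<in> p \<and> y \<in> p}\<^sup>*"

lemma linked_refl: "(x, x) \<in> linked P"
  by (simp add: linked_def)

lemma linked_trans: "(x, y) \<in> linked P \<Longrightarrow> (y, z) \<in> linked P \<Longrightarrow> (x, z) \<in> linked P"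
  unfolding linked_def by (rule rtrancl_trans)

lemma linkedI: "p \<in> P \<Longrightarrow> x \<in> p \<Longrightarrow> y \<in> p \<Longrightarrow> (x, y) \<in> linked P"
  unfolding linked_def by (rule r_into_rtrancl) blast

lemma linked_sym: "(x, y) \<in> linked P \<Longrightarrow> (y, x) \<in> linked P"
proof -
  have "sym (linked P)"
    unfolding linked_def by (rule sym_rtrancl) (auto simp: sym_def)
  then show "(x, y) \<in> linked P \<Longrightarrow> (y, x) \<in> linked P" by (rule symD)
qed

lemma compat_linked:
  assumes "compat f P" "(x, y) \<in> linked P"
  shows "f x = f y"
  using assms(2) unfolding linked_def
proof (induction rule: rtrancl_induct)
  case (step y z)
  then obtain p where "p \<in> P" "y \<in> p" "z \<in> p" by blast
  then have "f y = f z" using assms(1) const_onD by (metis compat_def)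
  then show ?case using step by simp
qed simp

lemma compat_reachable: "compat (\<lambda>y. (x, y) \<in> linked P) P"
  unfolding compat_def const_on_def using linkedI linked_trans by metis

text \<open>The indicator of the class of a point is a compatible function and separates that class
  from all others. This trades every count of circles for a statement about functions.\<close>

lemma num_classes_eq_1_iff:
  "num_classes E P = 1 \<longleftrightarrow> E \<noteq> {} \<and> (\<forall>f. compat f P \<longrightarrow> const_on f E)"
proof
  assume "num_classes E P = 1"
  then obtain C where C: "E // linked P = {C}"
    unfolding num_classes_def linked_def[symmetric] by (auto simp: card_1_singleton_iff)
  have "(x, y) \<in> linked P" if "x \<in> E" "y \<in> E" for x y
  proof -
    have "linked P `` {x} = C" "linked P `` {y} = C"
      using C quotientI[OF that(1), of "linked P"] quotientI[OF that(2), of "linked P"] by simp_all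
    then show ?thesis using linked_refl[of y P] by blast
  qed
  moreover have "E \<noteq> {}" using C by (metis insert_not_empty quotient_empty)
  ultimately show "E \<noteq> {} \<and> (\<forall>f. compat f P \<longrightarrow> const_on f E)"
    unfolding const_on_def by (simp add: compat_linked)
next
  assume *: "E \<noteq> {} \<and> (\<forall>f. compat f P \<longrightarrow> const_on f E)"
  then obtain x where x: "x \<in> E" by blast
  have xy: "(x, y) \<in> linked P" if "y \<in> E" for y
    using * compat_reachable[of x P] x that const_onD[of "\<lambda>y. (x, y) \<in> linked P" E x y] linked_refl[of x P] by simp
  have "linked P `` {y} = linked P `` {x}" if "y \<in> E" for y
  proof -
    have "(y, x) \<in> linked P" using xy[OF that] by (rule linked_sym)
    then show ?thesis using xy[OF that] by (auto elim: linked_trans)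
  qed
  then have "E // linked P = {linked P `` {x}}"
    using x unfolding quotient_def by blast
  then show "num_classes E P = 1" unfolding num_classes_def linked_def[symmetric] by simp
qed

section \<open>Counting invariant sets\<close>

text \<open>Compatible functions written as subsets of \<open>E\<close>, so that they can be added
  by symmetric difference and counted: for finite \<open>E\<close> the cardinality is 2 to the
  dimension over the field with two elements.\<close>

definition inv_sets :: "'a set \<Rightarrow> 'a set set \<Rightarrow> 'a set set" where
  "inv_sets E P = {A. A \<subseteq> E \<and> compat (\<lambda>x. x \<in> A) P}"

lemma inv_sets_Un: "inv_sets E (P \<union> Q) = inv_sets E P \<inter> inv_sets E Q"
  by (auto simp: inv_sets_def)

lemma card_inv_sets_partition:
  assumes "partition_on E P" and "finite P"
  shows "card (inv_sets E P) = 2 ^ card P"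
proof -
  have "inv_sets E P = \<Union> ` Pow P"
  proof (intro equalityI subsetI)
    fix A assume A: "A \<in> inv_sets E P"
    have E: "E = \<Union> P" by (rule partition_onD1[OF assms(1)])
    have sub: "p \<subseteq> A" if p: "p \<in> P" "x \<in> p" "x \<in> A" for p x
    proof
      fix y assume "y \<in> p"
      moreover have "const_on (\<lambda>x. x \<in> A) p"
        using A p by (simp add: inv_sets_def compat_def)
      ultimately show "y \<in> A" using p const_onD by metis
    qed
    have "A = \<Union> {p \<in> P. p \<inter> A \<noteq> {}}"
    proof (intro equalityI subsetI)
      fix x assume x: "x \<in> A"
      then have "x \<in> \<Union> P" using A E by (auto simp: inv_sets_def)
      then show "x \<in> \<Union> {p \<in> P. p \<inter> A \<noteq> {}}" using x by blast
    next
      fix x assume "x \<in> \<Union> {p \<in> P. p \<inter> A \<noteq> {}}"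
      then show "x \<in> A" using sub by blast
    qed
    then show "A \<in> \<Union> ` Pow P" by blast
  next
    fix A assume "A \<in> \<Union> ` Pow P"
    then obtain Q where Q: "A = \<Union> Q" "Q \<subseteq> P" by blast
    have "const_on (\<lambda>x. x \<in> A) p" if p: "p \<in> P" for p
    proof (cases "p \<in> Q")
      case True
      then have "p \<subseteq> A" using Q by blast
      then show ?thesis by (auto simp: const_on_def)
    next
      case False
      have "p \<inter> q = {}" if "q \<in> Q" for q
        using False that Q(2) p partition_onD2[OF assms(1)] disjointD by blast
      then have "p \<inter> A = {}" unfolding Q(1) by blast
      then show ?thesis by (auto simp: const_on_def)
    qed
    moreover have "A \<subseteq> E" using Q partition_onD1[OF assms(1)] by blast
    ultimately show "A \<in> inv_sets E P" by (auto simp: inv_sets_def compat_def)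
  qed
  moreover have "inj_on \<Union> (Pow P)"
  proof (rule inj_onI)
    fix Q R assume QR: "Q \<in> Pow P" "R \<in> Pow P" "\<Union> Q = \<Union> R"
    have "p \<in> R" if that: "p \<in> Q" "Q \<subseteq> P" "R \<subseteq> P" "\<Union> Q = \<Union> R" for p Q R
    proof -
      have "p \<noteq> {}" using that partition_onD3[OF assms(1)] by auto
      then obtain x where x: "x \<in> p" by blast
      then have "x \<in> \<Union> R" using that by blast
      then obtain q where q: "q \<in> R" "x \<in> q" by blast
      then have "p = q"
        using partition_onD2[OF assms(1)] that x by (metis disjoint_def disjoint_iff subsetD)
      then show ?thesis using q by simp
    qed
    from this[of _ Q R] this[of _ R Q] show "Q = R"
      using QR by (intro equalityI subsetI) (simp_all only: Pow_iff)
  qed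
  ultimately show ?thesis using assms(2) by (simp add: card_image card_Pow)
qed

lemma card_inv_sets:
  assumes "finite E" and "\<And>p. p \<in> P \<Longrightarrow> p \<subseteq> E"
  shows "card (inv_sets E P) = 2 ^ num_classes E P"
proof -
  let ?R = "linked P"
  have in_E: "y \<in> E" if "(x, y) \<in> ?R" "x \<in> E" for x y
    using that unfolding linked_def by (induction rule: rtrancl_induct) (use assms(2) in auto)
  \<comment> \<open>\<open>linked P\<close> is reflexive on the whole type. Cut down to
    \<open>E\<close> it is an equivalence on \<open>E\<close>, with the same classes because no
    member of \<open>P\<close> leaves \<open>E\<close>.\<close>
  let ?S = "?R \<inter> E \<times> E"
  have "equiv E ?S"
    by (rule equivI)
      (auto simp: refl_on_def sym_def trans_def linked_refl intro: linked_trans linked_sym)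
  moreover have q: "E // ?R = E // ?S"
    using in_E by (auto simp: quotient_def)
  ultimately have part: "partition_on E (E // ?R)"
    using partition_on_quotient by metis
  have "compat (\<lambda>x. x \<in> A) P \<longleftrightarrow> compat (\<lambda>x. x \<in> A) (E // ?R)" for A
  proof
    assume "compat (\<lambda>x. x \<in> A) P"
    note * = compat_linked[OF this]
    show "compat (\<lambda>x. x \<in> A) (E // ?R)"
      unfolding compat_def const_on_def quotient_def by (auto dest: *)
  next
    assume r: "compat (\<lambda>x. x \<in> A) (E // ?R)"
    show "compat (\<lambda>x. x \<in> A) P"
      unfolding compat_def const_on_def
    proof (intro ballI)
      fix p x y assume p: "p \<in> P" "x \<in> p" "y \<in> p"
      have "?R `` {x} \<in> E // ?R" using p assms(2) by (auto simp: quotient_def)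
      moreover have "(x, y) \<in> ?R" using p by (rule linkedI)
      ultimately show "(x \<in> A) = (y \<in> A)"
        using r linked_refl[of x P] unfolding compat_def const_on_def by blast
    qed
  qed
  then have "inv_sets E P = inv_sets E (E // ?R)"
    by (auto simp: inv_sets_def)
  moreover have "finite (E // ?R)"
    using part assms(1) finite_elements by blast
  ultimately show ?thesis
    using card_inv_sets_partition[OF part] by (simp add: num_classes_def linked_def[symmetric])
qed

section \<open>Orthogonality over the field with two elements\<close>

definition symdiff :: "'a set \<Rightarrow> 'a set \<Rightarrow> 'a set" where
  "symdiff A B = (A - B) \<union> (B - A)"

lemma in_symdiff [simp]: "x \<in> symdiff A B \<longleftrightarrow> (x \<in> A) \<noteq> (x \<in> B)"
  by (auto simp: symdiff_def)

lemma symdiff_self [simp]: "symdiff A A = {}"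
  by (simp add: symdiff_def)

lemma symdiff_cancel [simp]: "symdiff (symdiff A B) B = A"
  by (auto simp: symdiff_def)

lemma even_card_symdiff:
  assumes "finite A" "finite B"
  shows "even (card (symdiff A B)) \<longleftrightarrow> (even (card A) \<longleftrightarrow> even (card B))"
proof -
  have "card (symdiff A B) = card (A - B) + card (B - A)"
    unfolding symdiff_def using assms by (intro card_Un_disjoint) auto
  moreover have "card A = card (A - B) + card (A \<inter> B)"
    using assms by (metis card_Diff_subset_Int card_mono finite_Int inf_le1 le_add_diff_inverse2)
  moreover have "card B = card (B - A) + card (A \<inter> B)"
    using assms by (metis card_Diff_subset_Int card_mono finite_Int inf_le1 inf_commute le_add_diff_inverse2)
  ultimately show ?thesis by (simp, blast)
qed

lemma even_card_involution:
  assumes "finite A" and "\<And>x. x \<in> A \<Longrightarrow> f x \<in> A \<and> f x \<noteq> x \<and> f (f x) = x"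
  shows "even (card A)"
  using assms
proof (induction A rule: finite_psubset_induct)
  case (psubset A)
  show ?case
  proof (cases "A = {}")
    case False
    then obtain x where x: "x \<in> A" by blast
    let ?A = "A - {x, f x}"
    have "even (card ?A)"
    proof (rule psubset.IH)
      show "?A \<subset> A" using x by blast
      fix y assume "y \<in> ?A"
      then show "f y \<in> ?A \<and> f y \<noteq> y \<and> f (f y) = y"
        using psubset.prems[of y] psubset.prems[OF x] by auto
    qed
    moreover have "card A = card ?A + card {x, f x}"
      using psubset.prems[OF x] x psubset.hyps
      by (subst card_Un_disjoint[symmetric]) (auto intro!: arg_cong[of _ _ card])
    moreover have "x \<noteq> f x" using psubset.prems[OF x] by metis
    then have "card {x, f x} = 2" by simp
    ultimately show ?thesis by simp
  qed simp
qed

definition subspace2 :: "'a set set \<Rightarrow> bool" where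
  "subspace2 U \<longleftrightarrow> {} \<in> U \<and> (\<forall>A\<in>U. \<forall>B\<in>U. symdiff A B \<in> U)"

lemma subspace2_inv_sets: "subspace2 (inv_sets E P)"
proof -
  have "symdiff A B \<in> inv_sets E P" if "A \<in> inv_sets E P" "B \<in> inv_sets E P" for A B
  proof -
    have "const_on (\<lambda>x. x \<in> symdiff A B) p" if "const_on (\<lambda>x. x \<in> A) p" "const_on (\<lambda>x. x \<in> B) p" for p
      unfolding const_on_def in_symdiff
      using const_onD[OF that(1)] const_onD[OF that(2)] by (intro ballI) metis
    moreover have "symdiff A B \<subseteq> E" using that by (auto simp: inv_sets_def)
    ultimately show ?thesis using that by (simp add: inv_sets_def compat_def)
  qed
  moreover have "{} \<in> inv_sets E P" by (simp add: inv_sets_def compat_def const_on_def)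
  ultimately show ?thesis by (simp add: subspace2_def)
qed

text \<open>The annihilator of \<open>U\<close> for the bilinear form that sends two sets to the
  parity of their intersection.\<close>

definition orth :: "'a set \<Rightarrow> 'a set set \<Rightarrow> 'a set set" where
  "orth E U = {B. B \<subseteq> E \<and> (\<forall>A\<in>U. even (card (A \<inter> B)))}"

text \<open>Translation by \<open>C\<close> permutes \<open>U\<close> and reverses every sign, so
  the sum is its own negative.\<close>

lemma sum_signs_zero:
  fixes s :: "'a set \<Rightarrow> int"
  assumes "\<And>A. A \<in> U \<Longrightarrow> symdiff A C \<in> U \<and> s (symdiff A C) = - s A"
  shows "sum s U = 0"
proof -
  have "bij_betw (\<lambda>A. symdiff A C) U U"
    by (rule bij_betw_byWitness[where f' = "\<lambda>A. symdiff A C"]) (use assms in auto)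
  then have "sum s U = (\<Sum>A\<in>U. s (symdiff A C))"
    using sum.reindex_bij_betw by metis
  also have "\<dots> = - sum s U"
    using assms by (simp add: sum_negf)
  finally show ?thesis by simp
qed

text \<open>
  Summing the characters \<open>(-1)\<^bsup>|A \<inter> B|\<^esup>\<close> over \<open>A \<in> U\<close> and all \<open>B\<close> in both orders gives
  \<open>|U| |U\<^sup>\<bottom>| = 2\<^bsup>|E|\<^esup>\<close>.
\<close>

lemma card_orth:
  assumes "finite E" "U \<subseteq> Pow E" "subspace2 U"
  shows "card U * card (orth E U) = 2 ^ card E"
proof -
  define s :: "'a set \<Rightarrow> 'a set \<Rightarrow> int" where "s A B = (if even (card (A \<inter> B)) then 1 else - 1)" for A B
  have fin: "finite A" if "A \<subseteq> E" for A using that assms(1) by (rule finite_subset)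
  have flip: "s (symdiff A C) B = - s A B" if "odd (card (C \<inter> B))" "A \<subseteq> E" "C \<subseteq> E" for A B C
  proof -
    have "symdiff A C \<inter> B = symdiff (A \<inter> B) (C \<inter> B)" by (auto simp: symdiff_def)
    then show ?thesis using that fin[of A] fin[of C] by (simp add: s_def even_card_symdiff)
  qed
  have comm: "s A B = s B A" for A B by (simp add: s_def Int_commute)
  have U: "A \<subseteq> E" if "A \<in> U" for A using that assms(2) by blast
  have finU: "finite U" using assms(1,2) finite_subset by blast
  \<comment> \<open>For fixed \<open>B\<close> the sign is a character of \<open>U\<close>: trivial
    if \<open>B\<close> is orthogonal to \<open>U\<close>, and otherwise summing to zero.\<close>
  have row: "(\<Sum>A\<in>U. s A B) = (if B \<in> orth E U then int (card U) else 0)" if B: "B \<subseteq> E" for B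
  proof (cases "B \<in> orth E U")
    case True
    then show ?thesis by (simp add: orth_def s_def)
  next
    case False
    then obtain C where C: "C \<in> U" "odd (card (C \<inter> B))" using B by (auto simp: orth_def)
    have "(\<Sum>A\<in>U. s A B) = 0"
      by (rule sum_signs_zero[where C = C]) (use C assms(3) flip U in \<open>auto simp: subspace2_def\<close>)
    then show ?thesis using False by simp
  qed
  have col: "(\<Sum>B\<in>Pow E. s A B) = (if A = {} then 2 ^ card E else 0)" if A: "A \<in> U" for A
  proof (cases "A = {}")
    case True
    then show ?thesis using assms(1) by (simp add: s_def card_Pow)
  next
    case False
    then obtain a where a: "a \<in> A" by blast
    have "(\<Sum>B\<in>Pow E. s A B) = 0"
    proof (rule sum_signs_zero[where C = "{a}"])
      fix B assume "B \<in> Pow E"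
      moreover have "a \<in> E" using a U[OF A] by blast
      ultimately show "symdiff B {a} \<in> Pow E \<and> s A (symdiff B {a}) = - s A B"
        using flip[of "{a}" A B] a comm by (auto simp: symdiff_def)
    qed
    then show ?thesis using False by simp
  qed
  have "(\<Sum>B\<in>Pow E. \<Sum>A\<in>U. s A B) = (\<Sum>B\<in>Pow E. if B \<in> orth E U then int (card U) else 0)"
    using row by (intro sum.cong) auto
  also have "\<dots> = int (card U) * int (card (orth E U))"
  proof -
    have "Pow E \<inter> orth E U = orth E U" by (auto simp: orth_def)
    then show ?thesis using assms(1) by (simp add: sum.If_cases mult.commute)
  qed
  finally have "int (card U) * int (card (orth E U)) = (\<Sum>A\<in>U. \<Sum>B\<in>Pow E. s A B)"
    by (subst sum.swap) simp
  also have "\<dots> = (\<Sum>A\<in>U. if A = {} then 2 ^ card E else 0)"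
    using col by (intro sum.cong) auto
  also have "\<dots> = 2 ^ card E"
    using finU assms(3) by (simp add: sum.delta subspace2_def)
  finally show ?thesis by (metis of_nat_mult of_nat_eq_iff of_nat_power of_nat_numeral)
qed

lemma card_le_fibres:
  assumes "finite G" and "\<And>a. a \<in> G \<Longrightarrow> card {b \<in> G. f b = f a} \<le> N"
  shows "card G \<le> card (f ` G) * N"
proof -
  have "card G = (\<Sum>y\<in>f ` G. card {b \<in> G. f b = y})"
    using sum.image_gen[OF assms(1), of "\<lambda>_. 1::nat" f] by simp
  also have "\<dots> \<le> (\<Sum>y\<in>f ` G. N)"
    by (rule sum_mono) (use assms(2) in auto)
  finally show ?thesis by simp
qed

text \<open>Translation maps each fibre injectively into the kernel. This is the half of the
  rank-nullity formula that bounds the image from below.\<close>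

lemma card_le_image_kernel:
  assumes "finite G" "subspace2 G"
    and hom: "\<And>A B. A \<in> G \<Longrightarrow> B \<in> G \<Longrightarrow> f (symdiff A B) = symdiff (f A) (f B)"
  shows "card G \<le> card (f ` G) * card {A \<in> G. f A = {}}"
proof (rule card_le_fibres[OF assms(1)])
  fix A assume A: "A \<in> G"
  show "card {B \<in> G. f B = f A} \<le> card {A \<in> G. f A = {}}"
  proof (rule card_inj_on_le[where f = "\<lambda>B. symdiff B A"])
    show "inj_on (\<lambda>B. symdiff B A) {B \<in> G. f B = f A}"
      by (rule inj_on_inverseI[where g = "\<lambda>B. symdiff B A"]) simp
    show "(\<lambda>B. symdiff B A) ` {B \<in> G. f B = f A} \<subseteq> {A \<in> G. f A = {}}"
      using A assms(2) by (auto simp: hom subspace2_def)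
  qed (use assms(1) in simp)
qed

text \<open>Two pairs with the same sum differ by an element of both subspaces, so a fibre of the
  sum map has at most \<open>card (U \<inter> W)\<close> elements.\<close>

lemma card_sum_subspaces:
  assumes "finite U" "finite W" "subspace2 U" "subspace2 W"
  shows "card U * card W \<le> card ((\<lambda>(A, B). symdiff A B) ` (U \<times> W)) * card (U \<inter> W)"
proof -
  have "card (U \<times> W) \<le> card ((\<lambda>(A, B). symdiff A B) ` (U \<times> W)) * card (U \<inter> W)"
  proof (rule card_le_fibres)
    fix a assume "a \<in> U \<times> W"
    then obtain A B where a: "a = (A, B)" "A \<in> U" "B \<in> W" by blast
    let ?F = "{b \<in> U \<times> W. (case b of (A, B) \<Rightarrow> symdiff A B) = (case a of (A, B) \<Rightarrow> symdiff A B)}"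
    show "card ?F \<le> card (U \<inter> W)"
    proof (rule card_inj_on_le[where f = "\<lambda>(A', B'). symdiff A' A"])
      have *: "symdiff A' A = symdiff B' B" if "symdiff A' B' = symdiff A B" for A' B'
        using that by (auto simp: set_eq_iff)
      have "inj_on (\<lambda>(A', B'). symdiff A' A) ?F"
      proof (rule inj_onI)
        fix x y
        assume xy: "x \<in> ?F" "y \<in> ?F" "(\<lambda>(A', B'). symdiff A' A) x = (\<lambda>(A', B'). symdiff A' A) y"
        obtain P Q R S where [simp]: "x = (P, Q)" "y = (R, S)" by fastforce
        have "P = R" using xy(3) by (auto simp: set_eq_iff)
        moreover have "Q = S" using xy a * by (auto simp: set_eq_iff)
        ultimately show "x = y" by simp
      qed
      then show "inj_on (\<lambda>(A', B'). symdiff A' A) ?F" .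
      show "(\<lambda>(A', B'). symdiff A' A) ` ?F \<subseteq> U \<inter> W"
      proof (intro image_subsetI)
        fix x assume x: "x \<in> ?F"
        obtain P Q where [simp]: "x = (P, Q)" by fastforce
        have "symdiff P A = symdiff Q B" using x a * by simp
        then show "(\<lambda>(A', B'). symdiff A' A) x \<in> U \<inter> W"
          using x a assms(3,4) unfolding subspace2_def by (metis (mono_tags, lifting) IntI \<open>x = (P, Q)\<close> case_prod_conv mem_Collect_eq mem_Sigma_iff)
      qed
    qed (use assms in simp)
  qed (use assms in simp)
  then show ?thesis by (simp add: card_cartesian_product)
qed

section \<open>Ends of a diagram\<close>

lemma UNIV_corner: "UNIV = {NW, NE, SW, SE}"
  using corner.exhaust by auto

lemma UNIV_leg: "UNIV = {O1, U1, O2, U2}"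
  using leg.exhaust by auto

lemma all_corner: "(\<forall>p. P p) \<longleftrightarrow> P NW \<and> P NE \<and> P SW \<and> P SE"
  by (metis corner.exhaust)

lemma finite_corner [simp]: "finite (A :: corner set)"
  by (rule finite_subset[OF subset_UNIV]) (simp add: UNIV_corner)

lemma finite_leg [simp]: "finite (A :: leg set)"
  by (rule finite_subset[OF subset_UNIV]) (simp add: UNIV_leg)

definition ends :: "nat \<Rightarrow> 'v diagram \<Rightarrow> 'v end_point set" where
  "ends n T = \<Union> (vertices n T)"

lemma ends_simps [simp]:
  "Out p \<in> ends n T"
  "Hole h p \<in> ends n T \<longleftrightarrow> h < n"
  "Cr c l \<in> ends n T \<longleftrightarrow> c \<in> crossings T"
  "Jt v s \<in> ends n T \<longleftrightarrow> v \<in> joints T"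
  by (auto simp: ends_def vertices_def image_iff)

lemma vertex_cases:
  assumes "v \<in> vertices n T"
  obtains "v = range Out" | h where "h < n" "v = range (Hole h)"
    | c where "c \<in> crossings T" "v = range (Cr c)" | j where "j \<in> joints T" "v = range (Jt j)"
  using assms unfolding vertices_def by blast

lemma partition_vertices: "partition_on (ends n T) (vertices n T)"
proof (rule partition_onI)
  show "\<Union> (vertices n T) = ends n T" by (simp add: ends_def)
  show "{} \<notin> vertices n T"
  proof
    assume "{} \<in> vertices n T"
    then show False by (elim vertex_cases) auto
  qed
  show "disjnt p q" if "p \<in> vertices n T" "q \<in> vertices n T" "p \<noteq> q" for p q
    using that by (elim vertex_cases) (auto simp: disjnt_def)
qed

section \<open>Arcs as an involution and vertices as orbits of the rotation\<close>

locale plane_tangle =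
  fixes n :: nat and T :: "'v diagram"
  assumes tangle: "tangle_diagram n T"
begin

abbreviation "E \<equiv> ends n T"

lemma finite_crossings [simp]: "finite (crossings T)"
  and finite_joints: "finite (joints T)"
  and partition_arcs: "partition_on E (arcs T)"
  and card_arc: "a \<in> arcs T \<Longrightarrow> card a = 2"
  using tangle by (auto simp: tangle_diagram_def ends_def)

lemma finite_vertices: "finite (vertices n T)"
  unfolding vertices_def using finite_joints by simp

lemma finite_ends: "finite E"
  unfolding ends_def
proof (rule finite_Union[OF finite_vertices])
  fix v assume "v \<in> vertices n T"
  then show "finite v" by (elim vertex_cases) auto
qed

lemma finite_arcs: "finite (arcs T)"
  using finite_elements[OF finite_ends partition_arcs] .

definition mate :: "'v end_point \<Rightarrow> 'v end_point" where
  "mate x = (THE y. y \<noteq> x \<and> {x, y} \<in> arcs T)"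

lemma arc_unique:
  assumes "{x, y} \<in> arcs T" "{x, z} \<in> arcs T" "x \<noteq> y" "x \<noteq> z"
  shows "y = z"
proof -
  have "{x, y} = {x, z}"
    using partition_onD2[OF partition_arcs] disjointD assms(1,2) by blast
  then show ?thesis using assms(3,4) by (metis doubleton_eq_iff)
qed

lemma mate_eqI:
  assumes "{x, y} \<in> arcs T" "x \<noteq> y"
  shows "mate x = y"
  unfolding mate_def using assms arc_unique by (intro the_equality) auto

lemma
  assumes "x \<in> E"
  shows mate_in [simp]: "mate x \<in> E" and mate_neq [simp]: "mate x \<noteq> x"
    and mate_arc: "{x, mate x} \<in> arcs T" and mate_mate [simp]: "mate (mate x) = x"
proof -
  obtain a where a: "a \<in> arcs T" "x \<in> a"
    using assms partition_onD1[OF partition_arcs] by blast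
  obtain y where y: "a = {x, y}" "x \<noteq> y"
  proof -
    obtain u v where uv: "a = {u, v}" "u \<noteq> v" using card_arc[OF a(1)] by (meson card_2_iff)
    then show ?thesis using a(2) that[of u] that[of v] by (metis empty_iff insert_commute insert_iff)
  qed
  have m: "mate x = y" using a(1) y by (simp add: mate_eqI)
  have "y \<in> E" using a(1) y(1) partition_onD1[OF partition_arcs] by blast
  then show "mate x \<in> E" "mate x \<noteq> x" "{x, mate x} \<in> arcs T" "mate (mate x) = x"
    using a y m mate_eqI[of y x] by (auto simp: insert_commute)
qed

lemma arcs_eq: "arcs T = (\<lambda>x. {x, mate x}) ` E"
proof (intro equalityI subsetI)
  fix a assume a: "a \<in> arcs T"
  obtain u v where uv: "a = {u, v}" "u \<noteq> v" using card_arc[OF a] by (meson card_2_iff)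
  then have "mate u = v" using a mate_eqI by simp
  moreover have "u \<in> E" using a uv(1) partition_onD1[OF partition_arcs] by blast
  ultimately show "a \<in> (\<lambda>x. {x, mate x}) ` E" using uv(1) by blast
qed (use mate_arc in auto)

lemma compat_arcs: "compat f (arcs T) \<longleftrightarrow> (\<forall>x\<in>E. f (mate x) = f x)"
  unfolding arcs_eq by (auto simp: compat_image)

lemma rot_vertex: "v \<in> vertices n T \<Longrightarrow> x \<in> v \<Longrightarrow> rot x \<in> v"
  by (elim vertex_cases) auto

lemma rot_in [simp]: "x \<in> E \<Longrightarrow> rot x \<in> E"
  unfolding ends_def using rot_vertex by blast

lemma rot_inj: "rot x = rot y \<Longrightarrow> x = y"
  by (cases x; cases y) (auto split: corner.splits leg.splits)

text \<open>The rotation runs through all ends of a vertex, so invariance under a single turn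
  already gives constancy there.\<close>

lemma compat_vertices:
  "compat f (vertices n T) \<longleftrightarrow> (\<forall>x\<in>E. f (rot x) = f x)"
proof
  assume *: "compat f (vertices n T)"
  show "\<forall>x\<in>E. f (rot x) = f x"
  proof
    fix x assume "x \<in> E"
    then obtain v where v: "v \<in> vertices n T" "x \<in> v" unfolding ends_def by blast
    then have "const_on f v" using * by (simp add: compat_def)
    then show "f (rot x) = f x" using v rot_vertex const_onD by metis
  qed
next
  assume *: "\<forall>x\<in>E. f (rot x) = f x"
  have "const_on f v" if v: "v \<in> vertices n T" for v
  proof -
    have r: "f (rot x) = f x" if "x \<in> v" for x
      using * that v unfolding ends_def by blast
    show ?thesis using v
    proof (cases rule: vertex_cases)
      case 1
      then show ?thesis
        using r[of "Out NW"] r[of "Out NE"] r[of "Out SW"] r[of "Out SE"]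
        by (simp add: const_on_image UNIV_corner) (simp add: const_on_def)
    next
      case (2 h)
      then show ?thesis
        using r[of "Hole h NW"] r[of "Hole h NE"] r[of "Hole h SW"] r[of "Hole h SE"]
        by (simp add: const_on_image UNIV_corner) (simp add: const_on_def)
    next
      case (3 c)
      then show ?thesis
        using r[of "Cr c O1"] r[of "Cr c U1"] r[of "Cr c O2"] r[of "Cr c U2"]
        by (simp add: const_on_image UNIV_leg) (simp add: const_on_def)
    next
      case (4 j)
      then show ?thesis
        using r[of "Jt j True"] r[of "Jt j False"]
        by (simp add: const_on_image UNIV_bool)
    qed
  qed
  then show "compat f (vertices n T)" by (simp add: compat_def)
qed

end

text \<open>Tangles and closures of opposite indices share a pairing of the corners:
  \<open>hflip\<close> is the fundamental tangle 2 and the numerator closure, \<open>vflip\<close>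
  the fundamental tangle 1 and the denominator closure.\<close>

fun hflip :: "corner \<Rightarrow> corner" where
  "hflip NW = NE" | "hflip NE = NW" | "hflip SW = SE" | "hflip SE = SW"

fun vflip :: "corner \<Rightarrow> corner" where
  "vflip NW = SW" | "vflip SW = NW" | "vflip NE = SE" | "vflip SE = NE"

fun A_partner :: "leg \<Rightarrow> leg" where
  "A_partner O1 = U2" | "A_partner U2 = O1" | "A_partner O2 = U1" | "A_partner U1 = O2"

fun B_partner :: "leg \<Rightarrow> leg" where
  "B_partner O1 = U1" | "B_partner U1 = O1" | "B_partner O2 = U2" | "B_partner U2 = O2"

text \<open>
  A state splits the crossings in \<open>\<sigma>\<close> by type A, fills the holes in \<open>H\<close> with the fundamental
  tangle 2 and the others with 1, and closes up by index 2 if \<open>d\<close> holds and by index 1 otherwise.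
  \<open>partner\<close> is the end to which an end is joined at its vertex.
\<close>

fun partner :: "'v set \<Rightarrow> nat set \<Rightarrow> bool \<Rightarrow> 'v end_point \<Rightarrow> 'v end_point" where
  "partner \<sigma> H d (Out p) = Out (if d then vflip p else hflip p)"
| "partner \<sigma> H d (Hole h p) = Hole h (if h \<in> H then hflip p else vflip p)"
| "partner \<sigma> H d (Cr c l) = Cr c (if c \<in> \<sigma> then A_partner l else B_partner l)"
| "partner \<sigma> H d (Jt v s) = Jt v (\<not> s)"

lemma flip_simps [simp]:
  "hflip (hflip p) = p" "vflip (vflip p) = p" "hflip p \<noteq> p" "vflip p \<noteq> p"
  "A_partner (A_partner l) = l" "B_partner (B_partner l) = l" "A_partner l \<noteq> l" "B_partner l \<noteq> l"
  by (cases p; simp | cases l; simp)+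

lemma partner_partner [simp]: "partner \<sigma> H d (partner \<sigma> H d x) = x"
  by (cases x) auto

lemma partner_neq [simp]: "partner \<sigma> H d x \<noteq> x"
  by (cases x) auto

lemma partner_in_iff [simp]: "partner \<sigma> H d x \<in> ends n T \<longleftrightarrow> x \<in> ends n T"
  by (cases x) auto

lemma partner_vertex: "v \<in> vertices n T \<Longrightarrow> x \<in> v \<Longrightarrow> partner \<sigma> H d x \<in> v"
  by (elim vertex_cases) auto

text \<open>Partners are cyclic neighbours in one direction or the other; hence a colouring that
  alternates around vertices separates them, whatever the state.\<close>

lemma partner_rot: "partner \<sigma> H d x = rot x \<or> rot (partner \<sigma> H d x) = x"
proof (cases x)
  case (Out p)
  then show ?thesis by (cases p) auto
next
  case (Hole h p)
  then show ?thesis by (cases p) auto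
next
  case (Cr c l)
  then show ?thesis by (cases l) auto
qed auto

section \<open>The checkerboard colouring\<close>

context plane_tangle
begin

lemma double_card_arcs: "card E = 2 * card (arcs T)"
proof -
  have "card (\<Union> (arcs T)) = sum card (arcs T)"
    using partition_onD2[OF partition_arcs] card_arc
    by (intro card_Union_disjoint) (auto intro: card_ge_0_finite)
  also have "\<dots> = (\<Sum>a\<in>arcs T. 2)"
    using card_arc by (rule sum.cong[OF refl])
  finally show ?thesis using partition_onD1[OF partition_arcs] by simp
qed

text \<open>A face is thus an orbit of \<open>rot\<close> after \<open>mate\<close>, and invariance
  along faces becomes an equation that is checked end by end.\<close>

lemma face_steps_eq: "face_steps T = (\<lambda>x. {x, rot (mate x)}) ` E"
proof (intro equalityI subsetI)
  fix p assume "p \<in> face_steps T"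
  then obtain x y where xy: "p = {x, rot y}" "x \<noteq> y" "{x, y} \<in> arcs T"
    unfolding face_steps_def by blast
  moreover have "x \<in> E" using xy(3) partition_onD1[OF partition_arcs] by blast
  ultimately show "p \<in> (\<lambda>x. {x, rot (mate x)}) ` E" using mate_eqI by blast
next
  fix p assume "p \<in> (\<lambda>x. {x, rot (mate x)}) ` E"
  then obtain x where x: "x \<in> E" "p = {x, rot (mate x)}" by blast
  then have "p = {x, rot (mate x)} \<and> x \<noteq> mate x \<and> {x, mate x} \<in> arcs T"
    using mate_arc[OF x(1)] mate_neq[OF x(1)] by metis
  then show "p \<in> face_steps T"
    unfolding face_steps_def by blast
qed

lemma inv_sets_arcs: "inv_sets E (arcs T) = {A. A \<subseteq> E \<and> (\<forall>x\<in>E. mate x \<in> A \<longleftrightarrow> x \<in> A)}"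
  unfolding inv_sets_def compat_arcs by simp

lemma inv_sets_vertices: "inv_sets E (vertices n T) = {A. A \<subseteq> E \<and> (\<forall>x\<in>E. rot x \<in> A \<longleftrightarrow> x \<in> A)}"
  unfolding inv_sets_def compat_vertices by simp

lemma inv_sets_faces:
  "inv_sets E (face_steps T) = {A. A \<subseteq> E \<and> (\<forall>x\<in>E. rot (mate x) \<in> A \<longleftrightarrow> x \<in> A)}"
  unfolding inv_sets_def face_steps_eq compat_image by auto

lemma euler:
  "card (vertices n T) + num_classes E (face_steps T)
     = card (arcs T) + 2 * num_classes E (vertices n T \<union> arcs T)"
  using tangle unfolding tangle_diagram_def ends_def by linarith

text \<open>The two conditions make \<open>\<chi>\<close> constant along
  \<open>rot (mate x)\<close>, hence on faces, while the two ends of an arc, which stand for its two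
  sides, get different colours.\<close>

definition colouring :: "('v end_point \<Rightarrow> bool) \<Rightarrow> bool" where
  "colouring \<chi> \<longleftrightarrow> (\<forall>x\<in>E. \<chi> (mate x) = (\<not> \<chi> x) \<and> \<chi> (rot x) = (\<not> \<chi> x))"

text \<open>
  Over the field with two elements, \<open>step\<close> is the coboundary from faces to arcs.  By Euler's formula
  its image is the whole space of cocycles, which contains the constant 1; a face colouring with
  coboundary 1 is a checkerboard colouring.
\<close>

definition step :: "'v end_point set \<Rightarrow> 'v end_point set" where
  "step A = {x \<in> E. (x \<in> A) \<noteq> (mate x \<in> A)}"

text \<open>Sums of a union of vertices and a union of arcs. A set orthogonal to all of them
  contains both ends or neither end of each arc and evenly many ends at each vertex; these are the
  cocycles.\<close>

definition cuts :: "'v end_point set set" where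
  "cuts = (\<lambda>(A, B). symdiff A B) ` (inv_sets E (vertices n T) \<times> inv_sets E (arcs T))"

lemma finite_inv_sets: "finite (inv_sets E P)"
  by (rule finite_subset[of _ "Pow E"]) (use finite_ends in \<open>auto simp: inv_sets_def\<close>)

lemma orth_cutsI:
  assumes "B \<subseteq> E"
    and "\<And>A. A \<in> inv_sets E (vertices n T) \<Longrightarrow> even (card (A \<inter> B))"
    and "\<And>A. A \<in> inv_sets E (arcs T) \<Longrightarrow> even (card (A \<inter> B))"
  shows "B \<in> orth E cuts"
proof -
  have "even (card (symdiff V A \<inter> B))"
    if "V \<in> inv_sets E (vertices n T)" "A \<in> inv_sets E (arcs T)" for V A
  proof -
    have "symdiff V A \<inter> B = symdiff (V \<inter> B) (A \<inter> B)" by (auto simp: symdiff_def)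
    moreover have "finite B" using assms(1) finite_ends finite_subset by blast
    ultimately show ?thesis using assms(2)[OF that(1)] assms(3)[OF that(2)]
      by (simp add: even_card_symdiff)
  qed
  then show ?thesis using assms(1) by (auto simp: orth_def cuts_def)
qed

text \<open>All vertices have even degree. The fixed-point-free involutions \<open>partner\<close>
  and \<open>mate\<close> show the two parities; the state chosen for \<open>partner\<close> is
  arbitrary.\<close>

lemma ends_orth_cuts: "E \<in> orth E cuts"
proof (rule orth_cutsI)
  fix A assume A: "A \<in> inv_sets E (vertices n T)"
  have "partner {} {} False x \<in> A" if x: "x \<in> A" "x \<in> E" for x
  proof -
    obtain v where v: "v \<in> vertices n T" "x \<in> v" using x(2) unfolding ends_def by blast
    then have "const_on (\<lambda>x. x \<in> A) v" using A by (auto simp: inv_sets_def compat_def)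
    from const_onD[OF this partner_vertex[OF v] v(2)] show ?thesis using x(1) by simp
  qed
  then show "even (card (A \<inter> E))"
    using finite_ends by (intro even_card_involution[where f = "partner {} {} False"]) auto
next
  fix A assume "A \<in> inv_sets E (arcs T)"
  then show "even (card (A \<inter> E))"
    using finite_ends by (intro even_card_involution[where f = mate]) (auto simp: inv_sets_arcs)
qed simp

text \<open>At a vertex an end lies in \<open>step A\<close> exactly when membership in
  \<open>A\<close> changes between it and the next end, and a cyclic sequence changes evenly often.
  Formally, \<open>V \<inter> step A\<close> is the sum of \<open>V \<inter> A\<close> and its
  preimage under the rotation of \<open>V\<close>, which has the same size.\<close>

lemma step_orth_cuts:
  assumes A: "A \<in> inv_sets E (face_steps T)"
  shows "step A \<in> orth E cuts"
proof (rule orth_cutsI)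
  fix V assume V: "V \<in> inv_sets E (vertices n T)"
  have "rot (mate x) \<in> A \<longleftrightarrow> x \<in> A" if "x \<in> E" for x
    using A that unfolding inv_sets_faces by blast
  then have "mate x \<in> A \<longleftrightarrow> rot x \<in> A" if "x \<in> E" for x
    using that mate_in[OF that] mate_mate[OF that] by metis
  then have "V \<inter> step A = symdiff (V \<inter> A) {x \<in> V. rot x \<in> A}"
    using V by (auto simp: step_def inv_sets_vertices)
  moreover have "card {x \<in> V. rot x \<in> A} = card (V \<inter> A)"
  proof -
    have finV: "finite V" using V finite_ends finite_subset by (auto simp: inv_sets_def)
    have "rot ` V \<subseteq> V" using V by (auto simp: inv_sets_vertices)
    moreover have inj: "inj_on rot V" using rot_inj by (auto intro: inj_onI)
    ultimately have "rot ` V = V" using finV by (simp add: endo_inj_surj)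
    moreover have "rot ` {x \<in> V. rot x \<in> A} = rot ` V \<inter> A" by auto
    moreover have "inj_on rot {x \<in> V. rot x \<in> A}" by (rule inj_on_subset[OF inj]) auto
    ultimately show ?thesis by (metis card_image)
  qed
  moreover have "finite V" using V finite_ends finite_subset by (auto simp: inv_sets_def)
  ultimately show "even (card (V \<inter> step A))" by (simp add: even_card_symdiff)
next
  fix B assume "B \<in> inv_sets E (arcs T)"
  then show "even (card (B \<inter> step A))"
    using finite_ends by (intro even_card_involution[where f = mate]) (auto simp: inv_sets_arcs step_def)
qed (auto simp: step_def)

text \<open>Let V, e, F, C be the numbers of vertices, arcs, faces and components. The kernel of
  \<open>step\<close> consists of sets that are constant on components, so the image has dimension
  at least F - C. The cuts have dimension at least V + e - C, so their annihilator in dimension 2 e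
  has dimension at most e - V + C. By Euler's formula the two bounds coincide.\<close>

lemma step_image: "step ` inv_sets E (face_steps T) = orth E cuts"
proof (rule card_subset_eq)
  let ?F = "num_classes E (face_steps T)" and ?C = "num_classes E (vertices n T \<union> arcs T)"
  let ?V = "card (vertices n T)" and ?e = "card (arcs T)"
  let ?m = "card (step ` inv_sets E (face_steps T))" and ?k = "card (orth E cuts)"
  show fin: "finite (orth E cuts)"
    by (rule finite_subset[of _ "Pow E"]) (use finite_ends in \<open>auto simp: orth_def\<close>)
  show sub: "step ` inv_sets E (face_steps T) \<subseteq> orth E cuts"
    using step_orth_cuts by blast
  have va: "inv_sets E (vertices n T \<union> arcs T) = inv_sets E (vertices n T) \<inter> inv_sets E (arcs T)"
    by (rule inv_sets_Un)
  have inE: "p \<subseteq> E" if "p \<in> vertices n T \<union> arcs T" for p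
    using that partition_onD1[OF partition_arcs] by (auto simp: ends_def)
  have cC: "card (inv_sets E (vertices n T \<union> arcs T)) = 2 ^ ?C"
    using inE by (rule card_inv_sets[OF finite_ends])
  have cF: "card (inv_sets E (face_steps T)) = 2 ^ ?F"
    by (rule card_inv_sets[OF finite_ends]) (auto simp: face_steps_eq)
  have cV: "card (inv_sets E (vertices n T)) = 2 ^ ?V"
    by (rule card_inv_sets_partition[OF partition_vertices finite_vertices])
  have cE: "card (inv_sets E (arcs T)) = 2 ^ ?e"
    by (rule card_inv_sets_partition[OF partition_arcs finite_arcs])
  have "2 ^ ?F \<le> ?m * 2 ^ ?C"
  proof -
    have "card (inv_sets E (face_steps T)) \<le> ?m * card {A \<in> inv_sets E (face_steps T). step A = {}}"
      by (rule card_le_image_kernel[OF finite_inv_sets subspace2_inv_sets]) (auto simp: step_def)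
    moreover have "card {A \<in> inv_sets E (face_steps T). step A = {}}
        \<le> card (inv_sets E (vertices n T \<union> arcs T))"
    proof (rule card_mono[OF finite_inv_sets], intro subsetI)
      fix A assume "A \<in> {A \<in> inv_sets E (face_steps T). step A = {}}"
      then have A: "A \<subseteq> E" "\<And>x. x \<in> E \<Longrightarrow> rot (mate x) \<in> A \<longleftrightarrow> x \<in> A" and "step A = {}"
        unfolding inv_sets_faces by simp_all
      then have m: "mate x \<in> A \<longleftrightarrow> x \<in> A" if "x \<in> E" for x
        using that unfolding step_def by blast
      have "rot x \<in> A \<longleftrightarrow> x \<in> A" if "x \<in> E" for x
        using A(2)[of "mate x"] m[of x] that by simp
      then show "A \<in> inv_sets E (vertices n T \<union> arcs T)"
        unfolding va inv_sets_vertices inv_sets_arcs using A(1) m by simp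
    qed
    ultimately show ?thesis unfolding cC cF by (meson le_trans mult_le_mono2)
  qed
  moreover have "2 ^ ?V * 2 ^ ?e \<le> card cuts * 2 ^ ?C"
    using card_sum_subspaces[OF finite_inv_sets finite_inv_sets subspace2_inv_sets subspace2_inv_sets,
      of "vertices n T" "arcs T"]
    unfolding va[symmetric] cC cV cE cuts_def .
  moreover have "card cuts * ?k = 2 ^ (2 * ?e)"
  proof -
    have "subspace2 cuts"
      unfolding subspace2_def
    proof (intro conjI ballI)
      have "symdiff {} {} \<in> cuts"
        using subspace2_inv_sets unfolding cuts_def subspace2_def by blast
      then show "{} \<in> cuts" by simp
      fix A B assume "A \<in> cuts" "B \<in> cuts"
      then obtain V W P Q where *: "A = symdiff V P" "B = symdiff W Q"
        "V \<in> inv_sets E (vertices n T)" "W \<in> inv_sets E (vertices n T)"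
        "P \<in> inv_sets E (arcs T)" "Q \<in> inv_sets E (arcs T)"
        unfolding cuts_def by auto
      have "symdiff A B = symdiff (symdiff V W) (symdiff P Q)"
        unfolding * by (auto simp: set_eq_iff)
      then show "symdiff A B \<in> cuts"
        using * subspace2_inv_sets unfolding cuts_def subspace2_def by blast
    qed
    moreover have "cuts \<subseteq> Pow E" by (auto simp: cuts_def inv_sets_def)
    ultimately show ?thesis using card_orth[OF finite_ends] double_card_arcs by simp
  qed
  ultimately have "?k \<le> ?m"
  proof -
    assume m: "2 ^ ?F \<le> ?m * 2 ^ ?C" and s: "2 ^ ?V * 2 ^ ?e \<le> card cuts * 2 ^ ?C"
      and k: "card cuts * ?k = 2 ^ (2 * ?e)"
    \<comment> \<open>The bounds are multiplied together rather than subtracted, so that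
      \<open>?k\<close> and \<open>?m\<close> need not be known to be powers of two.\<close>
    have "?k * 2 ^ (?V + ?e + ?C) = ?k * (2 ^ ?V * 2 ^ ?e) * 2 ^ ?C"
      by (simp add: power_add)
    also have "\<dots> \<le> ?k * (card cuts * 2 ^ ?C) * 2 ^ ?C"
      by (rule mult_le_mono1[OF mult_le_mono2[OF s]])
    also have "\<dots> = 2 ^ (2 * ?e) * 2 ^ ?C * 2 ^ ?C"
      using k by (simp add: ac_simps)
    also have "\<dots> = 2 ^ (?e + (?e + 2 * ?C))"
      by (simp add: power_add mult_2)
    also have "\<dots> = 2 ^ ?F * 2 ^ (?V + ?e)"
      unfolding euler[symmetric] by (simp add: power_add)
    also have "\<dots> \<le> ?m * 2 ^ ?C * 2 ^ (?V + ?e)"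
      using m by (rule mult_le_mono1)
    finally show ?thesis by (simp add: power_add)
  qed
  then show "?m = ?k" using card_mono[OF fin sub] by simp
qed

lemma colouring_exists: "\<exists>\<chi>. colouring \<chi>"
proof -
  \<comment> \<open>\<open>A\<close> is the union of the faces of one colour: as
    \<open>step A\<close> is all of \<open>E\<close>, membership changes across every arc.\<close>
  obtain A where A: "A \<in> inv_sets E (face_steps T)" "step A = E"
    using ends_orth_cuts unfolding step_image[symmetric] by auto
  have m: "mate x \<in> A \<longleftrightarrow> x \<notin> A" if "x \<in> E" for x
    using A(2) that by (auto simp: step_def)
  have f: "rot (mate x) \<in> A \<longleftrightarrow> x \<in> A" if "x \<in> E" for x
    using A(1) that unfolding inv_sets_faces by blast
  have "rot x \<in> A \<longleftrightarrow> x \<notin> A" if x: "x \<in> E" for x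
    using f[of "mate x"] m[OF x] x by simp
  then show ?thesis using m by (auto simp: colouring_def intro!: exI[of _ "\<lambda>x. x \<in> A"])
qed

end

section \<open>Parity of the states with one circle\<close>

text \<open>The last hypothesis says that \<open>p\<close> is a single cycle. Following
  \<open>p\<close> by the transposition of \<open>x\<close> and \<open>p x\<close> fixes
  \<open>x\<close> and leaves a single cycle on the rest, at the cost of one sign.\<close>

lemma sign_single_orbit:
  assumes "finite S" "p permutes S" "S \<noteq> {}"
    and "\<And>A. A \<subseteq> S \<Longrightarrow> A \<noteq> {} \<Longrightarrow> p ` A \<subseteq> A \<Longrightarrow> A = S"
  shows "sign p = (- 1) ^ (card S - 1)"
  using assms
proof (induction "card S" arbitrary: S p rule: less_induct)
  case less
  obtain x where x: "x \<in> S" using less.prems(3) by blast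
  define y where "y = p x"
  have y: "y \<in> S" using less.prems(2) x by (simp add: y_def permutes_in_image)
  show ?case
  proof (cases "S = {x}")
    case True
    then have "p = id" using less.prems(2) by (simp add: permutes_sing)
    then show ?thesis using True by simp
  next
    case False
    have "y \<noteq> x"
    proof
      assume "y = x"
      then have "{x} = S" using less.prems(4)[of "{x}"] x by (simp add: y_def)
      then show False using False by simp
    qed
    define q where "q = transpose x y \<circ> p"
    have q_permutes: "q permutes S"
      unfolding q_def using less.prems(2) x y permutes_swap_id permutes_compose by metis
    have qx: "q x = x" by (simp add: q_def y_def)
    let ?S = "S - {x}"
    have q': "q permutes ?S"
      by (rule permutes_superset[OF q_permutes]) (use qx in auto)
    have "sign q = (- 1) ^ (card ?S - 1)"
    proof (rule less.hyps)
      show "card ?S < card S" using x less.prems(1) by (rule card_Diff1_less[rotated])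
      show "finite ?S" using less.prems(1) by simp
      show "?S \<noteq> {}" using y \<open>y \<noteq> x\<close> by blast
      show "q permutes ?S" by (rule q')
      fix A assume A: "A \<subseteq> ?S" "A \<noteq> {}" "q ` A \<subseteq> A"
      have p_eq: "p a = q a \<or> (p a = x \<and> q a = y)" if "a \<in> A" for a
      proof -
        have "p a \<noteq> y"
        proof
          assume "p a = y"
          then have "a = x" unfolding y_def using permutes_inj[OF less.prems(2)] by (simp add: inj_eq)
          then show False using that A(1) by blast
        qed
        then show ?thesis by (cases "p a = x") (auto simp: q_def)
      qed
      \<comment> \<open>If \<open>p\<close> enters \<open>x\<close> from \<open>A\<close>, then
        \<open>insert x A\<close> is invariant under \<open>p\<close>; otherwise \<open>A\<close>
        itself is invariant, hence all of \<open>S\<close>, although it misses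
        \<open>x\<close>.\<close>
      show "A = ?S"
      proof (cases "\<exists>a\<in>A. p a = x")
        case True
        then obtain a where "a \<in> A" "p a = x" by blast
        then have "y \<in> A" using A(3) by (auto simp: q_def)
        then have "p ` insert x A \<subseteq> insert x A" using p_eq A(3) by (auto simp: y_def[symmetric])
        then have "insert x A = S" using less.prems(4)[of "insert x A"] A(1) x by blast
        then show ?thesis using A(1) by blast
      next
        case False
        then have "p ` A \<subseteq> A" using p_eq A(3) by auto
        then have "A = S" using less.prems(4)[of A] A by blast
        then show ?thesis using A(1) x by blast
      qed
    qed
    moreover have "p = transpose x y \<circ> q" by (simp add: q_def fun_eq_iff)
    then have "sign p = sign (transpose x y) * sign q"
      using permutes_imp_permutation[OF less.prems(1) q_permutes] by (simp add: sign_compose permutation_swap_id)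
    moreover have "card S - 1 = Suc (card ?S - 1)"
    proof -
      have "card {x, y} \<le> card S" using x y less.prems(1) by (intro card_mono) auto
      then show ?thesis using \<open>y \<noteq> x\<close> x less.prems(1) by simp
    qed
    ultimately show ?thesis using \<open>y \<noteq> x\<close> by (simp add: sign_swap_id)
  qed
qed

text \<open>The criterion of \<open>num_classes_eq_1_iff\<close> stated on the ends of
  \<open>T\<close> itself: fillings and closure enter only through \<open>partner\<close>, and no
  closed diagram has to be built.\<close>

definition one_circle :: "nat \<Rightarrow> 'v diagram \<Rightarrow> 'v set \<Rightarrow> nat set \<Rightarrow> bool \<Rightarrow> bool" where
  "one_circle n T \<sigma> H d \<longleftrightarrow>
     (\<forall>f. compat f (arcs T) \<longrightarrow> (\<forall>x\<in>ends n T. f (partner \<sigma> H d x) = f x) \<longrightarrow> const_on f (ends n T))"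

lemma card_corners:
  "card {p. Q p} = of_bool (Q NW) + of_bool (Q NE) + of_bool (Q SW) + (of_bool (Q SE) :: nat)"
proof -
  have "card {p. Q p} = (\<Sum>p\<in>UNIV. of_bool (Q p))"
    by (simp add: of_bool_def sum.If_cases)
  then show ?thesis by (simp add: UNIV_corner)
qed

locale coloured_tangle = plane_tangle n T for n and T :: "'v diagram" +
  fixes \<chi> :: "'v end_point \<Rightarrow> bool"
  assumes colouring: "colouring \<chi>"
begin

lemma colour_mate [simp]: "x \<in> E \<Longrightarrow> \<chi> (mate x) \<longleftrightarrow> \<not> \<chi> x"
  and colour_rot: "x \<in> E \<Longrightarrow> \<chi> (rot x) \<longleftrightarrow> \<not> \<chi> x"
  using colouring unfolding colouring_def by simp_all

lemma colour_partner [simp]: "x \<in> E \<Longrightarrow> \<chi> (partner \<sigma> H d x) \<longleftrightarrow> \<not> \<chi> x"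
  using partner_rot[of \<sigma> H d x] colour_rot[of x] colour_rot[of "partner \<sigma> H d x"]
    partner_in_iff[of \<sigma> H d x n T] by metis

text \<open>
  Arcs and splittings join ends of opposite colours, so a union of components contains as many
  outer ends of one colour as of the other.
\<close>

lemma balanced:
  assumes "compat f (arcs T)" and "\<And>x. x \<in> E \<Longrightarrow> x \<notin> range Out \<Longrightarrow> f (partner \<sigma> H d x) = f x"
  shows "(f (Out NW) = f (Out NE) \<and> f (Out SW) = f (Out SE))
    \<or> (f (Out NW) = f (Out SW) \<and> f (Out NE) = f (Out SE))"
proof -
  define P where "P c = {x \<in> E. f x \<and> \<chi> x = c}" for c
  have fin: "finite (P c)" for c using finite_ends by (simp add: P_def)
  have f_mate: "f (mate x) = f x" if "x \<in> E" for x
    using assms(1) that by (simp add: compat_arcs)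
  have "bij_betw mate (P True) (P False)"
    by (rule bij_betw_byWitness[where f' = mate]) (auto simp: P_def f_mate)
  then have all: "card (P True) = card (P False)" by (rule bij_betw_same_card)
  have out: "partner \<sigma> H d x \<in> range Out \<longleftrightarrow> x \<in> range Out" for x
    by (cases x) auto
  have "bij_betw (partner \<sigma> H d) (P True - range Out) (P False - range Out)"
    by (rule bij_betw_byWitness[where f' = "partner \<sigma> H d"])
      (use assms(2) out in \<open>auto simp: P_def\<close>)
  then have inner: "card (P True - range Out) = card (P False - range Out)" by (rule bij_betw_same_card)
  have split: "card (P c) = card (P c - range Out) + card {p. f (Out p) \<and> \<chi> (Out p) = c}" for c
  proof -
    have "P c = (P c - range Out) \<union> Out ` {p. f (Out p) \<and> \<chi> (Out p) = c}"
      by (auto simp: P_def)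
    moreover have "card (Out ` {p. f (Out p) \<and> \<chi> (Out p) = c} :: 'v end_point set)
        = card {p. f (Out p) \<and> \<chi> (Out p) = c}"
      by (rule card_image) (simp add: inj_on_def)
    moreover have "card ((P c - range Out) \<union> Out ` {p. f (Out p) \<and> \<chi> (Out p) = c})
        = card (P c - range Out) + card (Out ` {p. f (Out p) \<and> \<chi> (Out p) = c} :: 'v end_point set)"
      by (rule card_Un_disjoint) (use fin in auto)
    ultimately show ?thesis by metis
  qed
  have "card {p. f (Out p) \<and> \<chi> (Out p) = True} = card {p. f (Out p) \<and> \<chi> (Out p) = False}"
    using all inner split[of True] split[of False] by linarith
  \<comment> \<open>Colours alternate around the outer vertex, so the count says that
    \<open>f\<close> holds equally often on the two diagonals. This excludes functions that single
    out one diagonal, or a single corner, or all corners but one.\<close>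
  moreover have "\<chi> (Out NE) \<longleftrightarrow> \<not> \<chi> (Out NW)" "\<chi> (Out SE) \<longleftrightarrow> \<not> \<chi> (Out NE)"
    "\<chi> (Out SW) \<longleftrightarrow> \<not> \<chi> (Out SE)"
    using colour_rot[of "Out NW"] colour_rot[of "Out NE"] colour_rot[of "Out SE"] by simp_all
  ultimately show ?thesis
    unfolding card_corners by (auto simp: of_bool_def split: if_splits)
qed

section \<open>The circles of a state as cycles of a permutation\<close>

definition white :: "'v end_point set" where
  "white = {x \<in> E. \<chi> x}"

text \<open>Arcs and pairings alternate along a circle and both change the colour, so an arc
  followed by a pairing preserves white ends. A circle gives one cycle on the white ends; on all
  ends it would give two, one for each direction.\<close>

definition walk :: "'v set \<Rightarrow> nat set \<Rightarrow> bool \<Rightarrow> 'v end_point \<Rightarrow> 'v end_point" where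
  "walk \<sigma> H d x = (if x \<in> white then partner \<sigma> H d (mate x) else x)"

lemma finite_white: "finite white"
  using finite_ends by (simp add: white_def)

lemma walk_permutes: "walk \<sigma> H d permutes white"
proof (rule bij_imp_permutes)
  show "bij_betw (walk \<sigma> H d) white white"
    by (rule bij_betw_byWitness[where f' = "\<lambda>x. mate (partner \<sigma> H d x)"])
      (auto simp: walk_def white_def)
qed (simp add: walk_def)

text \<open>A single circle is a single cycle through all white ends, so its sign does not depend on
  the state. This is what makes the parities of different states comparable.\<close>

lemma sign_one_circle:
  assumes "one_circle n T \<sigma> H d"
  shows "sign (walk \<sigma> H d) = (- 1) ^ (card white - 1)"
proof (rule sign_single_orbit[OF finite_white walk_permutes])
  have "Out NW \<in> white \<or> Out NE \<in> white"
    using colour_rot[of "Out NW"] by (simp add: white_def)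
  then show "white \<noteq> {}" by blast
  fix A assume A: "A \<subseteq> white" "A \<noteq> {}" "walk \<sigma> H d ` A \<subseteq> A"
  let ?p = "walk \<sigma> H d"
  have "inj_on ?p A" using permutes_inj[OF walk_permutes] by (rule inj_on_subset) simp
  then have img: "?p ` A = A"
    using A(1,3) finite_white finite_subset by (metis endo_inj_surj)
  have walk_in: "?p x \<in> A \<longleftrightarrow> x \<in> A" for x
    using img permutes_inj[OF walk_permutes, of \<sigma> H d] by (metis inj_image_mem_iff)
  have white: "x \<in> E" "\<chi> x" if "x \<in> A" for x using that A(1) by (auto simp: white_def)
  \<comment> \<open>\<open>A\<close> contains white ends only; adding the ends joined to them by
    arcs gives a union of circles.\<close>
  define f where "f x \<longleftrightarrow> x \<in> A \<or> (x \<in> E \<and> mate x \<in> A)" for x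
  have "compat f (arcs T)"
    unfolding compat_arcs f_def using white(1) by auto
  moreover have "f (partner \<sigma> H d x) = f x" if x: "x \<in> E" for x
  proof (cases "\<chi> x")
    case True
    let ?y = "mate (partner \<sigma> H d x)"
    have "partner \<sigma> H d x \<notin> A" "mate x \<notin> A" using white(2) x True by fastforce+
    moreover have "?p ?y = x" using x True by (simp add: walk_def white_def)
    then have "?y \<in> A \<longleftrightarrow> x \<in> A" using walk_in[of ?y] by simp
    ultimately show ?thesis using x by (simp add: f_def)
  next
    case False
    have "x \<notin> A" "mate (partner \<sigma> H d x) \<notin> A" using white(2) x False by fastforce+
    moreover have "?p (mate x) = partner \<sigma> H d x" using x False by (simp add: walk_def white_def)
    then have "partner \<sigma> H d x \<in> A \<longleftrightarrow> mate x \<in> A" using walk_in[of "mate x"] by simp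
    ultimately show ?thesis using x by (simp add: f_def)
  qed
  ultimately have const: "const_on f E" using assms unfolding one_circle_def by blast
  obtain a where a: "a \<in> A" using A(2) by blast
  show "A = white"
  proof (intro equalityI subsetI)
    fix x assume x: "x \<in> white"
    have "f x = f a" using const_onD[OF const] x a white(1) by (simp add: white_def)
    then have "f x" using a by (simp add: f_def)
    then show "x \<in> A" using x white(2) by (fastforce simp: f_def white_def)
  qed (use A in blast)
qed

text \<open>At a vertex with four ends of alternating colours, the two pairings of neighbours
  differ, seen from the black ends, by exchanging the two white ends.\<close>

lemma sign_switch:
  assumes ab: "a \<in> white" "b \<in> white" "a \<noteq> b"
    and switch: "\<And>y. y \<in> E \<Longrightarrow> \<not> \<chi> y \<Longrightarrow> partner \<sigma>' H' d' y = transpose a b (partner \<sigma> H d y)"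
  shows "sign (walk \<sigma>' H' d') = - sign (walk \<sigma> H d)"
proof -
  have "walk \<sigma>' H' d' = transpose a b \<circ> walk \<sigma> H d"
  proof
    fix x
    have "x \<noteq> a" "x \<noteq> b" if "x \<notin> white" using that ab by auto
    then show "walk \<sigma>' H' d' x = (transpose a b \<circ> walk \<sigma> H d) x"
      using switch[of "mate x"] by (auto simp: walk_def white_def)
  qed
  then show ?thesis
    using permutes_imp_permutation[OF finite_white walk_permutes, of \<sigma> H d] ab(3)
    by (simp add: sign_compose permutation_swap_id sign_swap_id)
qed

lemma sign_switch_crossing:
  assumes "c \<in> crossings T" "c \<notin> \<sigma>"
  shows "sign (walk (insert c \<sigma>) H d) = - sign (walk \<sigma> H d)"
proof -
  have rots: "\<chi> (Cr c U1) \<longleftrightarrow> \<not> \<chi> (Cr c O1)" "\<chi> (Cr c O2) \<longleftrightarrow> \<not> \<chi> (Cr c U1)"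
    "\<chi> (Cr c U2) \<longleftrightarrow> \<not> \<chi> (Cr c O2)"
    using colour_rot[of "Cr c O1"] colour_rot[of "Cr c U1"] colour_rot[of "Cr c O2"] assms by simp_all
  \<comment> \<open>Colours alternate around \<open>c\<close>, so these are its two white
    ends.\<close>
  define a b where "a = (if \<chi> (Cr c O1) then Cr c O1 else Cr c U1)"
    and "b = (if \<chi> (Cr c O1) then Cr c O2 else Cr c U2)"
  show ?thesis
  proof (rule sign_switch[of a b])
    show "a \<in> white" "b \<in> white" "a \<noteq> b"
      using rots assms by (auto simp: a_def b_def white_def)
    fix y assume y: "y \<in> E" "\<not> \<chi> y"
    show "partner (insert c \<sigma>) H d y = transpose a b (partner \<sigma> H d y)"
    proof (cases "\<exists>l. y = Cr c l")
      case True
      then obtain l where l: "y = Cr c l" by blast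
      show ?thesis using rots y(2) assms unfolding l
        by (cases l; cases "\<chi> (Cr c O1)") (simp_all add: a_def b_def)
    next
      case False
      then have "partner \<sigma> H d y \<noteq> a" "partner \<sigma> H d y \<noteq> b"
        by (cases y; simp add: a_def b_def)+
      moreover have "partner (insert c \<sigma>) H d y = partner \<sigma> H d y"
        using False by (cases y) auto
      ultimately show ?thesis by simp
    qed
  qed
qed

lemma sign_switch_hole:
  assumes "h < n" "h \<notin> H"
  shows "sign (walk \<sigma> (insert h H) d) = - sign (walk \<sigma> H d)"
proof -
  have rots: "\<chi> (Hole h SW) \<longleftrightarrow> \<not> \<chi> (Hole h NW)" "\<chi> (Hole h SE) \<longleftrightarrow> \<not> \<chi> (Hole h SW)"
    "\<chi> (Hole h NE) \<longleftrightarrow> \<not> \<chi> (Hole h SE)"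
    using colour_rot[of "Hole h NW"] colour_rot[of "Hole h SW"] colour_rot[of "Hole h SE"] assms by simp_all
  \<comment> \<open>The white corners of a hole form one of its two diagonals.\<close>
  define a b where "a = (if \<chi> (Hole h NW) then Hole h NW else Hole h NE :: 'v end_point)"
    and "b = (if \<chi> (Hole h NW) then Hole h SE else Hole h SW :: 'v end_point)"
  show ?thesis
  proof (rule sign_switch[of a b])
    show "a \<in> white" "b \<in> white" "a \<noteq> b"
      using rots assms by (auto simp: a_def b_def white_def)
    fix y assume y: "y \<in> E" "\<not> \<chi> y"
    show "partner \<sigma> (insert h H) d y = transpose a b (partner \<sigma> H d y)"
    proof (cases "\<exists>p. y = Hole h p")
      case True
      then obtain p where p: "y = Hole h p" by blast
      show ?thesis using rots y(2) assms unfolding p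
        by (cases p; cases "\<chi> (Hole h NW)") (simp_all add: a_def b_def)
    next
      case False
      then have "partner \<sigma> H d y \<noteq> a" "partner \<sigma> H d y \<noteq> b"
        by (cases y; simp add: a_def b_def)+
      moreover have "partner \<sigma> (insert h H) d y = partner \<sigma> H d y"
        using False by (cases y) auto
      ultimately show ?thesis by simp
    qed
  qed
qed

lemma sign_switch_closure: "sign (walk \<sigma> H True) = - sign (walk \<sigma> H False)"
proof -
  have rots: "\<chi> (Out NE) \<longleftrightarrow> \<not> \<chi> (Out NW)" "\<chi> (Out SE) \<longleftrightarrow> \<not> \<chi> (Out NE)"
    "\<chi> (Out SW) \<longleftrightarrow> \<not> \<chi> (Out SE)"
    using colour_rot[of "Out NW"] colour_rot[of "Out NE"] colour_rot[of "Out SE"] by simp_all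
  define a b where "a = (if \<chi> (Out NW) then Out NW else Out NE :: 'v end_point)"
    and "b = (if \<chi> (Out NW) then Out SE else Out SW :: 'v end_point)"
  show ?thesis
  proof (rule sign_switch[of a b])
    show "a \<in> white" "b \<in> white" "a \<noteq> b"
      using rots by (auto simp: a_def b_def white_def)
    fix y assume y: "y \<in> E" "\<not> \<chi> y"
    show "partner \<sigma> H True y = transpose a b (partner \<sigma> H False y)"
    proof (cases "\<exists>p. y = Out p")
      case True
      then obtain p where p: "y = Out p" by blast
      show ?thesis using rots y(2) unfolding p
        by (cases p; cases "\<chi> (Out NW)") (simp_all add: a_def b_def)
    next
      case False
      then have "partner \<sigma> H False y \<noteq> a" "partner \<sigma> H False y \<noteq> b"
        by (cases y; simp add: a_def b_def)+
      moreover have "partner \<sigma> H True y = partner \<sigma> H False y"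
        using False by (cases y) auto
      ultimately show ?thesis by simp
    qed
  qed
qed

lemma sign_walk:
  assumes "\<sigma> \<subseteq> crossings T" "H \<subseteq> {..<n}"
  shows "sign (walk \<sigma> H d) = sign (walk {} {} False) * (- 1) ^ (card \<sigma> + card H + of_bool d)"
proof -
  have "finite \<sigma>" using assms(1) finite_crossings finite_subset by blast
  then have "sign (walk \<sigma> H d) = sign (walk {} H d) * (- 1) ^ card \<sigma>"
    using assms(1) by (induction \<sigma> rule: finite_induct) (simp_all add: sign_switch_crossing)
  moreover have "finite H" using assms(2) finite_subset by blast
  then have "sign (walk {} H d) = sign (walk {} {} d) * (- 1) ^ card H"
    using assms(2) by (induction H rule: finite_induct) (simp_all add: sign_switch_hole)
  moreover have "sign (walk {} {} d) = sign (walk {} {} False) * (- 1) ^ of_bool d"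
    by (cases d) (simp_all add: sign_switch_closure)
  ultimately show ?thesis by (simp add: power_add)
qed

end

context plane_tangle
begin

text \<open>Both walks have the sign forced by a single circle, while each switched crossing, hole
  or closure contributes a factor -1. The states may differ in all three respects, so this parity
  belongs to the diagram.\<close>

lemma one_circle_parity:
  assumes "\<sigma> \<subseteq> crossings T" "H \<subseteq> {..<n}" "one_circle n T \<sigma> H d"
    and "\<sigma>' \<subseteq> crossings T" "H' \<subseteq> {..<n}" "one_circle n T \<sigma>' H' d'"
  shows "even (card \<sigma> + card H + of_bool d) \<longleftrightarrow> even (card \<sigma>' + card H' + of_bool d')"
proof -
  obtain \<chi> where "colouring \<chi>" using colouring_exists by blast
  then interpret coloured_tangle n T \<chi> by unfold_locales
  have "sign (walk {} {} False) * (- 1) ^ (card \<sigma> + card H + of_bool d)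
      = sign (walk {} {} False) * (- 1) ^ (card \<sigma>' + card H' + of_bool d')"
    unfolding sign_walk[OF assms(1,2), symmetric] sign_walk[OF assms(4,5), symmetric]
    using sign_one_circle assms(3,6) by simp
  then have "(- 1 :: int) ^ (card \<sigma> + card H + of_bool d) = (- 1) ^ (card \<sigma>' + card H' + of_bool d')"
    by simp
  moreover have "even a \<longleftrightarrow> even b" if "(- 1 :: int) ^ a = (- 1) ^ b" for a b :: nat
    using that by (auto simp: minus_one_power_iff split: if_splits)
  ultimately show ?thesis by blast
qed

lemma outer_ends_balanced:
  assumes "compat f (arcs T)" and "\<And>x. x \<in> E \<Longrightarrow> x \<notin> range Out \<Longrightarrow> f (partner \<sigma> H d x) = f x"
  shows "(f (Out NW) = f (Out NE) \<and> f (Out SW) = f (Out SE))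
    \<or> (f (Out NW) = f (Out SW) \<and> f (Out NE) = f (Out SE))"
proof -
  obtain \<chi> where "colouring \<chi>" using colouring_exists by blast
  then interpret coloured_tangle n T \<chi> by unfold_locales
  show ?thesis using balanced[OF assms] .
qed

end

section \<open>Closures of diagrams with filled holes\<close>

abbreviation embed :: "'v end_point \<Rightarrow> (('v, unit) glued + corner) end_point" where
  "embed x \<equiv> embed_closed (embed_base x)"

text \<open>Both sides of a seam or closing joint are contracted to the end they come from.
  Fundamental tangles have no crossings or joints, and the closed diagram has no holes or outer ends
  left, so the default is never met on its ends.\<close>

fun collapse :: "(('v, unit) glued + corner) end_point \<Rightarrow> 'v end_point" where
  "collapse (Cr (Inl (Base c)) l) = Cr c l"
| "collapse (Jt (Inl (Base v)) s) = Jt v s"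
| "collapse (Jt (Inl (Seam h p)) s) = Hole h p"
| "collapse (Jt (Inr p) s) = Out p"
| "collapse x = undefined"

lemma collapse_embed [simp]: "collapse (embed x) = x"
  by (cases x) auto

lemma crossings_closed_filling: "crossings (closed_filling m T c \<alpha>) = Inl ` Base ` crossings T"
  by (auto simp: closed_filling_def close_up_def fill_def fundamental_def)

lemma joints_closed_filling:
  "joints (closed_filling m T c \<alpha>)
    = Inl ` (Base ` joints T \<union> {Seam j p | j p. j < m}) \<union> range Inr"
  by (auto simp: closed_filling_def close_up_def fill_def fundamental_def)

lemma compat_arcs_closed_filling:
  "compat f (arcs (closed_filling m T c \<alpha>)) \<longleftrightarrow>
    compat (\<lambda>x. f (embed x)) (arcs T) \<and>
    (\<forall>h<m. \<forall>p. f (Jt (Inl (Seam h (if \<alpha> ! h \<noteq> 1 then hflip p else vflip p))) False) = f (Jt (Inl (Seam h p)) False)) \<and>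
    (\<forall>p. f (Jt (Inr (if c \<noteq> 1 then vflip p else hflip p)) False) = f (Jt (Inr p) False))"
proof -
  have "compat f ((\<lambda>a. embed_closed ` a) ` (\<lambda>a. embed_base ` a) ` arcs T) \<longleftrightarrow>
      compat (\<lambda>x. f (embed x)) (arcs T)"
    by (simp add: compat_def const_on_image)
  moreover have "compat f ((\<lambda>a. embed_closed ` a) ` (\<lambda>a. embed_filling 0 h ` a) ` arcs (fundamental (\<alpha> ! h)))
      \<longleftrightarrow> (\<forall>p. f (Jt (Inl (Seam h (if \<alpha> ! h \<noteq> 1 then hflip p else vflip p))) False) = f (Jt (Inl (Seam h p)) False))"
    for h
    unfolding all_corner by (auto simp: fundamental_def)
  moreover have "compat f (if c = 1 then {outer_arc NW NE, outer_arc SW SE} else {outer_arc NW SW, outer_arc NE SE})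
      \<longleftrightarrow> (\<forall>p. f (Jt (Inr (if c \<noteq> 1 then vflip p else hflip p)) False) = f (Jt (Inr p) False))"
    unfolding all_corner by (auto simp: outer_arc_def)
  ultimately show ?thesis
    by (simp add: closed_filling_def close_up_def fill_def image_Un image_UN Ball_def)
qed

text \<open>Compatible functions restrict along \<open>embed\<close> and pull back along
  \<open>collapse\<close>. Nothing is lost, since a compatible function agrees on the two sides of a
  joint.\<close>

lemma num_circles_closed_filling:
  fixes T :: "'v diagram"
  assumes "\<sigma> \<subseteq> crossings T"
  shows "num_circles (closed_filling m T c \<alpha>) (Inl ` Base ` \<sigma>) = 1
    \<longleftrightarrow> one_circle m T \<sigma> {h. h < m \<and> \<alpha> ! h \<noteq> 1} (c \<noteq> 1)"
proof -
  let ?L = "closed_filling m T c \<alpha>" and ?H = "{h. h < m \<and> \<alpha> ! h \<noteq> 1}"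
  let ?E = "(\<Union>c\<in>crossings ?L. range (Cr c)) \<union> (\<Union>v\<in>joints ?L. range (Jt v))"
  let ?P = "arcs ?L \<union> (\<lambda>v. range (Jt v)) ` joints ?L
    \<union> (\<Union>c\<in>Inl ` Base ` \<sigma>. A_splitting c) \<union> (\<Union>c\<in>crossings ?L - Inl ` Base ` \<sigma>. B_splitting c)"
  let ?small = "\<lambda>g. compat g (arcs T) \<and> (\<forall>x\<in>ends m T. g (partner \<sigma> ?H (c \<noteq> 1) x) = g x)"
  have embed_in: "embed x \<in> ?E" if "x \<in> ends m T" for x
    using that by (cases x) (auto simp: crossings_closed_filling joints_closed_filling image_iff)
  have collapse_in: "collapse y \<in> ends m T" if "y \<in> ?E" for y
    using that by (auto simp: crossings_closed_filling joints_closed_filling)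
  have A: "compat f (\<Union>c\<in>Inl ` Base ` \<sigma>. A_splitting c) \<longleftrightarrow>
      (\<forall>c\<in>\<sigma>. \<forall>l. f (Cr (Inl (Base c)) (A_partner l)) = f (Cr (Inl (Base c)) l))" for f :: "(('v, unit) glued + corner) end_point \<Rightarrow> bool"
  proof -
    have "compat f (A_splitting (Inl (Base c))) \<longleftrightarrow>
      (\<forall>l. f (Cr (Inl (Base c)) (A_partner l)) = f (Cr (Inl (Base c)) l))" for c
    proof
      assume "compat f (A_splitting (Inl (Base c)))"
      then show "\<forall>l. f (Cr (Inl (Base c)) (A_partner l)) = f (Cr (Inl (Base c)) l)"
        by (intro allI, case_tac l) (auto simp: A_splitting_def)
    next
      assume *: "\<forall>l. f (Cr (Inl (Base c)) (A_partner l)) = f (Cr (Inl (Base c)) l)"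
      show "compat f (A_splitting (Inl (Base c)))"
        using *[rule_format, of U1] *[rule_format, of U2] by (auto simp: A_splitting_def)
    qed
    then show ?thesis by simp
  qed
  have B: "compat f (\<Union>c\<in>crossings ?L - Inl ` Base ` \<sigma>. B_splitting c) \<longleftrightarrow>
      (\<forall>c\<in>crossings T - \<sigma>. \<forall>l. f (Cr (Inl (Base c)) (B_partner l)) = f (Cr (Inl (Base c)) l))" for f :: "(('v, unit) glued + corner) end_point \<Rightarrow> bool"
  proof -
    have "compat f (B_splitting (Inl (Base c))) \<longleftrightarrow>
      (\<forall>l. f (Cr (Inl (Base c)) (B_partner l)) = f (Cr (Inl (Base c)) l))" for c
    proof
      assume "compat f (B_splitting (Inl (Base c)))"
      then show "\<forall>l. f (Cr (Inl (Base c)) (B_partner l)) = f (Cr (Inl (Base c)) l)"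
        by (intro allI, case_tac l) (auto simp: B_splitting_def)
    next
      assume *: "\<forall>l. f (Cr (Inl (Base c)) (B_partner l)) = f (Cr (Inl (Base c)) l)"
      show "compat f (B_splitting (Inl (Base c)))"
        using *[rule_format, of U1] *[rule_format, of U2] by (auto simp: B_splitting_def)
    qed
    moreover have "crossings ?L - Inl ` Base ` \<sigma> = Inl ` Base ` (crossings T - \<sigma>)"
      by (auto simp: crossings_closed_filling)
    ultimately show ?thesis by simp
  qed
  have J: "compat f ((\<lambda>v. range (Jt v)) ` joints ?L) \<longleftrightarrow> (\<forall>v\<in>joints ?L. f (Jt v True) = f (Jt v False))"
    for f :: "(('v, unit) glued + corner) end_point \<Rightarrow> bool"
    by (simp add: compat_image const_on_image UNIV_bool) blast
  have down: "?small (\<lambda>x. f (embed x)) \<and> (\<forall>y\<in>?E. f y = f (embed (collapse y)))" if f: "compat f ?P" for f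
  proof -
    have J': "f (Jt v True) = f (Jt v False)" if "v \<in> joints ?L" for v
      using f that J[of f] unfolding compat_Un by blast
    have jB: "f (Jt (Inl (Base v)) True) = f (Jt (Inl (Base v)) False)" if "v \<in> joints T" for v
      using J'[of "Inl (Base v)"] that by (simp add: joints_closed_filling image_iff)
    have jS: "f (Jt (Inl (Seam h p)) True) = f (Jt (Inl (Seam h p)) False)" if "h < m" for h p
      using J'[of "Inl (Seam h p)"] that by (auto simp: joints_closed_filling image_iff)
    have jO: "f (Jt (Inr p) True) = f (Jt (Inr p) False)" for p
      using J'[of "Inr p"] by (simp add: joints_closed_filling)
    have arcs: "compat f (arcs ?L)" using f by simp
    note arcs = arcs[unfolded compat_arcs_closed_filling]
    have cA: "\<forall>c\<in>\<sigma>. \<forall>l. f (Cr (Inl (Base c)) (A_partner l)) = f (Cr (Inl (Base c)) l)"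
      using f A[of f] unfolding compat_Un by blast
    have cB: "\<forall>c\<in>crossings T - \<sigma>. \<forall>l. f (Cr (Inl (Base c)) (B_partner l)) = f (Cr (Inl (Base c)) l)"
      using f B[of f] unfolding compat_Un by blast
    have "f (embed (partner \<sigma> ?H (c \<noteq> 1) x)) = f (embed x)" if x: "x \<in> ends m T" for x
    proof (cases x)
      case (Out p)
      then show ?thesis using jO arcs by simp
    next
      case (Hole h p)
      then show ?thesis using x jS arcs by simp
    next
      case (Cr c l)
      then show ?thesis using x cA cB by simp
    next
      case (Jt v s)
      then show ?thesis using x jB by (cases s) simp_all
    qed
    moreover have "f y = f (embed (collapse y))" if "y \<in> ?E" for y
    proof (cases y)
      case (Cr c l)
      then show ?thesis using that by (auto simp: crossings_closed_filling)
    next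
      case (Jt v s)
      then show ?thesis using that jS jO by (cases s) (auto simp: joints_closed_filling)
    qed (use that in auto)
    ultimately show ?thesis using arcs by blast
  qed
  have up: "compat (\<lambda>y. g (collapse y)) ?P" if g: "?small g" for g
  proof -
    have p: "g (partner \<sigma> ?H (c \<noteq> 1) x) = g x" if "x \<in> ends m T" for x using g that by blast
    have "compat (\<lambda>y. g (collapse y)) (arcs ?L)"
      unfolding compat_arcs_closed_filling
      using g p[of "Out _"] p[of "Hole _ _"] by simp
    moreover have "compat (\<lambda>y. g (collapse y)) ((\<lambda>v. range (Jt v)) ` joints ?L)"
      unfolding J using p[of "Jt _ True"] by (auto simp: joints_closed_filling)
    moreover have "compat (\<lambda>y. g (collapse y)) (\<Union>c\<in>Inl ` Base ` \<sigma>. A_splitting c)"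
      unfolding A collapse.simps
    proof (intro ballI allI)
      fix c l assume "c \<in> \<sigma>"
      then show "g (Cr c (A_partner l)) = g (Cr c l)" using p[of "Cr c l"] assms by auto
    qed
    moreover have "compat (\<lambda>y. g (collapse y)) (\<Union>c\<in>crossings ?L - Inl ` Base ` \<sigma>. B_splitting c)"
      unfolding B collapse.simps
    proof (intro ballI allI)
      fix c l assume "c \<in> crossings T - \<sigma>"
      then show "g (Cr c (B_partner l)) = g (Cr c l)" using p[of "Cr c l"] by auto
    qed
    ultimately show ?thesis by simp
  qed
  have "?E \<noteq> {}" by (auto simp: joints_closed_filling)
  moreover have "(\<forall>f. compat f ?P \<longrightarrow> const_on f ?E) \<longleftrightarrow> (\<forall>g. ?small g \<longrightarrow> const_on g (ends m T))"
  proof (intro iffI allI impI)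
    fix g assume *: "\<forall>f. compat f ?P \<longrightarrow> const_on f ?E" and g: "?small g"
    have c: "const_on (\<lambda>y. g (collapse y)) ?E" using * up[OF g] by blast
    show "const_on g (ends m T)"
      unfolding const_on_def
    proof (intro ballI)
      fix x y assume "x \<in> ends m T" "y \<in> ends m T"
      then show "g x = g y" using const_onD[OF c embed_in embed_in, of x y] by simp
    qed
  next
    fix f assume *: "\<forall>g. ?small g \<longrightarrow> const_on g (ends m T)" and f: "compat f ?P"
    have c: "const_on (\<lambda>x. f (embed x)) (ends m T)" using * down[OF f] by blast
    have e: "f y = f (embed (collapse y))" if "y \<in> ?E" for y using down[OF f] that by blast
    show "const_on f ?E"
      unfolding const_on_def
    proof (intro ballI)
      fix x y assume xy: "x \<in> ?E" "y \<in> ?E"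
      show "f x = f y"
        using e[OF xy(1)] e[OF xy(2)] const_onD[OF c collapse_in[OF xy(1)] collapse_in[OF xy(2)]] by simp
    qed
  qed
  ultimately show ?thesis
    unfolding num_circles_def num_classes_eq_1_iff one_circle_def by (simp only: imp_conjL) simp
qed

definition state_weight :: "'v diagram \<Rightarrow> 'v set \<Rightarrow> complex" where
  "state_weight T \<sigma> = cis (pi / 4) powi (int (card \<sigma>) - int (card (crossings T - \<sigma>)))"

definition state_sum :: "nat \<Rightarrow> 'v diagram \<Rightarrow> nat set \<Rightarrow> bool \<Rightarrow> complex" where
  "state_sum m T H d = (\<Sum>\<sigma> | \<sigma> \<subseteq> crossings T \<and> one_circle m T \<sigma> H d. state_weight T \<sigma>)"

lemma bracket_closed_filling:
  fixes T :: "'v diagram"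
  shows "bracket (closed_filling m T c \<alpha>) = state_sum m T {h. h < m \<and> \<alpha> ! h \<noteq> 1} (c \<noteq> 1)"
proof -
  let ?L = "closed_filling m T c \<alpha>" and ?e = "\<lambda>c. Inl (Base c)"
  have inj: "inj ?e" by (auto intro: injI)
  have card_e: "card (Inl ` Base ` A) = card A" for A :: "'v set"
    unfolding image_image by (rule card_image[OF inj_on_subset[OF inj]]) simp
  have cr: "crossings ?L = Inl ` Base ` crossings T" by (rule crossings_closed_filling)
  have diff: "crossings ?L - Inl ` Base ` \<sigma> = Inl ` Base ` (crossings T - \<sigma>)" for \<sigma>
    unfolding cr by auto
  have states: "{\<sigma>. \<sigma> \<subseteq> crossings T \<and> one_circle m T \<sigma> {h. h < m \<and> \<alpha> ! h \<noteq> 1} (c \<noteq> 1)}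
      = {\<sigma>. \<sigma> \<subseteq> crossings T \<and> num_circles ?L (Inl ` Base ` \<sigma>) = 1}"
    using num_circles_closed_filling[of _ T m c \<alpha>] by blast
  have "bij_betw (\<lambda>\<sigma>. Inl ` Base ` \<sigma>)
      {\<sigma>. \<sigma> \<subseteq> crossings T \<and> one_circle m T \<sigma> {h. h < m \<and> \<alpha> ! h \<noteq> 1} (c \<noteq> 1)}
      {\<sigma>. \<sigma> \<subseteq> crossings ?L \<and> num_circles ?L \<sigma> = 1}"
    unfolding states
  proof (rule bij_betw_imageI)
    show "inj_on (\<lambda>\<sigma>. Inl ` Base ` \<sigma>) {\<sigma>. \<sigma> \<subseteq> crossings T \<and> num_circles ?L (Inl ` Base ` \<sigma>) = 1}"
      by (auto simp: inj_on_def inj_image_eq_iff)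
    show "(\<lambda>\<sigma>. Inl ` Base ` \<sigma>) ` {\<sigma>. \<sigma> \<subseteq> crossings T \<and> num_circles ?L (Inl ` Base ` \<sigma>) = 1}
        = {\<sigma>. \<sigma> \<subseteq> crossings ?L \<and> num_circles ?L \<sigma> = 1}"
    proof (intro equalityI subsetI)
      fix \<sigma> assume "\<sigma> \<in> {\<sigma>. \<sigma> \<subseteq> crossings ?L \<and> num_circles ?L \<sigma> = 1}"
      then have *: "\<sigma> \<subseteq> Inl ` Base ` crossings T" "num_circles ?L \<sigma> = 1" unfolding cr by simp_all
      from *(1) obtain \<tau> where "\<tau> \<subseteq> crossings T" "\<sigma> = Inl ` Base ` \<tau>" by (metis subset_imageE)
      then show "\<sigma> \<in> (\<lambda>\<sigma>. Inl ` Base ` \<sigma>) ` {\<sigma>. \<sigma> \<subseteq> crossings T \<and> num_circles ?L (Inl ` Base ` \<sigma>) = 1}"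
        using *(2) by blast
    qed (auto simp: cr)
  qed
  from sum.reindex_bij_betw[OF this, of "\<lambda>\<sigma>. cis (pi / 4) powi (int (card \<sigma>) - int (card (crossings ?L - \<sigma>)))"]
  show ?thesis
    unfolding bracket_def state_sum_def state_weight_def diff card_e by (rule sym)
qed

section \<open>Types of fillings\<close>

text \<open>
  Here the outer ends are left free; the closure \<open>False\<close> is arbitrary, as it only matters for them.
\<close>

definition open_state :: "nat \<Rightarrow> 'v diagram \<Rightarrow> 'v set \<Rightarrow> nat set \<Rightarrow> ('v end_point \<Rightarrow> bool) \<Rightarrow> bool" where
  "open_state n T \<sigma> H f \<longleftrightarrow> compat f (arcs T) \<and>
     (\<forall>x\<in>ends n T - range Out. f (partner \<sigma> H False x) = f x)"

lemma partner_closure: "x \<notin> range Out \<Longrightarrow> partner \<sigma> H d x = partner \<sigma> H d' x"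
  by (cases x) auto

lemma one_circle_open:
  "one_circle n T \<sigma> H d \<longleftrightarrow> (\<forall>f. open_state n T \<sigma> H f \<longrightarrow>
     (\<forall>p. f (Out (if d then vflip p else hflip p)) = f (Out p)) \<longrightarrow> const_on f (ends n T))"
proof -
  have "(\<forall>x\<in>ends n T. f (partner \<sigma> H d x) = f x) \<longleftrightarrow>
      (\<forall>x\<in>ends n T - range Out. f (partner \<sigma> H False x) = f x) \<and>
      (\<forall>p. f (Out (if d then vflip p else hflip p)) = f (Out p))" (is "?L \<longleftrightarrow> ?R") for f
  proof
    assume ?L
    then have "f (partner \<sigma> H d (Out p)) = f (Out p)" for p by (metis ends_simps(1))
    moreover have "f (partner \<sigma> H False x) = f x" if "x \<in> ends n T - range Out" for x
      using that \<open>?L\<close> partner_closure by (metis Diff_iff)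
    ultimately show ?R by simp
  next
    assume R: ?R
    show ?L
    proof
      fix x assume x: "x \<in> ends n T"
      show "f (partner \<sigma> H d x) = f x"
      proof (cases "x \<in> range Out")
        case True
        then show ?thesis using R by auto
      next
        case False
        then show ?thesis using R x partner_closure[OF False, of \<sigma> H d False] by simp
      qed
    qed
  qed
  note eq = this
  show ?thesis unfolding one_circle_def open_state_def eq imp_conjL ..
qed

lemma open_state_const: "open_state n T \<sigma> H (\<lambda>_. b)"
  by (simp add: open_state_def compat_def const_on_def)

lemma const_on_not [simp]: "const_on (\<lambda>x. \<not> f x) A \<longleftrightarrow> const_on f A"
  by (simp add: const_on_def)

lemma open_state_not: "open_state n T \<sigma> H f \<Longrightarrow> open_state n T \<sigma> H (\<lambda>x. \<not> f x)"
  unfolding open_state_def compat_def by simp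

context plane_tangle
begin

lemma open_state_balanced:
  assumes "open_state n T \<sigma> H f"
  shows "(\<forall>p. f (Out (hflip p)) = f (Out p)) \<or> (\<forall>p. f (Out (vflip p)) = f (Out p))"
  using outer_ends_balanced[of f \<sigma> H False] assms
  unfolding open_state_def all_corner by auto

text \<open>Exchanging the closure shifts the exponent in \<open>one_circle_parity\<close> by one,
  so the same state cannot give a single circle in both closures.\<close>

lemma one_circle_unique:
  assumes "\<sigma> \<subseteq> crossings T" "H \<subseteq> {..<n}" "one_circle n T \<sigma> H d" "one_circle n T \<sigma> H d'"
  shows "d = d'"
  using one_circle_parity[OF assms(1-3) assms(1,2,4)] by (cases d; cases d') auto

lemma one_circle_const:
  assumes "one_circle n T \<sigma> H d" "open_state n T \<sigma> H f" "const_on f (range Out)"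
  shows "const_on f E"
proof -
  have "f (Out q) = f (Out p)" for p q using const_onD[OF assms(3)] by blast
  then show ?thesis using assms(1,2) unfolding one_circle_open by blast
qed

text \<open>A fundamental tangle gives one circle in the closure of its own index, hence
  \<open>hflip\<close> here against \<open>vflip\<close> in the closure. A function that also
  respects the closure is constant; any other one must, by balance, have the remaining
  symmetry.\<close>

lemma one_circle_type:
  assumes "one_circle n T \<sigma> H d" "open_state n T \<sigma> H f"
  shows "f (Out (if d then hflip p else vflip p)) = f (Out p)"
proof (cases "\<forall>p. f (Out (if d then vflip p else hflip p)) = f (Out p)")
  case True
  then have "const_on f E" using assms unfolding one_circle_open by blast
  then show ?thesis by (rule const_onD) simp_all
next
  case False
  then show ?thesis using open_state_balanced[OF assms(2)] by (cases d) auto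
qed

text \<open>The other closure does not give a single circle, so it admits a nonconstant function,
  which is then nonconstant at the corners. With the prescribed symmetry there are only two
  nonconstant corner patterns, exchanged by negation.\<close>

lemma one_circle_type_surj:
  assumes "\<sigma> \<subseteq> crossings T" "H \<subseteq> {..<n}" "one_circle n T \<sigma> H d"
    and g: "\<And>p. g (if d then hflip p else vflip p) = g p"
  shows "\<exists>f. open_state n T \<sigma> H f \<and> (\<forall>p. f (Out p) = g p)"
proof (cases "\<forall>p. g p = g NW")
  case True
  then show ?thesis using open_state_const[of n T \<sigma> H "g NW"] by metis
next
  case False
  have "\<not> one_circle n T \<sigma> H (\<not> d)" using one_circle_unique assms(1-3) by blast
  then obtain f where f: "open_state n T \<sigma> H f"
    "\<forall>p. f (Out (if d then hflip p else vflip p)) = f (Out p)" "\<not> const_on f E"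
    unfolding one_circle_open by (cases d) auto
  have "\<not> const_on f (range Out)" using one_circle_const assms(3) f by blast
  then have nc: "\<not> (\<forall>p. f (Out p) = f (Out NW))" by (auto simp: const_on_def)
  have "(\<forall>p. f (Out p) = g p) \<or> (\<forall>p. (\<not> f (Out p)) = g p)"
  proof (cases d)
    case True
    have "g NE = g NW" "g SE = g SW" "f (Out NE) = f (Out NW)" "f (Out SE) = f (Out SW)"
      using g[of NW] g[of SW] f(2)[rule_format, of NW] f(2)[rule_format, of SW] True by simp_all
    then show ?thesis using False nc unfolding all_corner by argo
  next
    case d: False
    have "g SW = g NW" "g SE = g NE" "f (Out SW) = f (Out NW)" "f (Out SE) = f (Out NE)"
      using g[of NW] g[of NE] f(2)[rule_format, of NW] f(2)[rule_format, of NE] d by simp_all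
    then show ?thesis using False nc unfolding all_corner by argo
  qed
  then show ?thesis using f(1) open_state_not[OF f(1)] by blast
qed

text \<open>If there were no such function, the failing closures would supply \<open>f\<close>
  distinguishing left from right and \<open>g\<close> distinguishing top from bottom. Their sum
  modulo 2 would then single out a diagonal, against \<open>open_state_balanced\<close>.\<close>

lemma closed_component:
  assumes "\<not> one_circle n T \<sigma> H True" "\<not> one_circle n T \<sigma> H False"
  shows "\<exists>f. open_state n T \<sigma> H f \<and> const_on f (range Out) \<and> \<not> const_on f E"
proof (rule ccontr)
  assume *: "\<not> ?thesis"
  obtain f where f: "open_state n T \<sigma> H f" "\<forall>p. f (Out (vflip p)) = f (Out p)" "\<not> const_on f E"
    using assms(1) unfolding one_circle_open by auto
  obtain g where g: "open_state n T \<sigma> H g" "\<forall>p. g (Out (hflip p)) = g (Out p)" "\<not> const_on g E"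
    using assms(2) unfolding one_circle_open by auto
  have "\<not> const_on f (range Out)" "\<not> const_on g (range Out)" using * f g by blast+
  then have nc: "\<not> (\<forall>p. f (Out p) = f (Out NW))" "\<not> (\<forall>p. g (Out p) = g (Out NW))"
    by (auto simp: const_on_def)
  have "open_state n T \<sigma> H (\<lambda>x. f x \<noteq> g x)"
    using f(1) g(1) unfolding open_state_def compat_arcs by auto
  moreover have "f (Out SW) = f (Out NW)" "f (Out SE) = f (Out NE)"
    "g (Out NE) = g (Out NW)" "g (Out SE) = g (Out SW)"
    using f(2)[rule_format, of NW] f(2)[rule_format, of NE] g(2)[rule_format, of NW] g(2)[rule_format, of SW]
    by simp_all
  ultimately show False
    using open_state_balanced[of \<sigma> H "\<lambda>x. f x \<noteq> g x"] nc unfolding all_corner by simp argo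
qed

end

section \<open>States of a filled diagram\<close>

lemma (in plane_tangle) open_state_cong:
  assumes "\<And>x. x \<in> E \<Longrightarrow> f x = g x"
  shows "open_state n T \<sigma> H f \<longleftrightarrow> open_state n T \<sigma> H g"
  using assms unfolding open_state_def compat_arcs by simp

section \<open>Numbering of the holes of a filled diagram\<close>

lemma hole_block_exists:
  fixes k :: "nat \<Rightarrow> nat" and n :: nat
  shows "q < (\<Sum>j<n. k j) \<Longrightarrow> \<exists>j<n. \<exists>h<k j. q = (\<Sum>i<j. k i) + h"
proof (induction n)
  case (Suc n)
  show ?case
  proof (cases "q < (\<Sum>j<n. k j)")
    case True
    then show ?thesis using Suc.IH less_SucI by blast
  next
    case False
    then have "q - (\<Sum>j<n. k j) < k n" "q = (\<Sum>j<n. k j) + (q - (\<Sum>j<n. k j))"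
      using Suc.prems by auto
    then show ?thesis by blast
  qed
qed simp

lemma hole_block_end:
  fixes k :: "nat \<Rightarrow> nat" and j :: nat
  assumes "j < j'"
  shows "(\<Sum>i<j. k i) + k j \<le> (\<Sum>i<j'. k i)"
proof -
  have "(\<Sum>i<Suc j. k i) \<le> (\<Sum>i<j'. k i)"
    using assms by (intro sum_mono2) auto
  then show ?thesis by simp
qed

lemma hole_block_less:
  fixes k :: "nat \<Rightarrow> nat" and j :: nat
  assumes "j < n" "h < k j"
  shows "(\<Sum>i<j. k i) + h < (\<Sum>i<n. k i)"
  using hole_block_end[OF assms(1), of k] assms(2) by linarith

lemma hole_block_unique:
  fixes k :: "nat \<Rightarrow> nat" and j :: nat
  assumes "(\<Sum>i<j. k i) + h = (\<Sum>i<j'. k i) + h'" "h < k j" "h' < k j'"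
  shows "j = j' \<and> h = h'"
  using assms hole_block_end[of j j' k] hole_block_end[of j' j k] by (cases j j' rule: linorder_cases) auto

definition merge :: "nat \<Rightarrow> 'v set \<Rightarrow> (nat \<Rightarrow> 'w set) \<Rightarrow> ('v, 'w) glued set" where
  "merge n \<sigma> \<tau> = Base ` \<sigma> \<union> (\<Union>j<n. Filling j ` \<tau> j)"

lemma in_merge [simp]:
  "Base c \<in> merge n \<sigma> \<tau> \<longleftrightarrow> c \<in> \<sigma>"
  "Filling j c' \<in> merge n \<sigma> \<tau> \<longleftrightarrow> j < n \<and> c' \<in> \<tau> j"
  "Seam j p \<notin> merge n \<sigma> \<tau>"
  by (auto simp: merge_def)

definition block :: "(nat \<Rightarrow> nat) \<Rightarrow> nat set \<Rightarrow> nat \<Rightarrow> nat set" where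
  "block k H j = {h. h < k j \<and> (\<Sum>i<j. k i) + h \<in> H}"

text \<open>The two sides of a seam joint take their values from different pieces, so compatibility
  there says exactly that \<open>f\<close> and \<open>g j\<close> agree. For holes in range,
  \<open>hole_block_unique\<close> makes the pair \<open>j\<close>, \<open>h\<close> unique; all
  other holes, and crossings named by a seam, get the default \<open>False\<close>.\<close>

fun glue :: "nat \<Rightarrow> (nat \<Rightarrow> nat) \<Rightarrow> ('v end_point \<Rightarrow> bool) \<Rightarrow> (nat \<Rightarrow> 'w end_point \<Rightarrow> bool)
    \<Rightarrow> ('v, 'w) glued end_point \<Rightarrow> bool" where
  "glue n k f g (Out p) = f (Out p)"
| "glue n k f g (Hole q p) = (\<exists>j<n. \<exists>h<k j. q = (\<Sum>i<j. k i) + h \<and> g j (Hole h p))"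
| "glue n k f g (Cr (Base c) l) = f (Cr c l)"
| "glue n k f g (Cr (Filling j c) l) = g j (Cr c l)"
| "glue n k f g (Cr (Seam j p) l) = False"
| "glue n k f g (Jt (Base v) s) = f (Jt v s)"
| "glue n k f g (Jt (Filling j v) s) = g j (Jt v s)"
| "glue n k f g (Jt (Seam j p) s) = (if s then f (Hole j p) else g j (Out p))"

lemma glue_base [simp]: "glue n k f g (embed_base x) = f x"
  by (cases x) auto

lemma glue_filling:
  assumes "j < n" "x \<in> ends (k j) S"
  shows "glue n k f g (embed_filling (\<Sum>i<j. k i) j x) = g j x"
proof (cases x)
  case (Hole h p)
  then have h: "h < k j" using assms(2) by simp
  show ?thesis unfolding Hole using h assms(1) hole_block_unique[where k = k, OF _ h] by auto
qed auto

text \<open>The counterpart of \<open>open_state\<close> with the holes left free instead of the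
  outer ends; the hole set \<open>{}\<close> is therefore an arbitrary choice.\<close>

definition base_state :: "nat \<Rightarrow> 'v diagram \<Rightarrow> 'v set \<Rightarrow> bool \<Rightarrow> ('v end_point \<Rightarrow> bool) \<Rightarrow> bool" where
  "base_state n T \<sigma> d f \<longleftrightarrow> compat f (arcs T) \<and>
     (\<forall>x\<in>ends n T. (\<forall>h p. x \<noteq> Hole h p) \<longrightarrow> f (partner \<sigma> {} d x) = f x)"

lemma one_circle_base:
  "one_circle n T \<sigma> B d \<longleftrightarrow> (\<forall>f. base_state n T \<sigma> d f \<longrightarrow>
     (\<forall>j<n. \<forall>p. f (Hole j (if j \<in> B then hflip p else vflip p)) = f (Hole j p)) \<longrightarrow>
     const_on f (ends n T))"
proof -
  have *: "partner \<sigma> B d x = partner \<sigma> {} d x" if "\<forall>h p. x \<noteq> Hole h p" for x :: "'a end_point"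
    using that by (cases x) auto
  have eq: "(\<forall>x\<in>ends n T. f (partner \<sigma> B d x) = f x) \<longleftrightarrow>
      (\<forall>x\<in>ends n T. (\<forall>h p. x \<noteq> Hole h p) \<longrightarrow> f (partner \<sigma> {} d x) = f x) \<and>
      (\<forall>j<n. \<forall>p. f (Hole j (if j \<in> B then hflip p else vflip p)) = f (Hole j p))"
    (is "?L \<longleftrightarrow> ?R1 \<and> ?R2") for f
  proof (intro iffI conjI)
    assume L: ?L
    show ?R1
    proof (intro ballI impI)
      fix x assume x: "x \<in> ends n T" "\<forall>h p. x \<noteq> Hole h p"
      then have "f (partner \<sigma> B d x) = f x" using L by blast
      then show "f (partner \<sigma> {} d x) = f x" using *[OF x(2)] by simp
    qed
    show ?R2
    proof (intro allI impI)
      fix j p assume "j < n"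
      then have "f (partner \<sigma> B d (Hole j p)) = f (Hole j p)" by (intro bspec[OF L]) simp
      then show "f (Hole j (if j \<in> B then hflip p else vflip p)) = f (Hole j p)" by simp
    qed
  next
    assume R: "?R1 \<and> ?R2"
    show ?L
    proof
      fix x assume x: "x \<in> ends n T"
      show "f (partner \<sigma> B d x) = f x"
      proof (cases "\<exists>h p. x = Hole h p")
        case True
        then show ?thesis using R x by auto
      next
        case False
        then have "f (partner \<sigma> {} d x) = f x" using R x by blast
        then show ?thesis using *[of x] False by simp
      qed
    qed
  qed
  show ?thesis unfolding one_circle_def base_state_def eq imp_conjL ..
qed

section \<open>Gluing functions and states over a filled diagram\<close>

locale filled =
  fixes n :: nat and k :: "nat \<Rightarrow> nat" and T :: "'v diagram" and S :: "nat \<Rightarrow> 'w diagram"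
  assumes base: "tangle_diagram n T"
    and filling: "\<And>j. j < n \<Longrightarrow> tangle_diagram (k j) (S j)"
begin

abbreviation "holes \<equiv> (\<Sum>j<n. k j)"
abbreviation "filled_diagram \<equiv> fill n k T S"
abbreviation into :: "nat \<Rightarrow> 'w end_point \<Rightarrow> ('v, 'w) glued end_point" where
  "into j \<equiv> embed_filling (\<Sum>i<j. k i) j"

lemma plane_filling: "j < n \<Longrightarrow> plane_tangle (k j) (S j)"
  using filling by unfold_locales

lemma crossings_fill: "crossings filled_diagram = merge n (crossings T) (\<lambda>j. crossings (S j))"
  by (simp add: fill_def merge_def)

lemma base_in_ends: "x \<in> ends n T \<Longrightarrow> embed_base x \<in> ends holes filled_diagram"
  by (cases x) (auto simp: fill_def)

lemma filling_in_ends: "j < n \<Longrightarrow> x \<in> ends (k j) (S j) \<Longrightarrow> into j x \<in> ends holes filled_diagram"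
  by (cases x) (auto simp: fill_def hole_block_less)

lemma ends_fill_cases:
  assumes "y \<in> ends holes filled_diagram"
  obtains x where "x \<in> ends n T" "y = embed_base x"
    | j x where "j < n" "x \<in> ends (k j) (S j)" "y = into j x"
proof (cases y)
  case (Out p)
  then show ?thesis using that(1)[of "Out p"] by simp
next
  case (Hole q p)
  then obtain j h where "j < n" "h < k j" "q = (\<Sum>i<j. k i) + h"
    using assms hole_block_exists[of q k n] by auto
  then show ?thesis using that(2)[of j "Hole h p"] Hole by simp
next
  case (Cr c l)
  then have "c \<in> merge n (crossings T) (\<lambda>j. crossings (S j))"
    using assms crossings_fill by simp
  then show ?thesis using that(1)[of "Cr _ l"] that(2)[of _ "Cr _ l"] Cr
    by (auto simp: merge_def)
next
  case (Jt v s)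
  then have "v \<in> Base ` joints T \<union> (\<Union>j<n. Filling j ` joints (S j)) \<union> {Seam j p | j p. j < n}"
    using assms by (simp add: fill_def)
  then consider v' where "v = Base v'" "v' \<in> joints T" | j v' where "j < n" "v = Filling j v'" "v' \<in> joints (S j)"
    | j p where "j < n" "v = Seam j p" by blast
  then show ?thesis
  proof cases
    case 1
    then show ?thesis using that(1)[of "Jt v' s"] Jt by simp
  next
    case 2
    then show ?thesis using that(2)[of j "Jt v' s"] Jt by simp
  next
    case 3
    then show ?thesis using that(1)[of "Hole j p"] that(2)[of j "Out p"] Jt by (cases s) simp_all
  qed
qed

lemma compat_arcs_fill:
  "compat f (arcs filled_diagram) \<longleftrightarrow>
    compat (\<lambda>x. f (embed_base x)) (arcs T) \<and> (\<forall>j<n. compat (\<lambda>x. f (into j x)) (arcs (S j)))"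
  by (simp add: fill_def compat_image const_on_image) (simp add: compat_def Ball_def)

lemma partner_base:
  "\<forall>h p. x \<noteq> Hole h p \<Longrightarrow> partner (merge n \<sigma> \<tau>) H d (embed_base x) = embed_base (partner \<sigma> {} d x)"
  by (cases x) auto

lemma partner_filling:
  "j < n \<Longrightarrow> x \<in> ends (k j) (S j) \<Longrightarrow> x \<notin> range Out \<Longrightarrow>
    partner (merge n \<sigma> \<tau>) H d (into j x) = into j (partner (\<tau> j) (block k H j) False x)"
  by (cases x) (auto simp: block_def)

text \<open>Pieces meet only at seam joints, so a consistent function on the filled diagram is a
  family of consistent functions on the pieces that agree at the seams.\<close>

lemma consistent_fill:
  "compat f (arcs filled_diagram) \<and>
   (\<forall>y\<in>ends holes filled_diagram. f (partner (merge n \<sigma> \<tau>) H d y) = f y) \<longleftrightarrow>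
   base_state n T \<sigma> d (\<lambda>x. f (embed_base x)) \<and>
   (\<forall>j<n. open_state (k j) (S j) (\<tau> j) (block k H j) (\<lambda>x. f (into j x))) \<and>
   (\<forall>j<n. \<forall>p. f (into j (Out p)) = f (embed_base (Hole j p)))" (is "?L \<longleftrightarrow> ?R")
proof
  assume L: ?L
  then have P: "f (partner (merge n \<sigma> \<tau>) H d y) = f y" if "y \<in> ends holes filled_diagram" for y
    using that by blast
  have "base_state n T \<sigma> d (\<lambda>x. f (embed_base x))"
    unfolding base_state_def
  proof (intro conjI ballI impI)
    fix x assume "x \<in> ends n T" "\<forall>h p. x \<noteq> Hole h p"
    then show "f (embed_base (partner \<sigma> {} d x)) = f (embed_base x)"
      using P[OF base_in_ends] partner_base by metis
  qed (use L compat_arcs_fill in blast)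
  moreover have "open_state (k j) (S j) (\<tau> j) (block k H j) (\<lambda>x. f (into j x))" if "j < n" for j
    unfolding open_state_def
  proof (intro conjI ballI)
    fix x assume x: "x \<in> ends (k j) (S j) - range Out"
    then show "f (into j (partner (\<tau> j) (block k H j) False x)) = f (into j x)"
      using P[OF filling_in_ends[OF that, of x]] partner_filling[OF that, of x \<sigma> \<tau> H d] by simp
  qed (use L compat_arcs_fill that in blast)
  moreover have "f (into j (Out p)) = f (embed_base (Hole j p))" if "j < n" for j p
    using P[OF base_in_ends, of "Hole j p"] that by simp
  ultimately show ?R by blast
next
  assume R: ?R
  have seam: "f (Jt (Seam j p) False) = f (Jt (Seam j p) True)" if "j < n" for j p
    using R that by simp
  have "f (partner (merge n \<sigma> \<tau>) H d y) = f y" if "y \<in> ends holes filled_diagram" for y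
    using that
  proof (cases rule: ends_fill_cases)
    case (1 x)
    show ?thesis
    proof (cases "\<exists>h p. x = Hole h p")
      case True
      then show ?thesis using 1 seam by auto
    next
      case False
      have "f (embed_base (partner \<sigma> {} d x)) = f (embed_base x)"
        using R 1(1) False unfolding base_state_def by blast
      then show ?thesis using 1(2) partner_base[of x \<sigma> \<tau> H d] False by simp
    qed
  next
    case (2 j x)
    show ?thesis
    proof (cases "x \<in> range Out")
      case True
      then show ?thesis using 2 seam by auto
    next
      case False
      then have "f (into j (partner (\<tau> j) (block k H j) False x)) = f (into j x)"
        using R 2(1,2) unfolding open_state_def by blast
      then show ?thesis using 2(3) partner_filling[OF 2(1,2) False, of \<sigma> \<tau> H d] by simp
    qed
  qed
  moreover have "compat f (arcs filled_diagram)"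
    unfolding compat_arcs_fill using R by (simp add: base_state_def open_state_def)
  ultimately show ?L by blast
qed

lemma const_on_fill:
  "const_on f (ends holes filled_diagram) \<Longrightarrow> const_on (\<lambda>x. f (embed_base x)) (ends n T)"
  unfolding const_on_def using base_in_ends by blast

text \<open>
  A filling without closed components amounts to one of the two fundamental tangles, namely the one
  whose index is that of the closure with a single circle.
\<close>

lemma one_circle_fill:
  assumes \<tau>: "\<And>j. j < n \<Longrightarrow> \<tau> j \<subseteq> crossings (S j)"
  shows "one_circle holes filled_diagram (merge n \<sigma> \<tau>) H d \<longleftrightarrow>
    (\<exists>B\<subseteq>{..<n}. one_circle n T \<sigma> B d \<and> (\<forall>j<n. one_circle (k j) (S j) (\<tau> j) (block k H j) (j \<in> B)))"
    (is "?L \<longleftrightarrow> ?R")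
proof
  assume ?R
  then obtain B where B: "one_circle n T \<sigma> B d"
    "\<And>j. j < n \<Longrightarrow> one_circle (k j) (S j) (\<tau> j) (block k H j) (j \<in> B)" by blast
  show ?L
    unfolding one_circle_def imp_conjL[symmetric] consistent_fill
  proof (intro allI impI)
    fix f
    assume f: "base_state n T \<sigma> d (\<lambda>x. f (embed_base x)) \<and>
      (\<forall>j<n. open_state (k j) (S j) (\<tau> j) (block k H j) (\<lambda>x. f (into j x))) \<and>
      (\<forall>j<n. \<forall>p. f (into j (Out p)) = f (embed_base (Hole j p)))"
    have open_j: "open_state (k j) (S j) (\<tau> j) (block k H j) (\<lambda>x. f (into j x))" if "j < n" for j
      using f that by blast
    have seam: "f (into j (Out p)) = f (embed_base (Hole j p))" if "j < n" for j p
      using f that by blast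
    \<comment> \<open>The type of filling \<open>j\<close> passes to the hole it occupies: on the
      base, \<open>f\<close> behaves as if the hole contained the fundamental tangle selected by
      \<open>B\<close>.\<close>
    have "f (embed_base (Hole j (if j \<in> B then hflip p else vflip p))) = f (embed_base (Hole j p))"
      if j: "j < n" for j p
      using plane_tangle.one_circle_type[OF plane_filling[OF j] B(2)[OF j] open_j[OF j]] seam[OF j] by metis
    then have const: "const_on (\<lambda>x. f (embed_base x)) (ends n T)"
      using B(1) f unfolding one_circle_base by blast
    have to_base: "f y = f (embed_base (Out NW))" if "y \<in> ends holes filled_diagram" for y
      using that
    proof (cases rule: ends_fill_cases)
      case (1 x)
      then show ?thesis using const_onD[OF const] by (metis ends_simps(1))
    next
      case (2 j x)
      have hole: "f (into j (Out p)) = f (embed_base (Out NW))" for p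
        using seam[OF 2(1)] const_onD[OF const, of "Hole j p" "Out NW"] 2(1) by simp
      have "const_on (\<lambda>x. f (into j x)) (ends (k j) (S j))"
      proof (rule plane_tangle.one_circle_const[OF plane_filling[OF 2(1)] B(2)[OF 2(1)] open_j[OF 2(1)]])
        show "const_on (\<lambda>x. f (into j x)) (range Out)"
          unfolding const_on_image by (simp only: hole) (simp add: const_on_def)
      qed
      from const_onD[OF this 2(2), of "Out NW"] show ?thesis using hole 2(3) by simp
    qed
    then show "const_on f (ends holes filled_diagram)" unfolding const_on_def by metis
  qed
next
  assume L: ?L
  have const: "const_on f (ends holes filled_diagram)"
    if "base_state n T \<sigma> d (\<lambda>x. f (embed_base x))"
      "\<And>j. j < n \<Longrightarrow> open_state (k j) (S j) (\<tau> j) (block k H j) (\<lambda>x. f (into j x))"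
      "\<And>j p. j < n \<Longrightarrow> f (into j (Out p)) = f (embed_base (Hole j p))" for f
  proof -
    have "compat f (arcs filled_diagram) \<and>
        (\<forall>y\<in>ends holes filled_diagram. f (partner (merge n \<sigma> \<tau>) H d y) = f y)"
      using that unfolding consistent_fill by simp
    then show ?thesis using L unfolding one_circle_def by simp
  qed
  have glue_open: "open_state (k j) (S j) (\<tau> j) (block k H j) (\<lambda>x. glue n k f g (into j x))"
    if "j < n" "open_state (k j) (S j) (\<tau> j) (block k H j) (g j)" for j f and g :: "nat \<Rightarrow> 'w end_point \<Rightarrow> bool"
    using plane_tangle.open_state_cong[OF plane_filling[OF that(1)],
        of "\<lambda>x. glue n k f g (into j x)" "g j", OF glue_filling[OF that(1), where S = "S j"]] that(2) by blast
  have typed: "one_circle (k j) (S j) (\<tau> j) (block k H j) True \<or> one_circle (k j) (S j) (\<tau> j) (block k H j) False"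
    if j: "j < n" for j
  proof (rule ccontr)
    assume "\<not> ?thesis"
    then obtain f where f: "open_state (k j) (S j) (\<tau> j) (block k H j) f"
      "const_on f (range Out)" "\<not> const_on f (ends (k j) (S j))"
      using plane_tangle.closed_component[OF plane_filling[OF j]] by blast
    \<comment> \<open>A function detecting a closed component of filling \<open>j\<close> is
      constant at the seams, so it extends by that value to all other pieces, against the single
      circle.\<close>
    define g where "g i = (if i = j then f else (\<lambda>_. f (Out NW)))" for i
    let ?f = "glue n k (\<lambda>_. f (Out NW)) g :: ('v, 'w) glued end_point \<Rightarrow> bool"
    have "f (Out p) = f (Out NW)" for p using const_onD[OF f(2)] by blast
    then have "g i (Out p) = f (Out NW)" for i p by (simp add: g_def)
    moreover have "open_state (k i) (S i) (\<tau> i) (block k H i) (g i)" for i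
      using f(1) by (simp add: g_def open_state_const)
    moreover have "base_state n T \<sigma> d (\<lambda>_. f (Out NW))"
      by (simp add: base_state_def compat_def const_on_def)
    ultimately have c: "const_on ?f (ends holes filled_diagram)"
      by (intro const) (simp_all add: glue_open)
    have "f x = f y" if "x \<in> ends (k j) (S j)" "y \<in> ends (k j) (S j)" for x y
      using const_onD[OF c filling_in_ends[OF j that(1)] filling_in_ends[OF j that(2)]]
      by (simp add: g_def glue_filling[where k = k and S = "S j", OF j that(1)]
        glue_filling[where k = k and S = "S j", OF j that(2)])
    then show False using f(3) unfolding const_on_def by blast
  qed
  define B where "B = {j. j < n \<and> one_circle (k j) (S j) (\<tau> j) (block k H j) True}"
  have oneB: "one_circle (k j) (S j) (\<tau> j) (block k H j) (j \<in> B)" if "j < n" for j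
    using typed[OF that] that by (cases "j \<in> B") (auto simp: B_def)
  have "one_circle n T \<sigma> B d"
    unfolding one_circle_base
  proof (intro allI impI)
    fix f
    assume f: "base_state n T \<sigma> d f"
      and flip: "\<forall>j<n. \<forall>p. f (Hole j (if j \<in> B then hflip p else vflip p)) = f (Hole j p)"
    \<comment> \<open>A function on the base with the right symmetry at the holes extends over all
      fillings; the single circle of the filled diagram then makes it constant.\<close>
    have "\<exists>g. open_state (k j) (S j) (\<tau> j) (block k H j) g \<and> (\<forall>p. g (Out p) = f (Hole j p))" if j: "j < n" for j
      using plane_tangle.one_circle_type_surj[OF plane_filling[OF j] \<tau>[OF j] _ oneB[OF j], of "\<lambda>p. f (Hole j p)"]
        flip j by (auto simp: block_def)
    then obtain g where g: "\<And>j. j < n \<Longrightarrow> open_state (k j) (S j) (\<tau> j) (block k H j) (g j)"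
      "\<And>j p. j < n \<Longrightarrow> g j (Out p) = f (Hole j p)" by metis
    have "const_on (glue n k f g :: ('v, 'w) glued end_point \<Rightarrow> bool) (ends holes filled_diagram)"
      by (intro const) (simp_all add: glue_open f g)
    from const_on_fill[OF this] show "const_on f (ends n T)" by simp
  qed
  moreover have "B \<subseteq> {..<n}" by (auto simp: B_def)
  ultimately show ?R using oneB by blast
qed

text \<open>By \<open>one_circle_unique\<close> at most one set \<open>B\<close> of types fits, so
  the existential in \<open>one_circle_fill\<close> becomes a sum with at most one nonzero
  term.\<close>

lemma one_circle_fill_sum:
  assumes \<tau>: "\<And>j. j < n \<Longrightarrow> \<tau> j \<subseteq> crossings (S j)"
  shows "(of_bool (one_circle holes filled_diagram (merge n \<sigma> \<tau>) H d) :: complex) =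
    (\<Sum>B\<in>Pow {..<n}. of_bool (one_circle n T \<sigma> B d) *
       (\<Prod>j<n. of_bool (one_circle (k j) (S j) (\<tau> j) (block k H j) (j \<in> B))))"
proof -
  let ?Q = "\<lambda>B. one_circle n T \<sigma> B d \<and> (\<forall>j<n. one_circle (k j) (S j) (\<tau> j) (block k H j) (j \<in> B))"
  have summand: "of_bool (one_circle n T \<sigma> B d) *
       (\<Prod>j<n. of_bool (one_circle (k j) (S j) (\<tau> j) (block k H j) (j \<in> B))) = (of_bool (?Q B) :: complex)" for B
  proof (cases "\<forall>j<n. one_circle (k j) (S j) (\<tau> j) (block k H j) (j \<in> B)")
    case False
    then show ?thesis by (auto intro!: prod_zero)
  qed simp
  have unique: "B = B'" if "?Q B" "?Q B'" "B \<subseteq> {..<n}" "B' \<subseteq> {..<n}" for B B'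
  proof -
    have "j \<in> B \<longleftrightarrow> j \<in> B'" if j: "j < n" for j
      using plane_tangle.one_circle_unique[OF plane_filling[OF j] \<tau>[OF j], of "block k H j" "j \<in> B" "j \<in> B'"]
        \<open>?Q B\<close> \<open>?Q B'\<close> j by (auto simp: block_def)
    then show ?thesis using that(3,4) by (auto simp: subset_eq)
  qed
  show ?thesis
  proof (cases "\<exists>B\<subseteq>{..<n}. ?Q B")
    case True
    then obtain B where B: "B \<subseteq> {..<n}" "?Q B" by blast
    have "(\<Sum>B'\<in>Pow {..<n}. of_bool (?Q B') :: complex) = (\<Sum>B'\<in>Pow {..<n}. if B' = B then 1 else 0)"
    proof (rule sum.cong[OF refl])
      fix B' assume "B' \<in> Pow {..<n}"
      then have "?Q B' \<longleftrightarrow> B' = B" using unique[of B' B] B by blast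
      then show "(of_bool (?Q B') :: complex) = (if B' = B then 1 else 0)" by simp
    qed
    also have "\<dots> = 1" using B(1) by simp
    moreover have "one_circle holes filled_diagram (merge n \<sigma> \<tau>) H d"
      using one_circle_fill[OF \<tau>, of \<sigma> H d] True by simp
    ultimately show ?thesis unfolding summand by simp
  next
    case False
    then have "(\<Sum>B'\<in>Pow {..<n}. of_bool (?Q B') :: complex) = 0"
      by (intro sum.neutral) auto
    moreover have "\<not> one_circle holes filled_diagram (merge n \<sigma> \<tau>) H d"
      using one_circle_fill[OF \<tau>, of \<sigma> H d] False by simp
    ultimately show ?thesis unfolding summand by simp
  qed
qed

lemma card_merge:
  fixes \<sigma> :: "'v set" and \<tau> :: "nat \<Rightarrow> 'w set"
  assumes "finite \<sigma>" "\<And>j. j < n \<Longrightarrow> finite (\<tau> j)"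
  shows "card (merge n \<sigma> \<tau>) = card \<sigma> + (\<Sum>j<n. card (\<tau> j))"
proof -
  have "card (\<Union>j<n. Filling j ` \<tau> j :: ('v, 'w) glued set) = (\<Sum>j<n. card (Filling j ` \<tau> j :: ('v, 'w) glued set))"
    using assms(2) by (intro card_UN_disjoint) auto
  moreover have "card (Filling j ` \<tau> j :: ('v, 'w) glued set) = card (\<tau> j)" for j
    by (rule card_image) (simp add: inj_on_def)
  moreover have "card (Base ` \<sigma> :: ('v, 'w) glued set) = card \<sigma>"
    by (rule card_image) (simp add: inj_on_def)
  moreover have "card (merge n \<sigma> \<tau>) = card (Base ` \<sigma> :: ('v, 'w) glued set) + card (\<Union>j<n. Filling j ` \<tau> j :: ('v, 'w) glued set)"
    unfolding merge_def using assms by (intro card_Un_disjoint) auto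
  ultimately show ?thesis by simp
qed

lemma finite_crossings_base: "finite (crossings T)"
  and finite_crossings_filling: "j < n \<Longrightarrow> finite (crossings (S j))"
  using base filling by (auto simp: tangle_diagram_def)

lemma state_weight_merge:
  assumes "\<sigma> \<subseteq> crossings T" "\<And>j. j < n \<Longrightarrow> \<tau> j \<subseteq> crossings (S j)"
  shows "state_weight filled_diagram (merge n \<sigma> \<tau>) = state_weight T \<sigma> * (\<Prod>j<n. state_weight (S j) (\<tau> j))"
proof -
  let ?A = "cis (pi / 4)"
  have diff: "crossings filled_diagram - merge n \<sigma> \<tau> = merge n (crossings T - \<sigma>) (\<lambda>j. crossings (S j) - \<tau> j)"
  proof (rule Set.set_eqI)
    fix c
    show "c \<in> crossings filled_diagram - merge n \<sigma> \<tau>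
        \<longleftrightarrow> c \<in> merge n (crossings T - \<sigma>) (\<lambda>j. crossings (S j) - \<tau> j)"
      unfolding crossings_fill by (cases c) auto
  qed
  have "finite \<sigma>" "\<And>j. j < n \<Longrightarrow> finite (\<tau> j)"
    using assms finite_crossings_base finite_crossings_filling finite_subset by blast+
  then have cards: "card (merge n \<sigma> \<tau>) = card \<sigma> + (\<Sum>j<n. card (\<tau> j))"
    "card (merge n (crossings T - \<sigma>) (\<lambda>j. crossings (S j) - \<tau> j))
      = card (crossings T - \<sigma>) + (\<Sum>j<n. card (crossings (S j) - \<tau> j))"
    using finite_crossings_base finite_crossings_filling by (auto intro!: card_merge)
  have w: "?A powi (int a - int b) = ?A ^ a / ?A ^ b" for a b
    by (simp add: power_int_diff)
  show ?thesis
    unfolding state_weight_def diff cards w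
    by (simp add: power_add power_sum prod_dividef)
qed

text \<open>\<open>merge\<close> sees \<open>\<tau>\<close> only below \<open>n\<close>; taking
  \<open>\<tau>\<close> extensional on \<open>{..<n}\<close> is what makes it injective.\<close>

lemma bij_merge:
  "bij_betw (\<lambda>(\<sigma>, \<tau>). merge n \<sigma> \<tau>)
    (Pow (crossings T) \<times> Pi\<^sub>E {..<n} (\<lambda>j. Pow (crossings (S j)))) (Pow (crossings filled_diagram))"
proof (rule bij_betw_byWitness[where f' = "\<lambda>\<rho>. (Base -` \<rho>, \<lambda>j\<in>{..<n}. Filling j -` \<rho>)"])
  let ?D = "Pow (crossings T) \<times> Pi\<^sub>E {..<n} (\<lambda>j. Pow (crossings (S j)))"
  show "\<forall>x\<in>?D. (\<lambda>\<rho>. (Base -` \<rho>, \<lambda>j\<in>{..<n}. Filling j -` \<rho>)) (case x of (\<sigma>, \<tau>) \<Rightarrow> merge n \<sigma> \<tau>) = x"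
  proof
    fix x assume "x \<in> ?D"
    then obtain \<sigma> \<tau> where x: "x = (\<sigma>, \<tau>)" "\<tau> \<in> extensional {..<n}" by (auto simp: PiE_def)
    have "(\<lambda>j\<in>{..<n}. Filling j -` merge n \<sigma> \<tau>) = \<tau>"
      using x(2) by (intro ext) (auto simp: extensional_def)
    then show "(\<lambda>\<rho>. (Base -` \<rho>, \<lambda>j\<in>{..<n}. Filling j -` \<rho>)) (case x of (\<sigma>, \<tau>) \<Rightarrow> merge n \<sigma> \<tau>) = x"
      by (auto simp: x(1) vimage_def)
  qed
  show "\<forall>\<rho>\<in>Pow (crossings filled_diagram). (case (Base -` \<rho>, \<lambda>j\<in>{..<n}. Filling j -` \<rho>) of (\<sigma>, \<tau>) \<Rightarrow> merge n \<sigma> \<tau>) = \<rho>"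
  proof
    fix \<rho> assume \<rho>: "\<rho> \<in> Pow (crossings filled_diagram)"
    have "c \<in> merge n (Base -` \<rho>) (\<lambda>j\<in>{..<n}. Filling j -` \<rho>) \<longleftrightarrow> c \<in> \<rho>" for c
      using \<rho> unfolding crossings_fill by (cases c) auto
    then show "(case (Base -` \<rho>, \<lambda>j\<in>{..<n}. Filling j -` \<rho>) of (\<sigma>, \<tau>) \<Rightarrow> merge n \<sigma> \<tau>) = \<rho>" by auto
  qed
  show "(\<lambda>(\<sigma>, \<tau>). merge n \<sigma> \<tau>) ` ?D \<subseteq> Pow (crossings filled_diagram)"
  proof (rule image_subsetI)
    fix x assume "x \<in> ?D"
    then obtain \<sigma> \<tau> where x: "x = (\<sigma>, \<tau>)" "\<sigma> \<subseteq> crossings T"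
      and \<tau>: "\<And>j. j < n \<Longrightarrow> \<tau> j \<subseteq> crossings (S j)" by (fastforce simp: PiE_def Pi_def)
    have "c \<in> crossings filled_diagram" if "c \<in> merge n \<sigma> \<tau>" for c
      using that x(2) \<tau> unfolding crossings_fill by (cases c) auto
    then show "(case x of (\<sigma>, \<tau>) \<Rightarrow> merge n \<sigma> \<tau>) \<in> Pow (crossings filled_diagram)"
      by (auto simp: x(1))
  qed
  show "(\<lambda>\<rho>. (Base -` \<rho>, \<lambda>j\<in>{..<n}. Filling j -` \<rho>)) ` Pow (crossings filled_diagram) \<subseteq> ?D"
  proof (rule image_subsetI)
    fix \<rho> assume "\<rho> \<in> Pow (crossings filled_diagram)"
    then have \<rho>: "\<rho> \<subseteq> merge n (crossings T) (\<lambda>j. crossings (S j))" by (simp add: crossings_fill)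
    have "Base -` \<rho> \<subseteq> crossings T"
    proof
      fix c assume "c \<in> Base -` \<rho>"
      then have "Base c \<in> merge n (crossings T) (\<lambda>j. crossings (S j))" using \<rho> by blast
      then show "c \<in> crossings T" by simp
    qed
    moreover have "Filling j -` \<rho> \<subseteq> crossings (S j)" for j
    proof
      fix c assume "c \<in> Filling j -` \<rho>"
      then have "Filling j c \<in> merge n (crossings T) (\<lambda>j. crossings (S j))" using \<rho> by blast
      then show "c \<in> crossings (S j)" by simp
    qed
    ultimately show "(Base -` \<rho>, \<lambda>j\<in>{..<n}. Filling j -` \<rho>) \<in> ?D" by auto
  qed
qed

lemma state_sum_alt:
  "finite (crossings L) \<Longrightarrow>
    state_sum m L H d = (\<Sum>\<sigma>\<in>Pow (crossings L). of_bool (one_circle m L \<sigma> H d) * state_weight L \<sigma>)"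
  unfolding state_sum_def
  by (rule sum.mono_neutral_cong_left) auto

text \<open>Once the types \<open>B\<close> are fixed, the states of the base and of the fillings
  vary independently, so the sum over states factors.\<close>

lemma state_sum_fill:
  "state_sum holes filled_diagram H d =
    (\<Sum>B\<in>Pow {..<n}. state_sum n T B d * (\<Prod>j<n. state_sum (k j) (S j) (block k H j) (j \<in> B)))"
proof -
  let ?P = "Pi\<^sub>E {..<n} (\<lambda>j. Pow (crossings (S j)))"
  let ?t = "\<lambda>\<sigma> B. of_bool (one_circle n T \<sigma> B d) * state_weight T \<sigma>"
  let ?s = "\<lambda>B j \<tau>. of_bool (one_circle (k j) (S j) \<tau> (block k H j) (j \<in> B)) * state_weight (S j) \<tau>"
  have fin: "finite (crossings filled_diagram)"
    unfolding crossings_fill merge_def using finite_crossings_base finite_crossings_filling by simp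
  have "state_sum holes filled_diagram H d = (\<Sum>(\<sigma>, \<tau>)\<in>Pow (crossings T) \<times> ?P.
      of_bool (one_circle holes filled_diagram (merge n \<sigma> \<tau>) H d) * state_weight filled_diagram (merge n \<sigma> \<tau>))"
    unfolding state_sum_alt[OF fin] sum.reindex_bij_betw[OF bij_merge, symmetric]
    by (simp add: case_prod_unfold)
  also have "\<dots> = (\<Sum>(\<sigma>, \<tau>)\<in>Pow (crossings T) \<times> ?P. \<Sum>B\<in>Pow {..<n}. ?t \<sigma> B * (\<Prod>j<n. ?s B j (\<tau> j)))"
  proof (rule sum.cong[OF refl], clarify)
    fix \<sigma> \<tau> assume *: "\<sigma> \<subseteq> crossings T" "\<tau> \<in> ?P"
    then have \<tau>: "\<tau> j \<subseteq> crossings (S j)" if "j < n" for j using that by (auto simp: PiE_def Pi_def)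
    have weight: "state_weight filled_diagram (merge n \<sigma> \<tau>)
        = state_weight T \<sigma> * (\<Prod>j<n. state_weight (S j) (\<tau> j))"
      using *(1) \<tau> by (rule state_weight_merge)
    have sum: "(of_bool (one_circle holes filled_diagram (merge n \<sigma> \<tau>) H d) :: complex) =
        (\<Sum>B\<in>Pow {..<n}. of_bool (one_circle n T \<sigma> B d) *
          (\<Prod>j<n. of_bool (one_circle (k j) (S j) (\<tau> j) (block k H j) (j \<in> B))))"
      using \<tau> by (rule one_circle_fill_sum)
    show "of_bool (one_circle holes filled_diagram (merge n \<sigma> \<tau>) H d) * state_weight filled_diagram (merge n \<sigma> \<tau>)
        = (\<Sum>B\<in>Pow {..<n}. ?t \<sigma> B * (\<Prod>j<n. ?s B j (\<tau> j)))"
      unfolding sum weight sum_distrib_right prod.distrib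
      by (simp only: mult_ac)
  qed
  also have "\<dots> = (\<Sum>B\<in>Pow {..<n}. \<Sum>\<sigma>\<in>Pow (crossings T). \<Sum>\<tau>\<in>?P. ?t \<sigma> B * (\<Prod>j<n. ?s B j (\<tau> j)))"
    unfolding sum.cartesian_product[symmetric]
    by (simp only: sum.swap[of _ "Pow {..<n}"])
  also have "\<dots> = (\<Sum>B\<in>Pow {..<n}. (\<Sum>\<sigma>\<in>Pow (crossings T). ?t \<sigma> B) * (\<Sum>\<tau>\<in>?P. \<Prod>j<n. ?s B j (\<tau> j)))"
    by (simp only: sum_distrib_left[symmetric] sum_distrib_right[symmetric])
  also have "\<dots> = (\<Sum>B\<in>Pow {..<n}. (\<Sum>\<sigma>\<in>Pow (crossings T). ?t \<sigma> B) * (\<Prod>j<n. \<Sum>\<tau>\<in>Pow (crossings (S j)). ?s B j \<tau>))"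
    using finite_crossings_filling by (subst prod_sum_PiE) simp_all
  also have "\<dots> = (\<Sum>B\<in>Pow {..<n}. state_sum n T B d * (\<Prod>j<n. state_sum (k j) (S j) (block k H j) (j \<in> B)))"
    using finite_crossings_base finite_crossings_filling by (simp add: state_sum_alt)
  finally show ?thesis .
qed

end

section \<open>Lexicographic enumeration\<close>

lemma bij_lex_nth: "finite B \<Longrightarrow> bij_betw (lex_nth B) {..<card B} B"
  unfolding lex_nth_def by (rule bij_betw_nth) simp_all

text \<open>A strictly increasing map preserves strictly sorted lists, and these are determined by
  their sets.\<close>

lemma lex_nth_image:
  assumes "finite B" and mono: "\<And>x y. x \<in> B \<Longrightarrow> y \<in> B \<Longrightarrow> x < y \<Longrightarrow> f x < f y"
    and "r < card B"
  shows "lex_nth (f ` B) r = f (lex_nth B r)"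
proof -
  have "sorted_wrt (<) (map f (sorted_list_of_set B))"
    unfolding sorted_wrt_map
    by (rule sorted_wrt_mono_rel[OF _ strict_sorted_list_of_set]) (use mono assms(1) in auto)
  moreover have "set (map f (sorted_list_of_set B)) = set (sorted_list_of_set (f ` B))"
    using assms(1) by simp
  ultimately have "sorted_list_of_set (f ` B) = map f (sorted_list_of_set B)"
    using strict_sorted_equal strict_sorted_list_of_set by metis
  then show ?thesis using assms(3) by (simp add: lex_nth_def)
qed

lemma append_less:
  fixes u u' v v' :: "nat list"
  assumes "length u = length u'" "u < u'"
  shows "u @ v < u' @ v'"
  using assms by (induction u u' rule: list_induct2) auto

lemma append_less_cancel: "(u @ v < u @ v') \<longleftrightarrow> v < (v' :: nat list)"
  by (induction u) auto

lemma list_less_first_difference: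
  fixes xs ys :: "nat list"
  assumes "length xs = length ys" "xs < ys"
  shows "\<exists>j<length xs. (\<forall>i<j. xs ! i = ys ! i) \<and> xs ! j < ys ! j"
  using assms
proof (induction xs ys rule: list_induct2)
  case (Cons x xs y ys)
  show ?case
  proof (cases "x < y")
    case True
    then show ?thesis by (intro exI[of _ 0]) simp
  next
    case False
    then have "x = y" "xs < ys" using Cons.prems by auto
    then obtain j where "j < length xs" "\<forall>i<j. xs ! i = ys ! i" "xs ! j < ys ! j"
      using Cons.IH by blast
    then show ?thesis using \<open>x = y\<close>
      by (intro exI[of _ "Suc j"]) (auto simp: nth_Cons split: nat.split)
  qed
qed simp

lemma concat_blocks:
  fixes k :: "nat \<Rightarrow> nat"
  assumes "\<And>j. j < n \<Longrightarrow> length (f j) = k j"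
  shows "length (concat (map f [0..<n])) = (\<Sum>j<n. k j)
    \<and> (\<forall>j<n. \<forall>h<k j. concat (map f [0..<n]) ! ((\<Sum>i<j. k i) + h) = f j ! h)"
  using assms
proof (induction n)
  case (Suc n)
  then have len: "length (concat (map f [0..<n])) = (\<Sum>j<n. k j)"
    and nth: "\<And>j h. j < n \<Longrightarrow> h < k j \<Longrightarrow> concat (map f [0..<n]) ! ((\<Sum>i<j. k i) + h) = f j ! h"
    by (simp_all del: map_append)
  have "(concat (map f [0..<n]) @ f n) ! ((\<Sum>i<j. k i) + h) = f j ! h" if "j < Suc n" "h < k j" for j h
  proof (cases "j < n")
    case True
    then show ?thesis using len nth[OF True that(2)] hole_block_less[of j n h k] True that(2) by (simp add: nth_append)
  next
    case False
    then have "j = n" using that(1) by simp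
    then show ?thesis using len by (simp add: nth_append)
  qed
  then show ?case using len Suc.prems by simp
qed simp

lemma finite_card_binary:
  "finite (listset (replicate m {1, 2::nat})) \<and> card (listset (replicate m {1, 2::nat})) = 2 ^ m"
  using finite_card_listset[of "replicate m {1, 2::nat}"]
  by (auto simp: prod_list_replicate numeral_2_eq_2[symmetric])

lemma binary_iff:
  "xs \<in> listset (replicate m {1, 2::nat}) \<longleftrightarrow> length xs = m \<and> (\<forall>i<m. xs ! i \<in> {1, 2})"
  by (auto simp: listset_conv)

lemma bij_alpha: "bij_betw (alpha m) {..<2 ^ m} (listset (replicate m {1, 2}))"
  unfolding alpha_def using bij_lex_nth finite_card_binary by metis

lemma alpha_in: "r < 2 ^ m \<Longrightarrow> alpha m r \<in> listset (replicate m {1, 2})"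
  using bij_betwE[OF bij_alpha[of m]] by simp

lemma length_alpha [simp]: "r < 2 ^ m \<Longrightarrow> length (alpha m r) = m"
  using alpha_in binary_iff by blast

lemma alpha_less: "r < s \<Longrightarrow> s < 2 ^ m \<Longrightarrow> alpha m r < alpha m s"
proof -
  let ?B = "listset (replicate m {1, 2::nat})"
  assume "r < s" "s < 2 ^ m"
  then have "s < length (sorted_list_of_set ?B)" using finite_card_binary[of m] by simp
  then show ?thesis unfolding alpha_def lex_nth_def
    using sorted_wrt_nth_less[OF strict_sorted_list_of_set \<open>r < s\<close>] by blast
qed

definition indices :: "nat \<Rightarrow> (nat \<Rightarrow> nat) \<Rightarrow> nat list set" where
  "indices n k = listset (map (\<lambda>j. {1..2 ^ k j}) [0..<n])"

lemma indices_iff: "xs \<in> indices n k \<longleftrightarrow> length xs = n \<and> (\<forall>j<n. xs ! j \<in> {1..2 ^ k j})"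
  by (auto simp: indices_def listset_conv)

lemma finite_card_indices: "finite (indices n k) \<and> card (indices n k) = 2 ^ (\<Sum>j<n. k j)"
proof -
  have "(\<Prod>j\<leftarrow>[0..<n]. 2 ^ k j) = (2::nat) ^ (\<Sum>j<n. k j)"
    by (induction n) (simp_all add: power_add mult.commute)
  then show ?thesis
    using finite_card_listset[of "map (\<lambda>j. {1..2 ^ k j}) [0..<n] :: nat set list"]
    by (simp add: indices_def o_def)
qed

text \<open>The column of the filled diagram addressed by a tuple of columns of the fillings. Index
  tuples start at 1 and \<open>alpha\<close> counts from 0, hence the subtraction.\<close>

definition block_alpha :: "nat \<Rightarrow> (nat \<Rightarrow> nat) \<Rightarrow> nat list \<Rightarrow> nat list" where
  "block_alpha n k xs = concat (map (\<lambda>j. alpha (k j) (xs ! j - 1)) [0..<n])"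

lemma index_less: "xs \<in> indices n k \<Longrightarrow> j < n \<Longrightarrow> xs ! j - 1 < 2 ^ k j"
proof -
  assume "xs \<in> indices n k" "j < n"
  then have "1 \<le> xs ! j" "xs ! j \<le> 2 ^ k j" by (auto simp: indices_iff)
  then show ?thesis by linarith
qed

lemma
  assumes "xs \<in> indices n k"
  shows length_block_alpha: "length (block_alpha n k xs) = (\<Sum>j<n. k j)"
    and block_alpha_nth: "\<And>j h. j < n \<Longrightarrow> h < k j \<Longrightarrow>
      block_alpha n k xs ! ((\<Sum>i<j. k i) + h) = alpha (k j) (xs ! j - 1) ! h"
  using concat_blocks[of n "\<lambda>j. alpha (k j) (xs ! j - 1)" k] index_less[OF assms]
  unfolding block_alpha_def by simp_all

lemma block_alpha_in:
  assumes "xs \<in> indices n k"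
  shows "block_alpha n k xs \<in> listset (replicate (\<Sum>j<n. k j) {1, 2})"
  unfolding binary_iff
proof (intro conjI allI impI)
  fix i assume "i < (\<Sum>j<n. k j)"
  then obtain j h where jh: "j < n" "h < k j" "i = (\<Sum>i<j. k i) + h"
    using hole_block_exists by blast
  then show "block_alpha n k xs ! i \<in> {1, 2}"
    using block_alpha_nth[OF assms jh(1,2)] alpha_nth[OF index_less[OF assms jh(1)] jh(2)] by simp
qed (rule length_block_alpha[OF assms])

text \<open>The block at position \<open>j\<close> always has length \<open>k j\<close>, so the
  first differing index decides the comparison of the concatenations.\<close>

lemma block_alpha_less:
  assumes xs: "xs \<in> indices n k" and ys: "ys \<in> indices n k" and "xs < ys"
  shows "block_alpha n k xs < block_alpha n k ys"
proof -
  have "length xs = n" "length ys = n" using xs ys by (simp_all add: indices_iff)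
  then obtain j where j: "j < n" "\<forall>i<j. xs ! i = ys ! i" "xs ! j < ys ! j"
    using list_less_first_difference[of xs ys] \<open>xs < ys\<close> by auto
  let ?f = "\<lambda>zs j. alpha (k j) (zs ! j - 1)"
  have split: "block_alpha n k zs = concat (map (?f zs) [0..<j]) @ ?f zs j @ concat (map (?f zs) [Suc j..<n])" for zs
  proof -
    have "[0..<n] = [0..<j] @ j # [Suc j..<n]"
      using upt_add_eq_append[of 0 j "n - j"] upt_conv_Cons[OF j(1)] j(1) by simp
    then show ?thesis by (simp add: block_alpha_def)
  qed
  have "concat (map (?f xs) [0..<j]) = concat (map (?f ys) [0..<j])"
    using j(2) by (intro arg_cong[of _ _ concat] map_cong) auto
  moreover have "?f xs j < ?f ys j"
  proof (rule alpha_less)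
    show "ys ! j - 1 < 2 ^ k j" using index_less[OF ys j(1)] .
    have "1 \<le> xs ! j" using xs j(1) by (auto simp: indices_iff)
    then show "xs ! j - 1 < ys ! j - 1" using j(3) by linarith
  qed
  ultimately show ?thesis
    unfolding split using index_less[OF xs j(1)] index_less[OF ys j(1)]
    by (simp add: append_less_cancel append_less)
qed

lemma gamma_in: "s < 2 ^ (\<Sum>j<n. k j) \<Longrightarrow> gamma n k s \<in> indices n k"
  using lex_nth_in[of "indices n k" s] finite_card_indices[of n k]
  by (simp add: gamma_def indices_def)

text \<open>\<open>block_alpha\<close> is strictly increasing, hence injective, and the two sets
  have the same size; an increasing bijection commutes with the enumerations. So the order of the
  tuples \<open>\<gamma>\<close> matches the order in which the holes of the filled diagram are
  numbered.\<close>

lemma alpha_sum: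
  assumes "s < 2 ^ (\<Sum>j<n. k j)"
  shows "alpha (\<Sum>j<n. k j) s = block_alpha n k (gamma n k s)"
proof -
  let ?L = "listset (replicate (\<Sum>j<n. k j) {1, 2::nat})"
  have "inj_on (block_alpha n k) (indices n k)"
  proof (rule inj_onI)
    fix xs ys assume "xs \<in> indices n k" "ys \<in> indices n k" "block_alpha n k xs = block_alpha n k ys"
    then show "xs = ys"
      using block_alpha_less[of xs n k ys] block_alpha_less[of ys n k xs] by (metis less_irrefl linorder_neqE)
  qed
  then have "card (block_alpha n k ` indices n k) = card ?L"
    using finite_card_binary finite_card_indices by (metis card_image)
  then have "block_alpha n k ` indices n k = ?L"
    using block_alpha_in finite_card_binary by (intro card_subset_eq) blast+
  moreover have "lex_nth (block_alpha n k ` indices n k) s = block_alpha n k (lex_nth (indices n k) s)"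
    using finite_card_indices[of n k] block_alpha_less assms by (intro lex_nth_image) auto
  ultimately show ?thesis by (simp add: alpha_def gamma_def indices_def)
qed

section \<open>Columns as sets of holes\<close>

definition twos :: "nat \<Rightarrow> nat \<Rightarrow> nat set" where
  "twos m r = {h. h < m \<and> alpha m r ! h \<noteq> 1}"

text \<open>Turns sums over columns into sums over subsets of the holes, the form in which the state
  sums arise.\<close>

lemma bij_twos: "bij_betw (twos m) {..<2 ^ m} (Pow {..<m})"
proof -
  have inj: "inj_on (twos m) {..<2 ^ m}"
  proof (rule inj_onI)
    fix r s assume rs: "r \<in> {..<2 ^ m}" "s \<in> {..<2 ^ m}" "twos m r = twos m s"
    have "alpha m r = alpha m s"
    proof (rule nth_equalityI)
      fix i assume "i < length (alpha m r)"
      then have i: "i < m" using rs by simp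
      have "i \<in> twos m r \<longleftrightarrow> i \<in> twos m s" using rs(3) by simp
      then show "alpha m r ! i = alpha m s ! i"
        using i alpha_nth[of r m i] alpha_nth[of s m i] rs(1,2) by (auto simp: twos_def)
    qed (use rs in simp)
    then show "r = s" using bij_betw_imp_inj_on[OF bij_alpha[of m]] rs(1,2) by (meson inj_onD)
  qed
  moreover have "twos m ` {..<2 ^ m} = Pow {..<m}"
  proof (rule card_subset_eq)
    show "card (twos m ` {..<2 ^ m}) = card (Pow {..<m})"
      using card_image[OF inj] by (simp add: card_Pow)
  qed (auto simp: twos_def)
  ultimately show ?thesis by (simp add: bij_betw_def)
qed

lemma twos_subset: "twos m r \<subseteq> {..<m}"
  by (auto simp: twos_def)

lemma count_list_alpha: "r < 2 ^ m \<Longrightarrow> count_list (alpha m r) 2 = card (twos m r)"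
proof -
  assume r: "r < 2 ^ m"
  have "count_list (alpha m r) 2 = card {i. i < m \<and> 2 = alpha m r ! i}"
    using r by (simp add: count_list_eq_length_filter length_filter_conv_card)
  also have "{i. i < m \<and> 2 = alpha m r ! i} = twos m r"
    unfolding twos_def
  proof (rule Collect_cong)
    fix i
    show "i < m \<and> 2 = alpha m r ! i \<longleftrightarrow> i < m \<and> alpha m r ! i \<noteq> 1"
      using alpha_nth[OF r, of i] by auto
  qed
  finally show ?thesis .
qed

lemma block_twos:
  assumes "s < 2 ^ (\<Sum>j<n. k j)" "j < n"
  shows "block k (twos (\<Sum>j<n. k j) s) j = twos (k j) (gamma n k s ! j - 1)"
  using block_alpha_nth[OF gamma_in[OF assms(1)] assms(2)] hole_block_less[of j n _ k] assms(2)
  by (auto simp: block_def twos_def alpha_sum[OF assms(1)])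

lemma sum_blocks:
  fixes k :: "nat \<Rightarrow> nat" and f :: "nat \<Rightarrow> nat"
  shows "(\<Sum>q<(\<Sum>j<n. k j). f q) = (\<Sum>j<n. \<Sum>h<k j. f ((\<Sum>i<j. k i) + h))"
proof (induction n)
  case (Suc n)
  have "(\<Sum>q<a + b. f q) = (\<Sum>q<a. f q) + (\<Sum>h<b. f (a + h))" for a b :: nat
    by (induction b) (simp_all add: add.assoc)
  then show ?case using Suc by simp
qed simp

lemma card_blocks:
  assumes "H \<subseteq> {..<(\<Sum>j<n. k j)}"
  shows "card H = (\<Sum>j<n. card (block k H j))"
proof -
  have card: "card {q. q < m \<and> P q} = (\<Sum>q<m. of_bool (P q))" for m and P :: "nat \<Rightarrow> bool"
    by (simp add: of_bool_def sum.If_cases Collect_conj_eq Int_commute lessThan_def)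
  have "H = {q. q < (\<Sum>j<n. k j) \<and> q \<in> H}" using assms by auto
  then have "card H = card {q. q < (\<Sum>j<n. k j) \<and> q \<in> H}" by (rule arg_cong)
  then show ?thesis unfolding block_def card sum_blocks .
qed

section \<open>The matrices\<close>

definition entry :: "nat \<Rightarrow> 'v diagram \<Rightarrow> bool \<Rightarrow> nat set \<Rightarrow> complex" where
  "entry m T d H = (- \<i>) ^ card H * (if d then \<i> else 1) * state_sum m T H d"

lemma X_entry:
  assumes "r < 2" "s < 2 ^ m"
  shows "X m T $$ (r, s) = entry m T (r \<noteq> 0) (twos m s)"
  using assms
  by (simp add: X_def entry_def bracket_closed_filling count_list_alpha twos_def)

lemma X_dim [simp]: "dim_row (X m T) = 2" "dim_col (X m T) = 2 ^ m"
  by (simp_all add: X_def)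

lemma (in filled) entry_fill:
  assumes H: "H \<subseteq> {..<holes}"
  shows "entry holes filled_diagram d H =
    (\<Sum>B\<in>Pow {..<n}. entry n T d B * (\<Prod>j<n. entry (k j) (S j) (j \<in> B) (block k H j)))"
proof -
  let ?c = "if d then \<i> else 1"
  have "entry n T d B * (\<Prod>j<n. entry (k j) (S j) (j \<in> B) (block k H j))
      = (- \<i>) ^ card H * ?c * (state_sum n T B d * (\<Prod>j<n. state_sum (k j) (S j) (block k H j) (j \<in> B)))"
    if B: "B \<subseteq> {..<n}" for B
  proof -
    have "(\<Prod>j<n. (- \<i>) ^ card (block k H j)) = (- \<i>) ^ card H"
      unfolding card_blocks[OF H] by (simp add: power_sum)
    moreover have "(\<Prod>j<n. if j \<in> B then \<i> else 1) = \<i> ^ card B"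
      using B by (simp add: prod.If_cases Int_absorb1)
    moreover have "(- \<i>) ^ card B * \<i> ^ card B = 1"
      by (simp flip: power_mult_distrib)
    ultimately show ?thesis
      unfolding entry_def prod.distrib by (simp add: algebra_simps)
  qed
  then have "(\<Sum>B\<in>Pow {..<n}. entry n T d B * (\<Prod>j<n. entry (k j) (S j) (j \<in> B) (block k H j)))
      = (\<Sum>B\<in>Pow {..<n}. (- \<i>) ^ card H * ?c * (state_sum n T B d * (\<Prod>j<n. state_sum (k j) (S j) (block k H j) (j \<in> B))))"
    by (intro sum.cong) auto
  then show ?thesis
    unfolding entry_def state_sum_fill sum_distrib_left[symmetric] by simp
qed

text \<open>This identity of complex entries is exact; roots of unity appear only in the passage to
  integer matrices.\<close>

lemma (in filled) X_fill:
  assumes r: "r < 2" and s: "s < 2 ^ holes"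
  shows "X holes filled_diagram $$ (r, s) = (\<Sum>q<2 ^ n. X n T $$ (r, q) *
    (\<Prod>j<n. X (k j) (S j) $$ (alpha n q ! j - 1, gamma n k s ! j - 1)))"
proof -
  have idx: "gamma n k s ! j - 1 < 2 ^ k j" if "j < n" for j
    using index_less[OF gamma_in[OF s] that] .
  have "X holes filled_diagram $$ (r, s) = entry holes filled_diagram (r \<noteq> 0) (twos holes s)"
    using r s by (rule X_entry)
  also have "\<dots> = (\<Sum>B\<in>Pow {..<n}. entry n T (r \<noteq> 0) B *
      (\<Prod>j<n. entry (k j) (S j) (j \<in> B) (twos (k j) (gamma n k s ! j - 1))))"
    unfolding entry_fill[OF twos_subset] by (intro sum.cong refl) (simp add: block_twos[OF s])
  also have "\<dots> = (\<Sum>q<2 ^ n. entry n T (r \<noteq> 0) (twos n q) *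
      (\<Prod>j<n. entry (k j) (S j) (j \<in> twos n q) (twos (k j) (gamma n k s ! j - 1))))"
    by (rule sum.reindex_bij_betw[OF bij_twos, symmetric])
  also have "\<dots> = (\<Sum>q<2 ^ n. X n T $$ (r, q) *
    (\<Prod>j<n. X (k j) (S j) $$ (alpha n q ! j - 1, gamma n k s ! j - 1)))"
  proof (intro sum.cong refl arg_cong2[of _ _ _ _ "(*)"] prod.cong)
    fix q assume "q \<in> {..<2 ^ n :: nat}"
    then have q: "q < 2 ^ n" by simp
    show "entry n T (r \<noteq> 0) (twos n q) = X n T $$ (r, q)"
      by (rule X_entry[OF r q, symmetric])
    fix j assume "j \<in> {..<n}"
    then have j: "j < n" by simp
    have "alpha n q ! j - 1 < 2" "(alpha n q ! j - 1 \<noteq> 0) = (j \<in> twos n q)"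
      using alpha_nth[OF q j] j by (auto simp: twos_def)
    then show "entry (k j) (S j) (j \<in> twos n q) (twos (k j) (gamma n k s ! j - 1))
        = X (k j) (S j) $$ (alpha n q ! j - 1, gamma n k s ! j - 1)"
      using idx[OF j] by (simp add: X_entry)
  qed
  finally show ?thesis .
qed

lemma cis_pi4_power2: "cis (pi / 4) ^ 2 = \<i>"
  by (simp add: DeMoivre)

context plane_tangle
begin

text \<open>With a splittings of type A among c crossings the exponent is 2 a - c, and the square of
  \<open>cis (pi / 4)\<close> is \<open>\<i>\<close>. So the weight depends on the state only
  through a power of \<open>\<i>\<close>.\<close>

lemma state_weight_eq:
  assumes "\<sigma> \<subseteq> crossings T"
  shows "state_weight T \<sigma> = \<i> ^ card \<sigma> / cis (pi / 4) ^ card (crossings T)"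
proof -
  let ?A = "cis (pi / 4)"
  have "finite \<sigma>" using assms finite_crossings finite_subset by blast
  then have c: "card (crossings T) = card \<sigma> + card (crossings T - \<sigma>)"
    using assms by (metis card_Diff_subset card_mono finite_crossings le_add_diff_inverse)
  have "\<i> ^ card \<sigma> = ?A ^ card \<sigma> * ?A ^ card \<sigma>"
    unfolding cis_pi4_power2[symmetric] power_mult[symmetric] by (simp add: power_add mult_2)
  then show ?thesis
    unfolding state_weight_def c by (simp add: power_int_diff power_add)
qed

text \<open>
  By parity, the powers of \<open>\<i>\<close> contributed by the states with one circle agree up to sign.
\<close>

lemma common_phase:
  "\<exists>w a. w ^ 8 = 1 \<and> (\<forall>d. \<forall>H\<subseteq>{..<n}. entry n T d H = w * of_int (a d H))"
proof -
  let ?S = "\<lambda>H d. {\<sigma>. \<sigma> \<subseteq> crossings T \<and> one_circle n T \<sigma> H d}"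
  let ?e = "\<lambda>\<sigma> H d. card \<sigma> + card H + of_bool d"
  \<comment> \<open>\<open>p\<close> says whether the exponent is even, for all states with one
    circle and all fillings and closures; if there are no such states, any value will do.\<close>
  have "\<exists>p. \<forall>d. \<forall>H\<subseteq>{..<n}. \<forall>\<sigma>\<in>?S H d. even (?e \<sigma> H d) = p"
  proof (cases "\<exists>d. \<exists>H\<subseteq>{..<n}. ?S H d \<noteq> {}")
    case True
    then obtain d H \<sigma> where 0: "H \<subseteq> {..<n}" "\<sigma> \<subseteq> crossings T" "one_circle n T \<sigma> H d" by blast
    have "even (?e \<sigma>' H' d') = even (?e \<sigma> H d)" if "H' \<subseteq> {..<n}" "\<sigma>' \<in> ?S H' d'" for d' H' \<sigma>'
      by (rule one_circle_parity) (use that 0 in auto)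
    then show ?thesis by (intro exI[of _ "even (?e \<sigma> H d)"] allI impI ballI)
  next
    case False
    then show ?thesis by (intro exI[of _ True] allI impI ballI) (metis empty_iff)
  qed
  then obtain p where "\<forall>d. \<forall>H\<subseteq>{..<n}. \<forall>\<sigma>\<in>?S H d. even (?e \<sigma> H d) = p" ..
  then have p: "even (?e \<sigma> H d) = p" if "H \<subseteq> {..<n}" "\<sigma> \<in> ?S H d" for d H \<sigma>
    using that by simp
  \<comment> \<open>If the common parity is odd, one factor \<open>\<i>\<close> is split off, so
    that even powers of \<open>\<i>\<close>, that is signs, remain.\<close>
  define u where "u = (if p then 1 else \<i>)"
  define w where "w = u / cis (pi / 4) ^ card (crossings T)"
  \<comment> \<open>As \<open>- \<i>\<close> is -1 times \<open>\<i>\<close>, a state contributes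
    \<open>(- 1) ^ card H\<close> times the power of \<open>\<i>\<close> with exponent
    \<open>?e\<close>; without \<open>u\<close> that power is a sign with half the exponent, rounded
    down.\<close>
  define a :: "bool \<Rightarrow> nat set \<Rightarrow> int"
    where "a d H = (\<Sum>\<sigma>\<in>?S H d. (- 1) ^ (card H + ?e \<sigma> H d div 2))" for d H
  have "cis (pi / 4) ^ 8 = (cis (pi / 4) ^ 2) ^ 4"
    by (simp only: power_mult[symmetric]) simp
  then have A8: "cis (pi / 4) ^ 8 = 1" unfolding cis_pi4_power2 by simp
  have "(cis (pi / 4) ^ card (crossings T)) ^ 8 = 1"
    by (metis A8 power_mult mult.commute power_one)
  moreover have "\<i> ^ 8 = (\<i> ^ 4) ^ 2" by (simp only: power_mult[symmetric]) simp
  then have "u ^ 8 = 1" by (simp add: u_def)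
  ultimately have "w ^ 8 = 1" by (simp add: w_def power_divide)
  moreover have "entry n T d H = w * of_int (a d H)" if H: "H \<subseteq> {..<n}" for d H
  proof -
    have "(- \<i>) ^ card H * (if d then \<i> else 1) * state_weight T \<sigma>
        = w * of_int ((- 1) ^ (card H + ?e \<sigma> H d div 2))" if \<sigma>: "\<sigma> \<in> ?S H d" for \<sigma>
    proof -
      have "\<i> ^ ?e \<sigma> H d = u * (- 1) ^ (?e \<sigma> H d div 2)"
      proof (cases "even (?e \<sigma> H d)")
        case True
        then have "?e \<sigma> H d = 2 * (?e \<sigma> H d div 2)" by simp
        then have "\<i> ^ ?e \<sigma> H d = (\<i>\<^sup>2) ^ (?e \<sigma> H d div 2)" by (metis power_mult)
        then show ?thesis using p[OF H \<sigma>] True by (simp add: u_def)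
      next
        case False
        then have "?e \<sigma> H d = Suc (2 * (?e \<sigma> H d div 2))" by simp
        then have "\<i> ^ ?e \<sigma> H d = \<i> * (\<i>\<^sup>2) ^ (?e \<sigma> H d div 2)" by (metis power_mult power_Suc)
        then show ?thesis using p[OF H \<sigma>] False by (simp add: u_def)
      qed
      moreover have "(- \<i>) ^ card H * (if d then \<i> else 1) * \<i> ^ card \<sigma> = (- 1) ^ card H * \<i> ^ ?e \<sigma> H d"
        unfolding power_minus[of \<i>] by (simp add: power_add)
      ultimately show ?thesis
        using \<sigma> by (simp add: state_weight_eq w_def power_add)
    qed
    then show ?thesis
      unfolding entry_def state_sum_def sum_distrib_left a_def of_int_sum by (intro sum.cong) auto
  qed
  ultimately show ?thesis by blast
qed

lemma X_integral:
  "\<exists>w M. w ^ 8 = 1 \<and> M \<in> carrier_mat 2 (2 ^ n) \<and> X n T = w \<cdot>\<^sub>m map_mat of_int M"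
proof -
  obtain w a where w: "w ^ 8 = 1" "\<And>d H. H \<subseteq> {..<n} \<Longrightarrow> entry n T d H = w * of_int (a d H)"
    using common_phase by blast
  define M where "M = mat 2 (2 ^ n) (\<lambda>(r, s). a (r \<noteq> 0) (twos n s))"
  have "X n T = w \<cdot>\<^sub>m map_mat of_int M"
    by (rule eq_matI) (simp_all add: M_def X_entry w(2)[OF twos_subset])
  then show ?thesis using w(1) by (intro exI[of _ w] exI[of _ M]) (simp add: M_def)
qed

end

section \<open>Integer representatives up to sign\<close>

lemma integer_root_of_unity:
  fixes u :: complex and a b :: int
  assumes "u ^ 8 = 1" "of_int b = u * of_int a" "a \<noteq> 0"
  shows "u = 1 \<or> u = - 1"
proof -
  have "norm u ^ 8 = 1" using assms(1) by (metis norm_one norm_power)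
  then have "norm u = 1" by (intro power_eq_imp_eq_base[of "norm u" 8 1]) auto
  then have "\<bar>b\<bar> = \<bar>a\<bar>"
    using arg_cong[OF assms(2), of norm] by (simp add: norm_mult flip: of_int_abs)
  then have "b = a \<or> b = - a" by linarith
  then show ?thesis
  proof
    assume "b = a"
    then show ?thesis using assms(2,3) by simp
  next
    assume "b = - a"
    then have "u * of_int a = - of_int a" using assms(2) by simp
    then have "(u + 1) * of_int a = 0" unfolding distrib_right by simp
    then show ?thesis using assms(3) by (simp add: eq_neg_iff_add_eq_0)
  qed
qed

text \<open>Two integer multiples of \<open>X m T\<close> by eighth roots of unity differ by such a
  root, which maps a nonzero integer entry to an integer; comparing absolute values leaves only a
  sign.\<close>

lemma F_eq_pm_class:
  assumes w: "w ^ 8 = 1" and M: "M \<in> carrier_mat 2 (2 ^ m)" and X: "X m T = w \<cdot>\<^sub>m map_mat of_int M"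
  shows "F m T = pm_class M"
proof (intro equalityI subsetI)
  fix N assume "N \<in> F m T"
  then obtain z where z: "z ^ 8 = 1" "map_mat of_int N = z \<cdot>\<^sub>m X m T" by (auto simp: F_def)
  have dims: "dim_row N = 2" "dim_col N = 2 ^ m"
    using arg_cong[OF z(2), of dim_row] arg_cong[OF z(2), of dim_col] by simp_all
  have entries: "of_int (N $$ (r, s)) = z * w * of_int (M $$ (r, s))" if "r < 2" "s < 2 ^ m" for r s
    using arg_cong[OF z(2), of "\<lambda>A. A $$ (r, s)"] that M dims by (simp add: X)
  show "N \<in> pm_class M"
  proof (cases "\<exists>r<2. \<exists>s<2 ^ m. M $$ (r, s) \<noteq> 0")
    case True
    then obtain r s where rs: "r < 2" "s < 2 ^ m" "M $$ (r, s) \<noteq> 0" by blast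
    have "(z * w) ^ 8 = 1" using z(1) w by (simp add: power_mult_distrib)
    then have "z * w = 1 \<or> z * w = - 1"
      using integer_root_of_unity entries[OF rs(1,2)] rs(3) by blast
    then show ?thesis
    proof
      assume 1: "z * w = 1"
      have "N = M"
        by (rule eq_matI) (use entries M dims in \<open>auto simp: 1\<close>)
      then show ?thesis by (simp add: pm_class_def)
    next
      assume 1: "z * w = - 1"
      have "N $$ (r, s) = - M $$ (r, s)" if "r < 2" "s < 2 ^ m" for r s
        using entries[OF that] unfolding 1 by (metis mult_minus1 of_int_eq_iff of_int_minus)
      then have "N = - M"
        by (intro eq_matI) (use M dims in auto)
      then show ?thesis by (simp add: pm_class_def)
    qed
  next
    \<comment> \<open>If all entries of \<open>M\<close> vanish, the phase is not determined, but
      every phase gives the same matrix.\<close>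
    case False
    then have "N $$ (r, s) = M $$ (r, s)" if "r < 2" "s < 2 ^ m" for r s
      using entries[OF that] that by simp
    then have "N = M" by (intro eq_matI) (use M dims in auto)
    then show ?thesis by (simp add: pm_class_def)
  qed
next
  fix N assume "N \<in> pm_class M"
  then have N: "N = M \<or> N = - M" by (simp add: pm_class_def)
  have "w \<noteq> 0" using w by auto
  have "\<exists>z. z ^ 8 = 1 \<and> map_mat of_int N = z \<cdot>\<^sub>m X m T"
    using N
  proof
    assume "N = M"
    then show ?thesis
      using w \<open>w \<noteq> 0\<close> unfolding X
      by (intro exI[of _ "1 / w"]) (auto simp: power_divide intro!: eq_matI)
  next
    assume "N = - M"
    then show ?thesis
      using w \<open>w \<noteq> 0\<close> unfolding X
      by (intro exI[of _ "- 1 / w"]) (auto simp: power_divide intro!: eq_matI)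
  qed
  then show "N \<in> F m T" by (simp add: F_def)
qed

theorem theorem3p8:
  fixes n :: nat and k :: "nat \<Rightarrow> nat"
    and T :: "'v diagram" and S :: "nat \<Rightarrow> 'w diagram"
  assumes "n \<ge> 1"
    and "tangle_diagram n T"
    and "\<And>j. j < n \<Longrightarrow> tangle_diagram (k j) (S j)"
  shows "F (\<Sum>j<n. k j) (fill n k T S) = pm_times (F n T) (pm_eta n k (\<lambda>j. F (k j) (S j)))"
proof -
  interpret filled n k T S using assms(2,3) by unfold_locales
  interpret T: plane_tangle n T using assms(2) by unfold_locales
  obtain w M where M: "w ^ 8 = 1" "M \<in> carrier_mat 2 (2 ^ n)" "X n T = w \<cdot>\<^sub>m map_mat of_int M"
    using T.X_integral by blast
  have "\<forall>j<n. \<exists>w M. w ^ 8 = 1 \<and> M \<in> carrier_mat 2 (2 ^ k j) \<and> X (k j) (S j) = w \<cdot>\<^sub>m map_mat of_int M"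
    using plane_tangle.X_integral[OF plane_filling] by blast
  then obtain v b where b: "v j ^ 8 = 1" "b j \<in> carrier_mat 2 (2 ^ k j)"
    "X (k j) (S j) = v j \<cdot>\<^sub>m map_mat of_int (b j)" if "j < n" for j
    by metis
  \<comment> \<open>Every entry of \<open>eta n k b\<close> has exactly one factor from each
    filling, so the phases \<open>v j\<close> come out as a product, and \<open>W\<close> is again
    an eighth root of unity.\<close>
  define W where "W = w * (\<Prod>j<n. v j)"
  have eta: "eta n k b \<in> carrier_mat (2 ^ n) (2 ^ holes)" by (simp add: eta_def)
  have "X holes filled_diagram = W \<cdot>\<^sub>m map_mat of_int (M * eta n k b)"
  proof (rule eq_matI)
    fix r s
    assume "r < dim_row (W \<cdot>\<^sub>m map_mat of_int (M * eta n k b))"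
      "s < dim_col (W \<cdot>\<^sub>m map_mat of_int (M * eta n k b))"
    then have rs: "r < 2" "s < 2 ^ holes" using M(2) eta by simp_all
    have "X n T $$ (r, q) * (\<Prod>j<n. X (k j) (S j) $$ (alpha n q ! j - 1, gamma n k s ! j - 1))
        = W * of_int (M $$ (r, q) * eta n k b $$ (q, s))" if q: "q < 2 ^ n" for q
    proof -
      have "X (k j) (S j) $$ (alpha n q ! j - 1, gamma n k s ! j - 1)
          = v j * of_int (b j $$ (alpha n q ! j - 1, gamma n k s ! j - 1))" if j: "j < n" for j
      proof -
        have "alpha n q ! j - 1 < 2" using alpha_nth[OF q j] by auto
        then show ?thesis
          using b(2)[OF j] index_less[OF gamma_in[OF rs(2)] j] unfolding b(3)[OF j] by simp
      qed
      moreover have "X n T $$ (r, q) = w * of_int (M $$ (r, q))"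
        unfolding M(3) using M(2) rs(1) q by simp
      ultimately show ?thesis
        using q rs(2) by (simp add: eta_def W_def prod.distrib)
    qed
    then have "X holes filled_diagram $$ (r, s) = (\<Sum>q<2 ^ n. W * of_int (M $$ (r, q) * eta n k b $$ (q, s)))"
      unfolding X_fill[OF rs] by (intro sum.cong) auto
    moreover have "(M * eta n k b) $$ (r, s) = (\<Sum>q<2 ^ n. M $$ (r, q) * eta n k b $$ (q, s))"
      using M(2) eta rs by (simp add: scalar_prod_def lessThan_atLeast0)
    ultimately show "X holes filled_diagram $$ (r, s) = (W \<cdot>\<^sub>m map_mat of_int (M * eta n k b)) $$ (r, s)"
      using M(2) eta rs by (simp add: sum_distrib_left)
  qed (use M(2) eta in auto)
  moreover have "W ^ 8 = 1"
    using M(1) b(1) by (simp add: W_def power_mult_distrib prod_power_distrib)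
  moreover have "M * eta n k b \<in> carrier_mat 2 (2 ^ holes)" using M(2) eta by (rule mult_carrier_mat)
  ultimately have "F holes filled_diagram = pm_class (M * eta n k b)"
    using F_eq_pm_class by blast
  also have "\<dots> = pm_times (pm_class M) (pm_class (eta n k b))"
    using pm_times_pm_class[OF M(2) eta] by simp
  also have "pm_class M = F n T" using F_eq_pm_class[OF M] by simp
  also have "pm_class (eta n k b) = pm_eta n k (\<lambda>j. F (k j) (S j))"
    using b F_eq_pm_class by (intro pm_eta_pm_class[symmetric]) blast+
  finally show ?thesis .
qed

end
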